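(* Let $(Q,Q')$ be a completely extended linear quiver with $n=|Q_0|\ge2$. Let $\mathcal{G}$ be the set of GCCs and $\mathcal{P}$ the set of $T$-paths from $\mathfrak{v}$ to $\mathfrak{w}$. For a GCC $\{S_{i,r}\}$, form the edge sequence $\alpha'=(\alpha'_1,\dots,\alpha'_{2n+1})$ as follows: - $\alpha'_{2i}=T_i$ for $i\in[1,n]$; - for $i\in[1,n-1]$, $\alpha'_{2i+1}=T_i$ if $(|S_{i,1}|,|S_{i,2}|)=(\delta_i,1-\delta_i)$, $T_{i+1}$ if it equals $(1-\delta_i,\delta_i)$, and $T_{i,i+1}$ if it equals $(0,0)$; - $\alpha'_1=T_{1,0}$ if $|S_{1,1+\delta_1}|=1-\delta_1$ and $T_{1,1}$ otherwise; - $\alpha'_{2n+1}=T_{n,0}$ if $|S_{n-1,2-\delta_{n-1}}|=\delta_{n-1}$ and $T_{n,1}$ otherwise. Let $\psi_{\mathcal{G},\mathcal{P}}(\{S_{i,r}\})$ be the path obtained from $\alpha'$, viewed as a path from $\mathfrak{v}$ to $\mathfrak{w}$, by cancelling duplicate pairs, i.e. deleting pairs of consecutive identical edges. Then $\psi_{\mathcal{G},\mathcal{P}}$ is a well-defined bijection $\mathcal{G}\to\mathcal{P}$. Moreover, for $\alpha=\psi_{\mathcal{G},\mathcal{P}}(\{S_{i,r}\})$, $$\prod_{i=1}^n x_i^{-1}\prod_{i=0}^n y_i=x(\alpha).$$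
   Context: A linear quiver $Q$ has vertices $1,\dots,n$ with exactly one arrow between $i$ and $i+1$ for each $i\in[1,n-1]$, and no other arrows. Set $\delta_i=0$ if the arrow is $i\to i+1$ and $\delta_i=1$ otherwise. The completely extended linear quiver $Q'$ adds: - a vertex $(i,i+1)$ forming an oriented $3$-cycle with $i,i+1$, for each $i\in[1,n-1]$; - vertices $(1,0),(1,1)$ with $1\to(1,0)\to(1,1)\to1$; - vertices $(n,0),(n,1)$ with $n\to(n,0)\to(n,1)\to n$. Formal variables $x_e$ are attached to the vertices $e$ of $Q'$ (written $x_i$, $x_{i,i+1}$, $x_{1,0}$, etc.). GCC: for $i\in[1,n-1]$, let $S_{i,1}\subseteq\{u^{(i)}\}$ and $S_{i,2}\subseteq\{v^{(i)}\}$, each a subset of a one-element set. The collection is a GCC if $(|S_{i,1}|,|S_{i,2}|)\ne(1,1)$ for all $i$, and for $i\in[2,n-1]$: - if $(\delta_{i-1},\delta_i)=(0,0)$ then $|S_{i-1,2}|\ne|S_{i,1}|$; - if $(1,1)$ then $|S_{i-1,1}|\ne|S_{i,2}|$; - if $(0,1)$ then $|S_{i-1,2}|=|S_{i,2}|$; - if $(1,0)$ then $|S_{i-1,1}|=|S_{i,1}|$. For a GCC, set $y_i=x_{i+\delta_i}^{|S_{i,2}|}x_{i+1-\delta_i}^{|S_{i,1}|}x_{i,i+1}^{1-|S_{i,1}|-|S_{i,2}|}$ for $i\in[1,n-1]$. Set $y_0=x_{1,0}$ if $|S_{1,1+\delta_1}|=1-\delta_1$, else $x_{1,1}$. Set $y_n=x_{n,0}$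 if $|S_{n-1,2-\delta_{n-1}}|=\delta_{n-1}$, else $x_{n,1}$. Triangulation: let $\Pi$ be a convex polygon with $n+3$ vertices with a triangulation. Its $n$ diagonals are labelled $T_1,\dots,T_n$ and its $n+3$ boundary edges are labelled $T_{1,0},T_{1,1},T_{n,0},T_{n,1},T_{i,i+1}$ ($i\in[1,n-1]$). The labelling is such that for edges $T_e,T_f$, $Q'$ has an arrow $e\to f$ iff $T_e,T_f$ are two sides of a common triangle and $T_f$ is obtained from $T_e$ by counterclockwise rotation (less than $180^\circ$) about their common endpoint. Let $\mathfrak{v}$ be the common endpoint of $T_{1,0},T_{1,1}$ and $\mathfrak{w}$ the common endpoint of $T_{n,0},T_{n,1}$. The diagonal $M_{\mathfrak{v},\mathfrak{w}}$ crosses $T_1,\dots,T_n$; let $p_i=M_{\mathfrak{v},\mathfrak{w}}\cap T_i$. A $T$-path from $\mathfrak{v}$ to $\mathfrak{w}$ is a sequence $w_0\xrightarrow{T_{e_1}}w_1\xrightarrow{T_{e_2}}\cdots\xrightarrow{T_{e_l}}w_l$ satisfying: 1. $w_0=\mathfrak{v}$, $w_l=\mathfrak{w}$, and all $w_k$ are polygon vertices; 2. $T_{e_k}$ is an edge of the triangulation joining $w_{k-1}$ and $w_k$; 3. the $e_k$ are pairwise distinct; 4. $l$ is odd; 5. $T_{e_k}$ crosses $M_{\mathfrak{v},\mathfrak{w}}$ whenever $k$ is even; 6. if $j<k$ and both $T_{e_j},T_{e_k}$ cross $M_{\mathfrak{v},\mathfrak{w}}$, then $p_{e_j}$ is closer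 to $\mathfrak{v}$ than $p_{e_k}$. Set $x(\alpha)=\prod_{k\text{ odd}}x_{e_k}\prod_{k\text{ even}}x_{e_k}^{-1}$. *)

theory Defs
  imports
    "HOL-Analysis.Analysis"
    "HOL-Library.Poly_Mapping"
    "Graph_Theory.Pair_Digraph"
begin

section \<open>Linear quivers and their complete extensions\<close>

text \<open>There is at most one arrow between any two vertices of a linear quiver, so a quiver is
  represented by a digraph whose arrows are ordered pairs.\<close>

definition linear_quiver :: "nat \<Rightarrow> nat pair_pre_digraph \<Rightarrow> bool" where
  "linear_quiver n Q \<longleftrightarrow>
     pverts Q = {1..n} \<and>
     (\<forall>i\<in>{1..n-1}. \<exists>!a. a \<in> parcs Q \<and> (a = (i, i+1) \<or> a = (i+1, i))) \<and>
     parcs Q \<subseteq> (\<Union>i\<in>{1..n-1}. {(i, i+1), (i+1, i)})"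

definition delta :: "nat pair_pre_digraph \<Rightarrow> nat \<Rightarrow> nat" where
  "delta Q i = (if (i, i+1) \<in> parcs Q then 0 else 1)"

text \<open>\<open>Orig i\<close> is the vertex $i$, \<open>Mid i\<close> is $(i,i+1)$, \<open>Start r\<close> is $(1,r)$ and
  \<open>End r\<close> is $(n,r)$.\<close>

datatype qvertex = Orig nat | Mid nat | Start nat | End nat

definition ext_verts :: "nat \<Rightarrow> qvertex set" where
  "ext_verts n = Mid ` {1..n-1} \<union> Start ` {0,1} \<union> End ` {0,1}"

text \<open>The arrow of $Q$ between $i$ and $i+1$ is $i+\delta_i \to i+1-\delta_i$; this determines
  the orientation of the $3$-cycle through $(i,i+1)$.\<close>

definition extended_quiver :: "nat \<Rightarrow> nat pair_pre_digraph \<Rightarrow> qvertex pair_pre_digraph" where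
  "extended_quiver n Q = \<lparr>
     pverts = Orig ` pverts Q \<union> ext_verts n,
     parcs = map_prod Orig Orig ` parcs Q
       \<union> (\<Union>i\<in>{1..n-1}. {(Orig (i + 1 - delta Q i), Mid i), (Mid i, Orig (i + delta Q i))})
       \<union> {(Orig 1, Start 0), (Start 0, Start 1), (Start 1, Orig 1)}
       \<union> {(Orig n, End 0), (End 0, End 1), (End 1, Orig n)} \<rparr>"

section \<open>Globally compatible collections\<close>

text \<open>\<open>GU i\<close> and \<open>GV i\<close> are the formal elements $u^{(i)}$ and $v^{(i)}$.  A collection is a
  function on the pairs $(i,r)$, extensional so that equality of collections is equality of
  functions.\<close>

datatype gelem = GU nat | GV nat

type_synonym collection = "nat \<times> nat \<Rightarrow> gelem set"

definition collections :: "nat \<Rightarrow> collection set" where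
  "collections n =
     (\<Pi>\<^sub>E (i, r) \<in> {1..n-1} \<times> {1,2}. Pow {if r = 1 then GU i else GV i})"

definition GCCs :: "nat \<Rightarrow> nat pair_pre_digraph \<Rightarrow> collection set" where
  "GCCs n Q = {S \<in> collections n.
     (\<forall>i\<in>{1..n-1}. (card (S (i,1)), card (S (i,2))) \<noteq> (1, 1)) \<and>
     (\<forall>i\<in>{2..n-1}.
        ((delta Q (i-1), delta Q i) = (0,0) \<longrightarrow> card (S (i-1,2)) \<noteq> card (S (i,1))) \<and>
        ((delta Q (i-1), delta Q i) = (1,1) \<longrightarrow> card (S (i-1,1)) \<noteq> card (S (i,2))) \<and>
        ((delta Q (i-1), delta Q i) = (0,1) \<longrightarrow> card (S (i-1,2)) = card (S (i,2))) \<and>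
        ((delta Q (i-1), delta Q i) = (1,0) \<longrightarrow> card (S (i-1,1)) = card (S (i,1))))}"

section \<open>Laurent polynomials in the formal variables\<close>

text \<open>Monomials are finitely supported integer exponent vectors, so
  \<open>(qvertex \<Rightarrow>\<^sub>0 int) \<Rightarrow>\<^sub>0 int\<close> with its convolution product is the ring of integral Laurent
  polynomials in the $x_e$.\<close>

type_synonym laurent = "(qvertex \<Rightarrow>\<^sub>0 int) \<Rightarrow>\<^sub>0 int"

definition X :: "qvertex \<Rightarrow> laurent" where
  "X e = Poly_Mapping.single (Poly_Mapping.single e 1) 1"

definition Xinv :: "qvertex \<Rightarrow> laurent" where
  "Xinv e = Poly_Mapping.single (Poly_Mapping.single e (-1)) 1"

lemma X_times_Xinv: "X e * Xinv e = 1"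
  by (simp add: X_def Xinv_def mult_single flip: single_add)

definition y :: "nat \<Rightarrow> nat pair_pre_digraph \<Rightarrow> collection \<Rightarrow> nat \<Rightarrow> laurent" where
  "y n Q S i =
     (if i = 0 then
        (if card (S (1, 1 + delta Q 1)) = 1 - delta Q 1 then X (Start 0) else X (Start 1))
      else if i = n then
        (if card (S (n-1, 2 - delta Q (n-1))) = delta Q (n-1) then X (End 0) else X (End 1))
      else
        X (Orig (i + delta Q i)) ^ card (S (i,2))
        * X (Orig (i + 1 - delta Q i)) ^ card (S (i,1))
        * X (Mid i) ^ (1 - card (S (i,1)) - card (S (i,2))))"

section \<open>Triangulated polygons\<close>

text \<open>A convex polygon is a polytope in the plane of complex numbers, its vertices being the
  extreme points; edges and diagonals are closed segments.\<close>

definition convex_polygon :: "nat \<Rightarrow> complex set \<Rightarrow> bool" where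
  "convex_polygon m P \<longleftrightarrow> polytope P \<and> aff_dim P = 2 \<and> card {p. p extreme_point_of P} = m"

definition diagonals :: "complex set \<Rightarrow> complex set set" where
  "diagonals P = {closed_segment a b | a b.
     a extreme_point_of P \<and> b extreme_point_of P \<and> a \<noteq> b \<and> \<not> closed_segment a b edge_of P}"

definition crosses :: "complex set \<Rightarrow> complex set \<Rightarrow> bool" where
  "crosses d d' \<longleftrightarrow> d \<noteq> d' \<and> rel_interior d \<inter> rel_interior d' \<noteq> {}"

text \<open>A triangulation is identified with its set of diagonals, a maximal set of pairwise
  noncrossing diagonals.\<close>

definition polygon_triangulation :: "complex set \<Rightarrow> complex set set \<Rightarrow> bool" where
  "polygon_triangulation P D \<longleftrightarrow>
     D \<subseteq> diagonals P \<and>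
     (\<forall>d\<in>D. \<forall>d'\<in>D. \<not> crosses d d') \<and>
     (\<forall>d\<in>diagonals P. (\<forall>d'\<in>D. \<not> crosses d d') \<longrightarrow> d \<in> D)"

text \<open>\<open>rotates_to E s t\<close>: the segments \<open>s = ca\<close> and \<open>t = cb\<close> are sides of a triangle \<open>abc\<close> all of
  whose sides belong to \<open>E\<close>, and the direction of \<open>t\<close> is obtained from that of \<open>s\<close> by a
  counterclockwise rotation about \<open>c\<close> by an angle less than $180$ degrees.\<close>

definition rotates_to :: "complex set set \<Rightarrow> complex set \<Rightarrow> complex set \<Rightarrow> bool" where
  "rotates_to E s t \<longleftrightarrow>
     (\<exists>a b c. \<not> collinear {a, b, c} \<and>
        s = closed_segment c a \<and> t = closed_segment c b \<and>
        s \<in> E \<and> t \<in> E \<and> closed_segment a b \<in> E \<and>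
        0 < Arg ((b - c) / (a - c)) \<and> Arg ((b - c) / (a - c)) < pi)"

definition labelled_triangulation ::
    "nat \<Rightarrow> nat pair_pre_digraph \<Rightarrow> complex set \<Rightarrow> (qvertex \<Rightarrow> complex set) \<Rightarrow> bool" where
  "labelled_triangulation n Q P T \<longleftrightarrow>
     convex_polygon (n + 3) P \<and>
     polygon_triangulation P (T ` Orig ` {1..n}) \<and>
     inj_on T (Orig ` {1..n}) \<and>
     bij_betw T (ext_verts n) {s. s edge_of P} \<and>
     (\<forall>e\<in>pverts (extended_quiver n Q). \<forall>f\<in>pverts (extended_quiver n Q).
        (e, f) \<in> parcs (extended_quiver n Q) \<longleftrightarrow>
        rotates_to (T ` pverts (extended_quiver n Q)) (T e) (T f))"

definition common_endpoint :: "complex \<Rightarrow> complex set \<Rightarrow> complex set \<Rightarrow> bool" where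
  "common_endpoint p s t \<longleftrightarrow> p extreme_point_of s \<and> p extreme_point_of t"

section \<open>Paths along edges of the triangulation\<close>

text \<open>A path with \<open>l\<close> steps is a pair of the list $w_0,\dots,w_l$ of polygon vertices and the
  list $e_1,\dots,e_l$ of edge labels.\<close>

type_synonym path = "complex list \<times> qvertex list"

definition walk :: "nat \<Rightarrow> complex set \<Rightarrow> (qvertex \<Rightarrow> complex set)
    \<Rightarrow> complex \<Rightarrow> complex \<Rightarrow> path \<Rightarrow> bool" where
  "walk n P T v w = (\<lambda>(ws, es).
     length ws = length es + 1 \<and>
     ws ! 0 = v \<and> ws ! length es = w \<and>
     (\<forall>k\<in>{0..length es}. ws ! k extreme_point_of P) \<and>
     (\<forall>k\<in>{1..length es}. es ! (k-1) \<in> Orig ` {1..n} \<union> ext_verts n \<and>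
        T (es ! (k-1)) = closed_segment (ws ! (k-1)) (ws ! k)))"

text \<open>The point where \<open>s\<close> meets the segment from \<open>v\<close> to \<open>w\<close>, for \<open>s\<close> crossing that segment.\<close>

definition crossing_point :: "complex \<Rightarrow> complex \<Rightarrow> complex set \<Rightarrow> complex" where
  "crossing_point v w s = the_elem (closed_segment v w \<inter> s)"

definition T_paths :: "nat \<Rightarrow> complex set \<Rightarrow> (qvertex \<Rightarrow> complex set)
    \<Rightarrow> complex \<Rightarrow> complex \<Rightarrow> path set" where
  "T_paths n P T v w = {(ws, es).
     walk n P T v w (ws, es) \<and>
     distinct es \<and>
     odd (length es) \<and>
     (\<forall>k\<in>{1..length es}. even k \<longrightarrow> crosses (T (es ! (k-1))) (closed_segment v w)) \<and>
     (\<forall>j\<in>{1..length es}. \<forall>k\<in>{1..length es}.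
        j < k \<and> crosses (T (es ! (j-1))) (closed_segment v w)
              \<and> crosses (T (es ! (k-1))) (closed_segment v w) \<longrightarrow>
        dist v (crossing_point v w (T (es ! (j-1))))
          < dist v (crossing_point v w (T (es ! (k-1)))))}"

definition path_monomial :: "path \<Rightarrow> laurent" where
  "path_monomial = (\<lambda>(ws, es).
     (\<Prod>k\<in>{k\<in>{1..length es}. odd k}. X (es ! (k-1)))
     * (\<Prod>k\<in>{k\<in>{1..length es}. even k}. Xinv (es ! (k-1))))"

section \<open>From globally compatible collections to paths\<close>

definition alpha_term :: "nat \<Rightarrow> nat pair_pre_digraph \<Rightarrow> collection \<Rightarrow> nat \<Rightarrow> qvertex" where
  "alpha_term n Q S k =
     (if even k then Orig (k div 2)
      else if k = 1 then
        (if card (S (1, 1 + delta Q 1)) = 1 - delta Q 1 then Start 0 else Start 1)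
      else if k = 2 * n + 1 then
        (if card (S (n-1, 2 - delta Q (n-1))) = delta Q (n-1) then End 0 else End 1)
      else (let i = k div 2; s = (card (S (i,1)), card (S (i,2))) in
        if s = (delta Q i, 1 - delta Q i) then Orig i
        else if s = (1 - delta Q i, delta Q i) then Orig (i+1)
        else Mid i))"

definition alpha_seq :: "nat \<Rightarrow> nat pair_pre_digraph \<Rightarrow> collection \<Rightarrow> qvertex list" where
  "alpha_seq n Q S = map (alpha_term n Q S) [1..<2*n+2]"

text \<open>\<open>cancels_to\<close> describes complete cancellation: deletions are repeated until no two
  consecutive edges are identical.\<close>

inductive cancel_step :: "qvertex list \<Rightarrow> qvertex list \<Rightarrow> bool" where
  "cancel_step (es @ [e, e] @ fs) (es @ fs)"

definition cancels_to :: "qvertex list \<Rightarrow> qvertex list \<Rightarrow> bool" where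
  "cancels_to es fs \<longleftrightarrow> cancel_step\<^sup>*\<^sup>* es fs \<and> \<not> (\<exists>gs. cancel_step fs gs)"

definition reduced_path :: "nat \<Rightarrow> nat pair_pre_digraph \<Rightarrow> complex set
    \<Rightarrow> (qvertex \<Rightarrow> complex set) \<Rightarrow> complex \<Rightarrow> complex \<Rightarrow> collection \<Rightarrow> path \<Rightarrow> bool" where
  "reduced_path n Q P T v w S \<alpha> \<longleftrightarrow>
     walk n P T v w \<alpha> \<and> cancels_to (alpha_seq n Q S) (snd \<alpha>)"

definition psi :: "nat \<Rightarrow> nat pair_pre_digraph \<Rightarrow> complex set
    \<Rightarrow> (qvertex \<Rightarrow> complex set) \<Rightarrow> complex \<Rightarrow> complex \<Rightarrow> collection \<Rightarrow> path" where
  "psi n Q P T v w S = (THE \<alpha>. reduced_path n Q P T v w S \<alpha>)"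

end

theory Submission
  imports Defs
begin

text \<open>
Write \<open>T\<^sub>i = l\<^sub>i r\<^sub>i\<close> with \<open>l\<^sub>i\<close> on the left and \<open>r\<^sub>i\<close> on the right as seen from \<open>v\<close>.  The arrows
of the extended quiver force consecutive triangles to lie on opposite sides of their common
diagonal: \<open>T\<^sub>i\<close> and \<open>T\<^sub>i\<^sub>+\<^sub>1\<close> share their left endpoint if \<open>\<delta>\<^sub>i = 0\<close> and their right endpoint otherwise.
By convex position every \<open>T\<^sub>i\<close> then separates \<open>v\<close> from \<open>w\<close>, the diagonals are crossed in
order, and each polygon vertex is an endpoint of an interval of diagonals.

A walk along a sequence \<open>\<alpha>'\<close> is determined by the bits \<open>b\<^sub>1, \<dots>, b\<^sub>n\<close> telling whether it meets \<open>T\<^sub>i\<close>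
first at \<open>r\<^sub>i\<close>; the edge between \<open>T\<^sub>i\<close> and \<open>T\<^sub>i\<^sub>+\<^sub>1\<close> exists for all but one value of
\<open>(b\<^sub>i, b\<^sub>i\<^sub>+\<^sub>1)\<close>, and a GCC encodes exactly such a bit sequence.  Along the strip \<open>\<alpha>'\<close> is weakly
increasing, so cancellation keeps the edges of odd multiplicity, in strictly increasing order.
A deletion of a pair preserves parities of counts, so \<open>\<alpha>'\<close> can be read off its reduction: it uses
\<open>T\<^sub>i\<close> right after its \<open>2i\<close>-th edge \<open>T\<^sub>i\<close> iff the reduction has an odd number of edges up to \<open>T\<^sub>i\<close>.
For a \<open>T\<close>-path the sequence so obtained is again a walk, because by the interval property the
vertex reached before \<open>T\<^sub>i\<close> is an endpoint of \<open>T\<^sub>i\<close>.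
\<close>

text \<open>The quiver tells which edges bound a common triangle, but not where the triangles lie:
  it does not say outright that the triangles before and after \<open>T_i\<close> are on different
  sides of it. This follows from convexity and non-crossing, because two different triangles on the
  same side of a common base have sides that cross. All positions are expressed by the sign of an
  oriented area, and convexity of \<open>P\<close> enters only through two facts about four
  vertices, \<open>opposite_side\<close> and \<open>same_side_crosses\<close>. Once the endpoints of
  the diagonals are known to form intervals, only incidences matter, and the rest takes place in the
  locale \<open>strip\<close> over an arbitrary type of vertices.

  Since \<open>psi\<close> is a definite description that leaves the order of deletions open, the
  reduction has to be shown unique. Invariants of a single deletion take the place of a confluence
  argument, and the same invariants give injectivity and the inverse map.\<close>

definition labels :: "nat \<Rightarrow> qvertex set" where
  "labels n = Orig ` {1..n} \<union> ext_verts n"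

lemma labels_simps [simp]:
  "Orig i \<in> labels n \<longleftrightarrow> 1 \<le> i \<and> i \<le> n"
  "Mid i \<in> labels n \<longleftrightarrow> 1 \<le> i \<and> i \<le> n - 1"
  "Start k \<in> labels n \<longleftrightarrow> k = 0 \<or> k = 1"
  "End k \<in> labels n \<longleftrightarrow> k = 0 \<or> k = 1"
  by (auto simp: labels_def ext_verts_def)

lemma pverts_extended_quiver:
  assumes "linear_quiver n Q"
  shows "pverts (extended_quiver n Q) = labels n"
  using assms by (auto simp: extended_quiver_def labels_def linear_quiver_def)

lemma delta_01: "delta Q i = 0 \<or> delta Q i = 1"
  by (simp add: delta_def)

section \<open>Arrows and triangles of the extended quiver\<close>

lemma arcs_linear_quiver:
  assumes "linear_quiver n Q"
  shows "parcs Q = (\<lambda>i. (i + delta Q i, i + 1 - delta Q i)) ` {1..n-1}" (is "_ = ?R")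
proof
  have ex: "\<exists>!a. a \<in> parcs Q \<and> (a = (i, i+1) \<or> a = (i+1, i))" if "i \<in> {1..n-1}" for i
    using assms that unfolding linear_quiver_def by blast
  show "parcs Q \<subseteq> ?R"
  proof
    fix a assume a: "a \<in> parcs Q"
    then obtain i where i: "i \<in> {1..n-1}" and ai: "a = (i, i+1) \<or> a = (i+1, i)"
      using assms unfolding linear_quiver_def by blast
    have "a = (i + delta Q i, i + 1 - delta Q i)"
    proof (cases "(i, i+1) \<in> parcs Q")
      case True
      then have "a = (i, i+1)" using ex[OF i] a ai by blast
      with True show ?thesis by (simp add: delta_def)
    next
      case False
      then show ?thesis using a ai by (auto simp: delta_def)
    qed
    with i show "a \<in> ?R" by blast
  qed
  show "?R \<subseteq> parcs Q"
  proof
    fix a assume "a \<in> ?R"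
    then obtain i where i: "i \<in> {1..n-1}" and a: "a = (i + delta Q i, i + 1 - delta Q i)"
      by blast
    obtain a' where "a' \<in> parcs Q" "a' = (i, i+1) \<or> a' = (i+1, i)"
      using ex[OF i] by blast
    then show "a \<in> parcs Q" using a by (auto simp: delta_def)
  qed
qed

lemma arcs_extended_quiver:
  assumes "linear_quiver n Q"
  shows "parcs (extended_quiver n Q) =
    (\<Union>i\<in>{1..n-1}. {(Orig (i + delta Q i), Orig (i + 1 - delta Q i)),
       (Orig (i + 1 - delta Q i), Mid i), (Mid i, Orig (i + delta Q i))})
    \<union> {(Orig 1, Start 0), (Start 0, Start 1), (Start 1, Orig 1)}
    \<union> {(Orig n, End 0), (End 0, End 1), (End 1, Orig n)}"
  by (simp add: extended_quiver_def arcs_linear_quiver[OF assms] image_image) blast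

text \<open>Identifies the third side of the triangle on \<open>T_i\<close> and
  \<open>T_{i+1}\<close>. It is not a diagonal: arrows between original vertices join numbers of
  opposite parity, so three of them never close up. A \<open>Start\<close> or \<open>End\<close>
  label is adjacent to only one original vertex, and \<open>Mid k\<close> only to \<open>k\<close>
  and \<open>k + 1\<close>.\<close>

lemma third_side_Mid:
  assumes Q: "linear_quiver n Q" and i: "1 \<le> i" "i < n"
    and "(Orig (i + 1 - delta Q i), g) \<in> parcs (extended_quiver n Q)"
    and "(g, Orig (i + delta Q i)) \<in> parcs (extended_quiver n Q)"
  shows "g = Mid i"
proof -
  define d where "d = delta Q"
  have d: "d j = 0 \<or> d j = 1" for j unfolding d_def by (rule delta_01)
  note arcs = assms(4,5)[unfolded arcs_extended_quiver[OF Q], folded d_def]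
  show ?thesis
  proof (cases g)
    case (Orig k)
    obtain j where "i + 1 - d i = j + d j" "k = j + 1 - d j"
      using arcs(1) unfolding Orig by blast
    moreover obtain j' where "k = j' + d j'" "i + d i = j' + 1 - d j'"
      using arcs(2) unfolding Orig by blast
    ultimately show ?thesis using d[of i] d[of j] d[of j'] by (elim disjE) simp_all
  next
    case (Mid k)
    with arcs have "i + 1 - d i = k + 1 - d k" "i + d i = k + d k" by auto
    then show ?thesis using Mid d[of i] d[of k] by auto
  qed (use arcs in auto)
qed

section \<open>Orientation of triangles\<close>

text \<open>Twice the signed area of the triangle \<open>abc\<close>, positive iff it is
  counterclockwise. For fixed \<open>a\<close> and \<open>b\<close> it is affine in \<open>c\<close>
  and vanishes on the line through \<open>a\<close> and \<open>b\<close>.\<close>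

definition ori :: "complex \<Rightarrow> complex \<Rightarrow> complex \<Rightarrow> real" where
  "ori a b c = (Re b - Re a) * (Im c - Im a) - (Im b - Im a) * (Re c - Re a)"

lemma ori_rotate: "ori b c a = ori a b c"
  by (simp add: ori_def algebra_simps)

lemma ori_swap: "ori b a c = - ori a b c"
  by (simp add: ori_def algebra_simps)

lemma ori_degenerate [simp]: "ori a a c = 0" "ori a b a = 0" "ori a b b = 0"
  by (simp_all add: ori_def)

lemma ori_affine: "ori a b ((1 - t) *\<^sub>R x + t *\<^sub>R x') = (1 - t) * ori a b x + t * ori a b x'"
  by (simp add: ori_def algebra_simps)

text \<open>The imaginary part of \<open>(b - c) / (a - c)\<close> has the sign of
  \<open>ori c a b\<close>, and it is positive iff the argument lies strictly between
  \<open>0\<close> and \<open>pi\<close>.\<close>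

lemma Arg_quotient_ori:
  assumes "a \<noteq> c" "0 < Arg ((b - c) / (a - c))" "Arg ((b - c) / (a - c)) < pi"
  shows "ori c a b > 0"
proof -
  have "Im ((b - c) / (a - c)) > 0"
    using assms Arg_lt_pi by blast
  then have "((Im (b - c)) * Re (a - c) - Re (b - c) * Im (a - c)) / ((Re (a - c))\<^sup>2 + (Im (a - c))\<^sup>2) > 0"
    by (simp add: Im_divide)
  moreover have "(Re (a - c))\<^sup>2 + (Im (a - c))\<^sup>2 > 0"
    using assms(1) by (metis complex_neq_0 right_minus_eq)
  ultimately have "(Im (b - c)) * Re (a - c) - Re (b - c) * Im (a - c) > 0"
    by (simp add: zero_less_divide_iff)
  then show ?thesis by (simp add: ori_def algebra_simps)
qed

lemma ori_pos_Arg: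
  assumes "ori c a b > 0"
  shows "0 < Arg ((b - c) / (a - c))" "Arg ((b - c) / (a - c)) < pi"
proof -
  have "a \<noteq> c" using assms by auto
  then have "(Re (a - c))\<^sup>2 + (Im (a - c))\<^sup>2 > 0"
    by (metis complex_neq_0 right_minus_eq)
  then have "Im ((b - c) / (a - c)) > 0"
    using assms by (simp add: Im_divide ori_def algebra_simps)
  then show "0 < Arg ((b - c) / (a - c))" "Arg ((b - c) / (a - c)) < pi"
    using Arg_lt_pi by blast+
qed

lemma ori_noncollinear:
  assumes "ori a b c \<noteq> 0"
  shows "\<not> collinear {a, b, c}"
proof
  assume "collinear {a, b, c}"
  then have "collinear {0, b - a, c - a}"
    using collinear_3[of b a c] by (simp add: insert_commute)
  then obtain k where "b - a = 0 \<or> c - a = 0 \<or> c - a = k *\<^sub>R (b - a)"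
    unfolding collinear_lemma by blast
  then have "ori a b c = 0"
  proof (elim disjE)
    assume "c - a = k *\<^sub>R (b - a)"
    then have "Re c - Re a = k * (Re b - Re a)" "Im c - Im a = k * (Im b - Im a)"
      by (simp_all add: complex_eq_iff)
    then show ?thesis by (simp add: ori_def)
  qed (auto)
  with assms show False by blast
qed

lemma rotates_toE:
  assumes "rotates_to E s t"
  obtains a b c where "ori c a b > 0" "s = closed_segment c a" "t = closed_segment c b"
    "closed_segment a b \<in> E" "s \<in> E" "t \<in> E"
proof -
  obtain a b c where abc: "\<not> collinear {a, b, c}"
        "s = closed_segment c a" "t = closed_segment c b"
        "s \<in> E" "t \<in> E" "closed_segment a b \<in> E"
        "0 < Arg ((b - c) / (a - c))" "Arg ((b - c) / (a - c)) < pi"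
    using assms unfolding rotates_to_def by blast
  have "a \<noteq> c"
  proof
    assume "a = c"
    then have "{a, b, c} = {b, c}" by blast
    then show False using abc(1) by (metis collinear_2)
  qed
  then have "ori c a b > 0" using Arg_quotient_ori abc(7,8) by blast
  then show thesis using that abc(2-6) by blast
qed

lemma rotates_toI:
  assumes "ori c a b > 0" "closed_segment c a \<in> E" "closed_segment c b \<in> E" "closed_segment a b \<in> E"
  shows "rotates_to E (closed_segment c a) (closed_segment c b)"
proof -
  have "ori a b c \<noteq> 0" using assms(1) ori_rotate[of a b c] by simp
  then show ?thesis
    unfolding rotates_to_def using ori_noncollinear ori_pos_Arg[OF assms(1)] assms by blast
qed

section \<open>Points in convex position\<close>

lemma barycentric:
  assumes "ori l r z \<noteq> 0"
  shows "p = (ori p r z / ori l r z) *\<^sub>R l + (ori l p z / ori l r z) *\<^sub>R r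
           + (ori l r p / ori l r z) *\<^sub>R z"
    and "ori p r z / ori l r z + ori l p z / ori l r z + ori l r p / ori l r z = 1"
proof -
  have s: "ori p r z + ori l p z + ori l r p = ori l r z"
    by (simp add: ori_def algebra_simps)
  show "ori p r z / ori l r z + ori l p z / ori l r z + ori l r p / ori l r z = 1"
    using assms s by (simp flip: add_divide_distrib)
  have "ori l r z * Re p = ori p r z * Re l + ori l p z * Re r + ori l r p * Re z"
       "ori l r z * Im p = ori p r z * Im l + ori l p z * Im r + ori l r p * Im z"
    by (simp_all add: ori_def algebra_simps)
  then show "p = (ori p r z / ori l r z) *\<^sub>R l + (ori l p z / ori l r z) *\<^sub>R r
           + (ori l r p / ori l r z) *\<^sub>R z"
    using assms by (simp add: complex_eq_iff field_simps)
qed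

text \<open>The terms in \<open>q\<close> and \<open>r\<close> merge into a single point
  \<open>u\<close> of \<open>P\<close>; if \<open>p\<close> were not \<open>x\<close>, then
  \<open>x\<close> would lie strictly between \<open>p\<close> and \<open>u\<close>.\<close>

lemma extreme_point_convex_combination:
  fixes x :: "'a::real_vector"
  assumes P: "convex P" and x: "x extreme_point_of P"
    and pqr: "p \<in> P" "q \<in> P" "r \<in> P"
    and c: "a > 0" "b \<ge> 0" "c \<ge> 0" "a + b + c = 1"
    and eq: "x = a *\<^sub>R p + b *\<^sub>R q + c *\<^sub>R r"
  shows "p = x"
proof (cases "a = 1")
  case True
  then have "b = 0" "c = 0" using c by auto
  then show ?thesis using True eq by simp
next
  case False
  then have bc: "b + c > 0" "b + c = 1 - a" "a < 1" using c by auto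
  define u where "u = (b / (b+c)) *\<^sub>R q + (c / (b+c)) *\<^sub>R r"
  have "u \<in> P"
    unfolding u_def using P pqr(2,3)
    by (rule convexD) (use bc c in \<open>auto simp flip: add_divide_distrib\<close>)
  have xe: "x = (1 - (1-a)) *\<^sub>R p + (1-a) *\<^sub>R u"
    using eq bc by (simp add: u_def scaleR_add_right)
  show ?thesis
  proof (rule ccontr)
    assume "p \<noteq> x"
    then have "p \<noteq> u" using xe by (metis scaleR_collapse add.commute diff_diff_eq2 add_diff_cancel_left')
    then have "x \<in> open_segment p u"
      unfolding in_segment using xe c bc by (intro conjI exI[of _ "1-a"]) auto
    then show False using x \<open>u \<in> P\<close> pqr(1) unfolding extreme_point_of_def by blast
  qed
qed

text \<open>Solving the equation for \<open>x\<close> makes \<open>x\<close> a convex combination in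
  which \<open>p\<close> has the positive weight \<open>1 / a\<close>.\<close>

lemma extreme_point_extrapolation:
  fixes x :: "'a::real_vector"
  assumes P: "convex P" and x: "x extreme_point_of P"
    and pqr: "p \<in> P" "q \<in> P" "r \<in> P"
    and c: "b \<le> 0" "c \<le> 0" "a + b + c = 1"
    and eq: "p = a *\<^sub>R x + b *\<^sub>R q + c *\<^sub>R r"
  shows "p = x"
proof -
  have a: "a > 0" using c by linarith
  have "a *\<^sub>R x = p + (-b) *\<^sub>R q + (-c) *\<^sub>R r" by (subst eq) simp
  then have "(1/a) *\<^sub>R (a *\<^sub>R x) = (1/a) *\<^sub>R (p + (-b) *\<^sub>R q + (-c) *\<^sub>R r)" by simp
  then have "x = (1/a) *\<^sub>R p + (-b/a) *\<^sub>R q + (-c/a) *\<^sub>R r"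
    using a by (simp add: scaleR_add_right scaleR_diff_right)
  moreover have "1/a + (-b/a) + (-c/a) = 1"
  proof -
    have "1/a + (-b/a) + (-c/a) = (1 - b - c) / a" by (simp add: diff_divide_distrib)
    also have "1 - b - c = a" using c by simp
    finally show ?thesis using a by simp
  qed
  moreover have "1/a > 0" "-b/a \<ge> 0" "-c/a \<ge> 0" using a c by (simp_all add: divide_nonpos_pos)
  ultimately show ?thesis by (intro extreme_point_convex_combination[OF P x pqr])
qed

text \<open>In convex position the segment from \<open>p\<close> to \<open>z\<close> leaves the triangle \<open>lrz\<close> through the side
  \<open>lr\<close>, so \<open>p\<close> lies on the triangle's side of the other two lines.\<close>

lemma opposite_side:
  assumes P: "convex P"
    and ext: "l extreme_point_of P" "r extreme_point_of P" "z extreme_point_of P" "p extreme_point_of P"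
    and z: "ori l r z > 0" and p: "ori l r p < 0"
  shows "ori l p z > 0" "ori p r z > 0"
proof -
  note inP = ext[THEN extreme_point_of_def[THEN iffD1], THEN conjunct1]
  define a b c where "a = ori p r z / ori l r z" and "b = ori l p z / ori l r z"
    and "c = ori l r p / ori l r z"
  have eq: "p = a *\<^sub>R l + b *\<^sub>R r + c *\<^sub>R z" and sum: "a + b + c = 1"
    using barycentric[of l r z p] z unfolding a_def b_def c_def by auto
  have c: "c < 0" using z p by (simp add: c_def divide_neg_pos)
  have ne: "p \<noteq> l" "p \<noteq> r" using p by auto
  have "b > 0"
  proof (rule ccontr)
    assume nb: "\<not> b > 0"
    then have "p = l"
      using extreme_point_extrapolation[OF P ext(1) inP(4) inP(2) inP(3) _ _ sum eq] c by simp
    then show False using ne by simp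
  qed
  moreover have "a > 0"
  proof (rule ccontr)
    assume na: "\<not> a > 0"
    have eq': "p = b *\<^sub>R r + a *\<^sub>R l + c *\<^sub>R z" and sum': "b + a + c = 1"
      using eq sum by simp_all
    have "p = r"
      using extreme_point_extrapolation[OF P ext(2) inP(4) inP(1) inP(3) _ _ sum' eq'] na c by simp
    then show False using ne by simp
  qed
  ultimately show "ori l p z > 0" "ori p r z > 0"
    using z by (auto simp: a_def b_def zero_less_divide_iff)
qed

lemma crosses_closed_segment:
  fixes a b c d :: complex
  assumes "a \<noteq> b" "c \<noteq> d"
  shows "crosses (closed_segment a b) (closed_segment c d) \<longleftrightarrow>
    {a, b} \<noteq> {c, d} \<and> open_segment a b \<inter> open_segment c d \<noteq> {}"
  using assms by (simp add: crosses_def rel_interior_closed_segment closed_segment_eq)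

lemma same_side_crosses_aux:
  assumes P: "convex P"
    and ext: "l extreme_point_of P" "r extreme_point_of P" "z extreme_point_of P" "p extreme_point_of P"
    and z: "ori l r z \<noteq> 0"
    and eq: "p = a *\<^sub>R l + b *\<^sub>R r + c *\<^sub>R z" and sum: "a + b + c = 1"
    and c: "c > 0" and a: "a < 0" and ne: "p \<noteq> z" "p \<noteq> l" "p \<noteq> r"
  shows "crosses (closed_segment l p) (closed_segment r z)"
proof -
  note inP = ext[THEN extreme_point_of_def[THEN iffD1], THEN conjunct1]
  have rz: "r \<noteq> z" "l \<noteq> r" "l \<noteq> z" using z by auto
  have b: "b > 0"
  proof (rule ccontr)
    assume nb: "\<not> b > 0"
    have eq': "p = c *\<^sub>R z + a *\<^sub>R l + b *\<^sub>R r" and sum': "c + a + b = 1"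
      using eq sum by simp_all
    have "p = z"
      using extreme_point_extrapolation[OF P ext(3) inP(4) inP(1) inP(2) _ _ sum' eq'] a nb by simp
    then show False using ne by simp
  qed
  \<comment> \<open>Moving the negative term to the left turns the equation into
    \<open>p - a l = b r + c z\<close>, both sides having total weight \<open>1 - a = b + c\<close>.
    The normalised vector \<open>q\<close> therefore lies on both segments.\<close>
  define q where "q = (1 / (1 - a)) *\<^sub>R (p - a *\<^sub>R l)"
  have bc: "1 - a = b + c" using sum by simp
  have "q = (1 - 1/(1-a)) *\<^sub>R l + (1/(1-a)) *\<^sub>R p"
  proof -
    have "1 - 1/(1-a) = - (a/(1-a))" using a by (simp add: field_simps)
    then show ?thesis by (simp add: q_def scaleR_diff_right)
  qed
  then have "q \<in> open_segment l p"
    unfolding in_segment using a ne by (intro conjI exI[of _ "1/(1-a)"]) auto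
  moreover have "q = (1 - c/(b+c)) *\<^sub>R r + (c/(b+c)) *\<^sub>R z"
  proof -
    have "1 - c/(b+c) = b/(b+c)" using b c by (simp add: field_simps)
    moreover have "p - a *\<^sub>R l = b *\<^sub>R r + c *\<^sub>R z" by (subst eq) simp
    ultimately show ?thesis by (simp add: q_def bc scaleR_add_right)
  qed
  then have "q \<in> open_segment r z"
    unfolding in_segment using b c rz by (intro conjI exI[of _ "c/(b+c)"]) auto
  ultimately show ?thesis
    using crosses_closed_segment[of l p r z] ne rz by (auto simp: doubleton_eq_iff)
qed

text \<open>If neither \<open>a\<close> nor \<open>b\<close> is negative, then \<open>p\<close> lies
  in the triangle \<open>lrz\<close> with positive weight at \<open>z\<close> and, being extreme,
  equals \<open>z\<close>. A negative coefficient tells which pair of sides crosses.\<close>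

lemma same_side_crosses:
  assumes P: "convex P"
    and ext: "l extreme_point_of P" "r extreme_point_of P" "z extreme_point_of P" "p extreme_point_of P"
    and z: "ori l r z > 0" and p: "ori l r p > 0" and ne: "p \<noteq> z"
  shows "crosses (closed_segment l p) (closed_segment r z) \<or>
    crosses (closed_segment r p) (closed_segment l z)"
proof -
  note inP = ext[THEN extreme_point_of_def[THEN iffD1], THEN conjunct1]
  define a b c where "a = ori p r z / ori l r z" and "b = ori l p z / ori l r z"
    and "c = ori l r p / ori l r z"
  have eq: "p = a *\<^sub>R l + b *\<^sub>R r + c *\<^sub>R z" and sum: "a + b + c = 1"
    using barycentric[of l r z p] z unfolding a_def b_def c_def by auto
  have c: "c > 0" using z p by (simp add: c_def)
  have ne': "p \<noteq> l" "p \<noteq> r" using p by auto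
  have "a < 0 \<or> b < 0"
  proof (rule ccontr)
    assume "\<not> (a < 0 \<or> b < 0)"
    moreover have "p = c *\<^sub>R z + a *\<^sub>R l + b *\<^sub>R r" by (subst eq) simp
    ultimately have "z = p"
      using extreme_point_convex_combination[OF P ext(4) inP(3) inP(1) inP(2), of c a b] c sum by simp
    then show False using ne by simp
  qed
  then show ?thesis
  proof
    assume "a < 0"
    then show ?thesis
      using same_side_crosses_aux[OF P ext _ eq sum c _ ne ne'] z by auto
  next
    assume b: "b < 0"
    have eq': "p = b *\<^sub>R r + a *\<^sub>R l + c *\<^sub>R z" and sum': "b + a + c = 1"
      using eq sum by simp_all
    have "ori r l z \<noteq> 0" using z ori_swap[of r l z] by simp
    then show ?thesis
      using same_side_crosses_aux[OF P ext(2,1,3,4) _ eq' sum' c b ne ne'(2,1)] by auto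
  qed
qed

text \<open>An edge is a face, so meeting the open segment it would contain both \<open>c\<close>
  and \<open>d\<close>; but its only extreme points are \<open>a\<close> and
  \<open>b\<close>.\<close>

lemma edge_not_crossed:
  assumes s: "closed_segment a b edge_of P" and cd: "c extreme_point_of P" "d extreme_point_of P"
    and ab: "a \<noteq> b" and ne: "c \<noteq> d"
  shows "\<not> crosses (closed_segment a b) (closed_segment c d)"
proof
  assume "crosses (closed_segment a b) (closed_segment c d)"
  then obtain x where x: "x \<in> open_segment a b" "x \<in> open_segment c d" and dist: "{a,b} \<noteq> {c,d}"
    unfolding crosses_closed_segment[OF ab ne] by blast
  have face: "closed_segment a b face_of P" using s unfolding edge_of_def by blast
  have "c \<in> closed_segment a b" "d \<in> closed_segment a b"
    using face x cd unfolding face_of_def extreme_point_of_def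
    by (meson open_closed_segment)+
  then have "c extreme_point_of closed_segment a b" "d extreme_point_of closed_segment a b"
    using extreme_point_of_face[OF face] cd by blast+
  then have "c \<in> {a,b}" "d \<in> {a,b}" by (simp_all add: extreme_point_of_segment)
  with dist ne show False by auto
qed


section \<open>The strip of triangles\<close>

locale quiver_triangulation =
  fixes n :: nat and Q :: "nat pair_pre_digraph" and P :: "complex set"
    and T :: "qvertex \<Rightarrow> complex set"
  assumes n_ge_2: "n \<ge> 2"
    and quiver: "linear_quiver n Q"
    and triangulation: "labelled_triangulation n Q P T"
begin

lemma convex_P: "convex P"
  using triangulation unfolding labelled_triangulation_def convex_polygon_def
  by (auto dest: polytope_imp_convex)

lemma arcs_labels:
  assumes "(e, f) \<in> parcs (extended_quiver n Q)"
  shows "e \<in> labels n" "f \<in> labels n"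
  using assms n_ge_2 unfolding arcs_extended_quiver[OF quiver] delta_def
  by (auto split: if_splits)

lemma T_Orig_diagonal: "1 \<le> i \<Longrightarrow> i \<le> n \<Longrightarrow> T (Orig i) \<in> diagonals P"
  using triangulation unfolding labelled_triangulation_def polygon_triangulation_def by auto

lemma T_edge:
  assumes "e \<in> labels n" "e \<notin> range Orig"
  shows "T e edge_of P"
proof -
  have "e \<in> ext_verts n" using assms by (auto simp: labels_def)
  then show ?thesis
    using triangulation unfolding labelled_triangulation_def bij_betw_def by blast
qed

lemma T_diagonal_not_edge: "s \<in> diagonals P \<Longrightarrow> \<not> s edge_of P"
  unfolding diagonals_def by blast

lemma inj_T: "inj_on T (labels n)"
proof -
  have "inj_on T (Orig ` {1..n})" "inj_on T (ext_verts n)"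
    using triangulation unfolding labelled_triangulation_def bij_betw_def by blast+
  moreover have "T ` Orig ` {1..n} \<inter> T ` ext_verts n = {}"
  proof -
    have "T e edge_of P" if "e \<in> ext_verts n" for e
      using that triangulation unfolding labelled_triangulation_def bij_betw_def by blast
    moreover have "\<not> T (Orig i) edge_of P" if "i \<in> {1..n}" for i
      using that T_Orig_diagonal T_diagonal_not_edge by simp
    ultimately show ?thesis by auto metis
  qed
  ultimately show ?thesis
    unfolding labels_def inj_on_Un by blast
qed

lemma T_endpoints_extreme:
  assumes "e \<in> labels n" "T e = closed_segment a b"
  shows "a extreme_point_of P" "b extreme_point_of P"
proof -
  have "a extreme_point_of P \<and> b extreme_point_of P"
  proof (cases "e \<in> range Orig")
    case True
    then obtain i where "e = Orig i" by blast
    then have "closed_segment a b \<in> diagonals P"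
      using assms T_Orig_diagonal[of i] by simp
    then obtain c d where "closed_segment a b = closed_segment c d"
      "c extreme_point_of P" "d extreme_point_of P" unfolding diagonals_def by blast
    then show ?thesis by (auto simp: closed_segment_eq doubleton_eq_iff)
  next
    case False
    then have "closed_segment a b face_of P"
      using T_edge[OF assms(1)] assms(2) unfolding edge_of_def by simp
    from extreme_point_of_face[OF this] show ?thesis
      unfolding extreme_point_of_segment by blast
  qed
  then show "a extreme_point_of P" "b extreme_point_of P" by auto
qed

lemma T_not_crosses:
  assumes e: "e \<in> labels n" "T e = closed_segment a b" "a \<noteq> b"
    and f: "f \<in> labels n" "T f = closed_segment c d" "c \<noteq> d"
  shows "\<not> crosses (closed_segment a b) (closed_segment c d)"
proof (cases "e \<in> range Orig \<and> f \<in> range Orig")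
  case True
  then have "T e \<in> T ` Orig ` {1..n}" "T f \<in> T ` Orig ` {1..n}" using e f by auto
  then show ?thesis
    using triangulation e f unfolding labelled_triangulation_def polygon_triangulation_def by metis
next
  case False
  have "crosses (closed_segment a b) (closed_segment c d) \<longleftrightarrow>
    crosses (closed_segment c d) (closed_segment a b)"
    unfolding crosses_def by blast
  then show ?thesis
    using False edge_not_crossed T_edge T_endpoints_extreme[OF e(1,2)] T_endpoints_extreme[OF f(1,2)]
      e f by metis
qed

text \<open>Reading the same triangle from its other two corners gives two more arrows. So every
  arrow lies on an oriented 3-cycle of sides of one triangle, which is what makes the label of the
  third side identifiable.\<close>

lemma arrow_triangle:
  assumes "(e, f) \<in> parcs (extended_quiver n Q)"
  obtains a b c g where "ori c a b > 0" "T e = closed_segment c a" "T f = closed_segment c b"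
    "T g = closed_segment a b" "g \<in> labels n"
    "(f, g) \<in> parcs (extended_quiver n Q)" "(g, e) \<in> parcs (extended_quiver n Q)"
proof -
  have arc_iff: "(e, f) \<in> parcs (extended_quiver n Q) \<longleftrightarrow> rotates_to (T ` labels n) (T e) (T f)"
    if "e \<in> labels n" "f \<in> labels n" for e f
    using triangulation that
    unfolding labelled_triangulation_def pverts_extended_quiver[OF quiver] by blast
  note ef = arcs_labels[OF assms]
  then have "rotates_to (T ` labels n) (T e) (T f)" using arc_iff assms by blast
  then obtain a b c where abc: "ori c a b > 0" "T e = closed_segment c a" "T f = closed_segment c b"
    "closed_segment a b \<in> T ` labels n" by (rule rotates_toE)
  then obtain g where g: "g \<in> labels n" "T g = closed_segment a b" by auto
  have "rotates_to (T ` labels n) (closed_segment b c) (closed_segment b a)"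
    by (rule rotates_toI)
      (use abc g ef ori_rotate[of c a b] ori_rotate[of a b c] in
        \<open>auto simp: closed_segment_commute intro: image_eqI\<close>)
  moreover have "rotates_to (T ` labels n) (closed_segment a b) (closed_segment a c)"
    by (rule rotates_toI)
      (use abc g ef ori_rotate[of c a b] ori_rotate[of a b c] in
        \<open>auto simp: closed_segment_commute intro: image_eqI\<close>)
  ultimately have "(f, g) \<in> parcs (extended_quiver n Q)" "(g, e) \<in> parcs (extended_quiver n Q)"
    using arc_iff ef g abc by (simp_all add: closed_segment_commute)
  then show thesis using that abc g by blast
qed

text \<open>Otherwise two triangles on the base \<open>LR\<close>, with different apexes on the same
  side, would have crossing sides, although all these sides are edges of the triangulation.\<close>

lemma apexes_on_opposite_sides:
  assumes lab: "e1 \<in> labels n" "e2 \<in> labels n" "f1 \<in> labels n" "f2 \<in> labels n"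
    and e: "T e1 = closed_segment q L" "T e2 = closed_segment q R"
    and f: "T f1 = closed_segment b L" "T f2 = closed_segment b R"
    and ne: "e1 \<noteq> f1" and q: "ori R L q > 0"
  shows "\<not> ori R L b > 0"
proof
  assume b: "ori R L b > 0"
  have "q \<noteq> b" using ne e f lab inj_T by (metis inj_onD)
  have ext: "R extreme_point_of P" "L extreme_point_of P" "b extreme_point_of P" "q extreme_point_of P"
    using T_endpoints_extreme lab e f by blast+
  have nz: "R \<noteq> q" "L \<noteq> b" "L \<noteq> q" "R \<noteq> b" using q b by auto
  have "\<not> crosses (closed_segment R q) (closed_segment L b)"
    by (rule T_not_crosses[OF lab(2) _ _ lab(3)]) (use e f nz in \<open>simp_all add: closed_segment_commute\<close>)
  moreover have "\<not> crosses (closed_segment L q) (closed_segment R b)"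
    by (rule T_not_crosses[OF lab(1) _ _ lab(4)]) (use e f nz in \<open>simp_all add: closed_segment_commute\<close>)
  ultimately show False
    using same_side_crosses[OF convex_P ext b q \<open>q \<noteq> b\<close>] by blast
qed

text \<open>The segment \<open>LR\<close> is \<open>T\<^sub>i\<close>, seen from the triangle before it with \<open>L\<close> on the left.\<close>

definition gate :: "nat \<Rightarrow> complex \<times> complex \<Rightarrow> bool" where
  "gate i = (\<lambda>(L, R). T (Orig i) = closed_segment L R \<and>
     (\<exists>q e1 e2. ori R L q > 0 \<and> T e1 = closed_segment q L \<and> T e2 = closed_segment q R \<and>
        e1 \<in> labels n \<and> e2 \<in> labels n \<and>
        {e1, e2} \<inter> {Orig (Suc i), Mid i, End 0, End 1} = {}))"

definition next_gate :: "nat \<Rightarrow> complex \<times> complex \<Rightarrow> complex \<times> complex \<Rightarrow> bool" where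
  "next_gate i = (\<lambda>(L, R) (L', R').
     if delta Q i = 0 then L' = L \<and> ori L R R' > 0 \<and> T (Mid i) = closed_segment R R'
     else R' = R \<and> ori L R L' > 0 \<and> T (Mid i) = closed_segment L L')"

lemma gateI:
  assumes "T (Orig i) = closed_segment L R" "ori R L q > 0"
    "T e1 = closed_segment q L" "T e2 = closed_segment q R"
    "e1 \<in> labels n" "e2 \<in> labels n" "{e1, e2} \<inter> {Orig (Suc i), Mid i, End 0, End 1} = {}"
  shows "gate i (L, R)"
  using assms unfolding gate_def by blast

text \<open>The labels excluded in \<open>gate\<close> are those that the other sides of the
  triangle after \<open>T_i\<close> can have. The triangle before avoids them, so the two apexes
  differ and have to lie on opposite sides.\<close>

lemma gate_opposite:
  assumes "gate i (L, R)" "f1 \<in> labels n" "f2 \<in> labels n"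
    "T f1 = closed_segment b L" "T f2 = closed_segment b R"
    "f1 \<in> {Orig (Suc i), Mid i, End 0, End 1}"
  shows "\<not> ori R L b > 0"
proof -
  obtain q e1 e2 where q: "ori R L q > 0" "T e1 = closed_segment q L" "T e2 = closed_segment q R"
    "e1 \<in> labels n" "e2 \<in> labels n" and e: "{e1, e2} \<inter> {Orig (Suc i), Mid i, End 0, End 1} = {}"
    using assms(1) unfolding gate_def prod.case by metis
  have "e1 \<noteq> f1" using e assms(6) by auto
  from apexes_on_opposite_sides[OF q(4,5) assms(2,3) q(2,3) assms(4,5) this q(1)] show ?thesis .
qed

lemma first_gate:
  assumes v: "common_endpoint v (T (Start 0)) (T (Start 1))"
  obtains L R where "gate 1 (L, R)" "T (Start 0) = closed_segment v R"
    "T (Start 1) = closed_segment v L" "ori R L v > 0"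
proof -
  have "(Orig 1, Start 0) \<in> parcs (extended_quiver n Q)"
    using arcs_extended_quiver[OF quiver] by blast
  then obtain a b c g where abc: "ori c a b > 0" "T (Orig 1) = closed_segment c a"
    "T (Start 0) = closed_segment c b" "T g = closed_segment a b" "g \<in> labels n"
    "(Start 0, g) \<in> parcs (extended_quiver n Q)"
    by (rule arrow_triangle)
  have "g = Start 1" using abc(6) unfolding arcs_extended_quiver[OF quiver] by auto
  have "v \<in> {c, b}" "v \<in> {a, b}"
    using v abc \<open>g = Start 1\<close> by (auto simp: common_endpoint_def extreme_point_of_segment)
  moreover have "c \<noteq> a" using abc by auto
  ultimately have [simp]: "b = v" by auto
  have "gate 1 (a, c)"
    by (rule gateI[of _ _ _ v "Start 1" "Start 0"]) (use abc \<open>g = Start 1\<close> in \<open>auto simp: closed_segment_commute\<close>)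
  then show thesis using that[of a c] abc \<open>g = Start 1\<close> by (simp add: closed_segment_commute)
qed

text \<open>The arrow between \<open>i\<close> and \<open>i + 1\<close> supplies the next triangle,
  with \<open>c\<close> the common endpoint of the two diagonals. Its direction, a counterclockwise
  rotation about \<open>c\<close>, decides whether \<open>c\<close> is on the left or on the
  right.\<close>

lemma gate_Suc:
  assumes g: "gate i (L, R)" and i: "1 \<le> i" "i < n"
  shows "\<exists>LR'. gate (Suc i) LR' \<and> next_gate i (L, R) LR'"
proof -
  have LR: "T (Orig i) = closed_segment L R" using g unfolding gate_def by simp
  have "(Orig (i + delta Q i), Orig (i + 1 - delta Q i)) \<in> parcs (extended_quiver n Q)"
    unfolding arcs_extended_quiver[OF quiver] using i by auto
  then obtain a b c h where abc: "ori c a b > 0" "T (Orig (i + delta Q i)) = closed_segment c a"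
    "T (Orig (i + 1 - delta Q i)) = closed_segment c b" "T h = closed_segment a b" "h \<in> labels n"
    "(Orig (i + 1 - delta Q i), h) \<in> parcs (extended_quiver n Q)"
    "(h, Orig (i + delta Q i)) \<in> parcs (extended_quiver n Q)"
    by (rule arrow_triangle)
  have h: "h = Mid i" using third_side_Mid[OF quiver i abc(6,7)] .
  have lab: "Orig (Suc i) \<in> labels n" "Mid i \<in> labels n" "Orig i \<in> labels n" using i by auto
  show ?thesis
  proof (cases "delta Q i = 0")
    case True
    have T: "T (Orig i) = closed_segment c a" "T (Orig (Suc i)) = closed_segment c b"
      "T (Mid i) = closed_segment a b" using abc True h by simp_all
    have "{c, a} = {L, R}" using LR T by (metis closed_segment_eq)
    \<comment> \<open>The reverse matching would put the new triangle on the same side of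
      \<open>T_i\<close> as the preceding one.\<close>
    moreover have "\<not> (c = R \<and> a = L)"
      using gate_opposite[OF g lab(2,1)] T abc(1) by (auto simp: closed_segment_commute)
    ultimately have [simp]: "c = L" "a = R" by (auto simp: doubleton_eq_iff)
    have "gate (Suc i) (L, b)"
      by (rule gateI[of _ _ _ R "Orig i" "Mid i"]) (use T lab abc(1) ori_rotate[of L R b] ori_rotate[of R b L] in
        \<open>auto simp: closed_segment_commute\<close>)
    moreover have "next_gate i (L, R) (L, b)"
      unfolding next_gate_def using True T abc(1) by simp
    ultimately show ?thesis by blast
  next
    case False
    then have d: "delta Q i = 1" using delta_01[of Q i] by simp
    have T: "T (Orig (Suc i)) = closed_segment c a" "T (Orig i) = closed_segment c b"
      "T (Mid i) = closed_segment a b" using abc d h by simp_all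
    have "{c, b} = {L, R}" using LR T by (metis closed_segment_eq)
    moreover have "\<not> (c = L \<and> b = R)"
    proof
      assume cb: "c = L \<and> b = R"
      then have "ori R L a > 0" using abc(1) by (simp add: ori_def algebra_simps)
      then show False
        using gate_opposite[OF g lab(1,2), of a] T cb by (simp add: closed_segment_commute)
    qed
    ultimately have [simp]: "c = R" "b = L" by (auto simp: doubleton_eq_iff)
    have "gate (Suc i) (a, R)"
      by (rule gateI[of _ _ _ L "Mid i" "Orig i"]) (use T lab abc(1) in \<open>auto simp: closed_segment_commute\<close>)
    moreover have "next_gate i (L, R) (a, R)"
      unfolding next_gate_def using d T abc(1) ori_rotate[of R a L]
      by (simp add: closed_segment_commute)
    ultimately show ?thesis by blast
  qed
qed

lemma last_gate:
  assumes g: "gate n (L, R)" and w: "common_endpoint w (T (End 0)) (T (End 1))"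
  shows "T (End 0) = closed_segment L w" "T (End 1) = closed_segment R w" "ori L R w > 0"
proof -
  have LR: "T (Orig n) = closed_segment L R" using g unfolding gate_def by simp
  have "(Orig n, End 0) \<in> parcs (extended_quiver n Q)"
    using arcs_extended_quiver[OF quiver] by blast
  then obtain a b c h where abc: "ori c a b > 0" "T (Orig n) = closed_segment c a"
    "T (End 0) = closed_segment c b" "T h = closed_segment a b" "h \<in> labels n"
    "(End 0, h) \<in> parcs (extended_quiver n Q)"
    by (rule arrow_triangle)
  have h: "h = End 1" using abc(6) unfolding arcs_extended_quiver[OF quiver] by auto
  have "w \<in> {c, b}" "w \<in> {a, b}"
    using w abc h by (auto simp: common_endpoint_def extreme_point_of_segment)
  moreover have "c \<noteq> a" using abc by auto
  ultimately have [simp]: "b = w" by auto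
  have "{c, a} = {L, R}" using LR abc by (metis closed_segment_eq)
  moreover have "\<not> (c = R \<and> a = L)"
    using gate_opposite[OF g, of "End 1" "End 0"] h abc by (auto simp: closed_segment_commute)
  ultimately have [simp]: "c = L" "a = R" by (auto simp: doubleton_eq_iff)
  show "T (End 0) = closed_segment L w" "T (End 1) = closed_segment R w" "ori L R w > 0"
    using abc h by simp_all
qed

lemma gates:
  assumes v: "common_endpoint v (T (Start 0)) (T (Start 1))"
    and w: "common_endpoint w (T (End 0)) (T (End 1))"
  obtains l r where
    "\<And>i. 1 \<le> i \<Longrightarrow> i \<le> n \<Longrightarrow> T (Orig i) = closed_segment (l i) (r i)"
    "\<And>i. 1 \<le> i \<Longrightarrow> i < n \<Longrightarrow> next_gate i (l i, r i) (l (Suc i), r (Suc i))"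
    "T (Start 0) = closed_segment v (r 1)" "T (Start 1) = closed_segment v (l 1)"
    "ori (r 1) (l 1) v > 0"
    "T (End 0) = closed_segment (l n) w" "T (End 1) = closed_segment (r n) w"
    "ori (l n) (r n) w > 0"
proof -
  obtain L R where LR: "gate 1 (L, R)" "T (Start 0) = closed_segment v R"
    "T (Start 1) = closed_segment v L" "ori R L v > 0"
    using first_gate[OF v] by blast
  \<comment> \<open>Index \<open>k\<close> stands for gate \<open>k + 1\<close>; for
    \<open>k \<ge> n\<close> the conditions are vacuous, so that the choice can run through all
    natural numbers.\<close>
  define A where "A k x \<longleftrightarrow> (k < n \<longrightarrow> gate (Suc k) x) \<and> (k = 0 \<longrightarrow> x = (L, R))" for k x
  define B where "B k x x' \<longleftrightarrow> (Suc k < n \<longrightarrow> next_gate (Suc k) x x')" for k x x'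
  have "\<exists>f. \<forall>k. A k (f k) \<and> B k (f k) (f (Suc k))"
  proof (rule dependent_nat_choice)
    show "\<exists>x. A 0 x" using LR by (auto simp: A_def)
    show "\<exists>x'. A (Suc k) x' \<and> B k x x'" if "A k x" for x k
    proof (cases "Suc k < n")
      case True
      then have "gate (Suc k) (fst x, snd x)" using that by (simp add: A_def)
      from gate_Suc[OF this] True show ?thesis by (auto simp: A_def B_def)
    qed (auto simp: A_def B_def)
  qed
  then obtain f where f: "\<And>k. A k (f k)" "\<And>k. B k (f k) (f (Suc k))" by blast
  define l r where "l i = fst (f (i - 1))" and "r i = snd (f (i - 1))" for i
  have gate: "gate i (l i, r i)" if "1 \<le> i" "i \<le> n" for i
    using f(1)[of "i - 1"] that by (simp add: A_def l_def r_def)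
  have next_i: "next_gate i (l i, r i) (l (Suc i), r (Suc i))" if "1 \<le> i" "i < n" for i
    using f(2)[of "i - 1"] that by (simp add: B_def l_def r_def)
  have "l 1 = L" "r 1 = R" using f(1)[of 0] by (simp_all add: A_def l_def r_def)
  moreover have "T (Orig i) = closed_segment (l i) (r i)" if "1 \<le> i" "i \<le> n" for i
    using gate[OF that] by (simp add: gate_def)
  moreover note last_gate[OF gate w]
  ultimately show thesis
    using that[of l r] next_i LR n_ge_2 by simp
qed

end


section \<open>Diagonals separating v from w\<close>

locale gate_sequence = quiver_triangulation +
  fixes l r :: "nat \<Rightarrow> complex" and v w :: complex
  assumes T_Orig: "1 \<le> i \<Longrightarrow> i \<le> n \<Longrightarrow> T (Orig i) = closed_segment (l i) (r i)"
    and next_gate: "1 \<le> i \<Longrightarrow> i < n \<Longrightarrow> next_gate i (l i, r i) (l (Suc i), r (Suc i))"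
    and T_Start: "T (Start 0) = closed_segment v (r 1)" "T (Start 1) = closed_segment v (l 1)"
    and v_left: "ori (r 1) (l 1) v > 0"
    and T_End: "T (End 0) = closed_segment (l n) w" "T (End 1) = closed_segment (r n) w"
    and w_right: "ori (l n) (r n) w > 0"
begin

lemma gate_extreme:
  assumes "1 \<le> i" "i \<le> n"
  shows "l i extreme_point_of P" "r i extreme_point_of P"
  using T_endpoints_extreme[OF _ T_Orig[OF assms]] assms by auto

lemma vw_extreme: "v extreme_point_of P" "w extreme_point_of P"
  using T_endpoints_extreme(1)[OF _ T_Start(1)] T_endpoints_extreme(2)[OF _ T_End(1)] by auto

lemma next_gate_0:
  assumes "1 \<le> i" "i < n" "delta Q i = 0"
  shows "l (Suc i) = l i" "ori (l i) (r i) (r (Suc i)) > 0"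
    "T (Mid i) = closed_segment (r i) (r (Suc i))"
  using next_gate[OF assms(1,2)] assms(3) by (simp_all add: next_gate_def)

lemma next_gate_1:
  assumes "1 \<le> i" "i < n" "delta Q i \<noteq> 0"
  shows "r (Suc i) = r i" "ori (l i) (r i) (l (Suc i)) > 0"
    "T (Mid i) = closed_segment (l i) (l (Suc i))"
  using next_gate[OF assms(1,2)] assms(3) by (simp_all add: next_gate_def)

lemma l_ne_r:
  assumes "1 \<le> i" "i \<le> n"
  shows "l i \<noteq> r i"
proof (cases "i < n")
  case True
  then show ?thesis
    using next_gate_0(2)[OF assms(1) True] next_gate_1(2)[OF assms(1) True]
    by (cases "delta Q i = 0") auto
next
  case False
  then show ?thesis using w_right assms by auto
qed

text \<open>The new corner of the triangle between the two diagonals is ahead of \<open>T_i\<close>.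
  By \<open>opposite_side\<close> a vertex behind \<open>T_i\<close> is then on the triangle's side
  of \<open>T_{i+1}\<close>, which is the side behind it.\<close>

lemma behind_Suc:
  assumes "1 \<le> i" "i < n" "p extreme_point_of P" "ori (l i) (r i) p < 0"
  shows "ori (l (Suc i)) (r (Suc i)) p < 0"
proof -
  note ext = gate_extreme[of i] gate_extreme[of "Suc i"]
  show ?thesis
  proof (cases "delta Q i = 0")
    case True
    have "ori (l i) p (r (Suc i)) > 0"
      by (rule opposite_side(1)[OF convex_P, of _ "r i"])
        (use ext assms next_gate_0[OF assms(1,2) True] in auto)
    then show ?thesis
      using next_gate_0(1)[OF assms(1,2) True] ori_swap[of "l i" p "r (Suc i)"]
        ori_rotate[of p "l i" "r (Suc i)"] ori_rotate[of "l i" "r (Suc i)" p] by simp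
  next
    case False
    have "ori p (r i) (l (Suc i)) > 0"
      by (rule opposite_side(2)[OF convex_P, of "l i"])
        (use ext assms next_gate_1[OF assms(1,2) False] in auto)
    then show ?thesis
      using next_gate_1(1)[OF assms(1,2) False] ori_swap[of p "r i" "l (Suc i)"]
        ori_rotate[of "l (Suc i)" "r i" p] ori_rotate[of "r i" p "l (Suc i)"] by simp
  qed
qed

text \<open>The argument of \<open>behind_Suc\<close> with the same triangle read backwards:
  \<open>T_{i+1}\<close> is the base and the dropped corner is the apex.\<close>

lemma ahead_pred:
  assumes "1 \<le> i" "i < n" "p extreme_point_of P" "ori (l (Suc i)) (r (Suc i)) p > 0"
  shows "ori (l i) (r i) p > 0"
proof -
  note ext = gate_extreme[of i] gate_extreme[of "Suc i"]
  show ?thesis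
  proof (cases "delta Q i = 0")
    case True
    note g = next_gate_0[OF assms(1,2) True]
    have "ori p (l i) (r i) > 0"
    proof (rule opposite_side(2)[OF convex_P, of "r (Suc i)"])
      show "ori (r (Suc i)) (l i) (r i) > 0" using g by (simp add: ori_def algebra_simps)
      show "ori (r (Suc i)) (l i) p < 0" using g assms(4) ori_swap[of "r (Suc i)" "l i" p] by simp
    qed (use ext assms g in auto)
    then show ?thesis by (simp add: ori_def algebra_simps)
  next
    case False
    note g = next_gate_1[OF assms(1,2) False]
    have "ori (r i) p (l i) > 0"
    proof (rule opposite_side(1)[OF convex_P, of _ "l (Suc i)"])
      show "ori (r i) (l (Suc i)) (l i) > 0" using g by (simp add: ori_def algebra_simps)
      show "ori (r i) (l (Suc i)) p < 0" using g assms(4) ori_swap[of "r i" "l (Suc i)" p] by simp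
    qed (use ext assms g in auto)
    then show ?thesis by (simp add: ori_def algebra_simps)
  qed
qed

lemma behind_mono:
  assumes "i \<le> j" "1 \<le> i" "j \<le> n" "p extreme_point_of P" "ori (l i) (r i) p < 0"
  shows "ori (l j) (r j) p < 0"
  using assms by (induction j rule: dec_induct) (auto intro: behind_Suc)

lemma v_behind:
  assumes "1 \<le> i" "i \<le> n"
  shows "ori (l i) (r i) v < 0"
  using behind_mono[OF assms(1) _ assms(2) vw_extreme(1)] v_left ori_swap[of "l 1" "r 1" v] by simp

lemma w_ahead:
  assumes "1 \<le> i" "i \<le> n"
  shows "ori (l i) (r i) w > 0"
  using assms(2,1)
proof (induction i rule: inc_induct)
  case base
  show ?case by (rule w_right)
next
  case (step j)
  then show ?case using ahead_pred[OF _ _ vw_extreme(2), of j] by simp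
qed

lemma dropped_vertex_behind:
  assumes "1 \<le> i" "i < n" "x \<in> {l i, r i}" "x \<notin> {l (Suc i), r (Suc i)}"
  shows "ori (l (Suc i)) (r (Suc i)) x < 0"
proof (cases "delta Q i = 0")
  case True
  note g = next_gate_0[OF assms(1,2) True]
  with assms have "x = r i" by auto
  then show ?thesis
    using g by (simp add: ori_def algebra_simps)
next
  case False
  note g = next_gate_1[OF assms(1,2) False]
  with assms have "x = l i" by auto
  then show ?thesis
    using g by (simp add: ori_def algebra_simps)
qed

lemma vertex_stays_or_behind:
  assumes "i \<le> j" "1 \<le> i" "j \<le> n" "x \<in> {l i, r i}"
  shows "x \<in> {l j, r j} \<or> ori (l j) (r j) x < 0"
  using assms
proof (induction j rule: dec_induct)
  case base
  then show ?case by blast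
next
  case (step m)
  have "x extreme_point_of P" using gate_extreme[of i] step by auto
  then show ?case
    using step dropped_vertex_behind[of m x] behind_Suc[of m x] by auto
qed

text \<open>A vertex that the strip drops is strictly behind all later diagonals, so
  \<open>ori\<close> never vanishes at it again and it cannot return.\<close>

lemma vertex_interval:
  assumes "1 \<le> i" "i \<le> j" "j \<le> k" "k \<le> n" "x \<in> {l i, r i}" "x \<in> {l k, r k}"
  shows "x \<in> {l j, r j}"
proof (rule ccontr)
  assume "x \<notin> {l j, r j}"
  then have "ori (l j) (r j) x < 0" using vertex_stays_or_behind[of i j x] assms by simp
  then have "ori (l k) (r k) x < 0"
    using behind_mono[of j k x] gate_extreme[of i] assms by auto
  then show False using assms(6) by auto
qed

lemma v_not_gate: "1 \<le> i \<Longrightarrow> i \<le> n \<Longrightarrow> v \<notin> {l i, r i}"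
  using v_behind[of i] by auto

lemma w_not_gate: "1 \<le> i \<Longrightarrow> i \<le> n \<Longrightarrow> w \<notin> {l i, r i}"
  using w_ahead[of i] by auto

section \<open>Order of the crossing points\<close>

lemma v_ne_w: "v \<noteq> w"
  using v_behind[of 1] w_ahead[of 1] n_ge_2 by auto

text \<open>The zero in \<open>t\<close> of the affine function
  \<open>ori (l i) (r i) (diagonal_point t)\<close>, which is negative at \<open>v\<close> and
  positive at \<open>w\<close>.\<close>

definition crossing_parameter :: "nat \<Rightarrow> real" where
  "crossing_parameter i =
     - ori (l i) (r i) v / (ori (l i) (r i) w - ori (l i) (r i) v)"

abbreviation diagonal_point :: "real \<Rightarrow> complex" where
  "diagonal_point t \<equiv> (1 - t) *\<^sub>R v + t *\<^sub>R w"

lemma crossing_parameter_bounds: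
  assumes "1 \<le> i" "i \<le> n"
  shows "0 < crossing_parameter i" "crossing_parameter i < 1"
  using v_behind[OF assms] w_ahead[OF assms] by (auto simp: crossing_parameter_def field_simps)

lemma ori_diagonal_point:
  assumes "1 \<le> i" "i \<le> n"
  shows "ori (l i) (r i) (diagonal_point t)
    = (t - crossing_parameter i) * (ori (l i) (r i) w - ori (l i) (r i) v)"
proof -
  have "ori (l i) (r i) w - ori (l i) (r i) v \<noteq> 0" using v_behind[OF assms] w_ahead[OF assms] by simp
  then have "crossing_parameter i * (ori (l i) (r i) w - ori (l i) (r i) v) = - ori (l i) (r i) v"
    by (simp add: crossing_parameter_def)
  then show ?thesis unfolding ori_affine by (simp add: algebra_simps)
qed

lemma ori_diagonal_point_sign:
  assumes "1 \<le> i" "i \<le> n"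
  shows "ori (l i) (r i) (diagonal_point t) > 0 \<longleftrightarrow> crossing_parameter i < t"
    "ori (l i) (r i) (diagonal_point t) = 0 \<longleftrightarrow> t = crossing_parameter i"
  using v_behind[OF assms] w_ahead[OF assms]
  unfolding ori_diagonal_point[OF assms] by (auto simp: zero_less_mult_iff)

lemma crossing_in_gate:
  assumes "1 \<le> i" "i \<le> n"
  shows "diagonal_point (crossing_parameter i) \<in> open_segment (l i) (r i)"
proof -
  define t where "t = crossing_parameter i"
  define x where "x = diagonal_point t"
  \<comment> \<open>Barycentric coordinates of \<open>x\<close> in the triangle of
    \<open>l i\<close>, \<open>r i\<close> and \<open>w\<close>. The coordinate at \<open>w\<close>
    vanishes because \<open>x\<close> is on the line of \<open>T_i\<close>, and the other two are
    positive because \<open>v\<close> is opposite to \<open>w\<close>.\<close>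
  define a b where "a = ori x (r i) w / ori (l i) (r i) w"
    and "b = ori (l i) x w / ori (l i) (r i) w"
  note vw = v_behind[OF assms] w_ahead[OF assms]
  have "ori (l i) v w > 0" "ori v (r i) w > 0"
    using opposite_side[OF convex_P gate_extreme[OF assms] vw_extreme(2,1) vw(2,1)] by auto
  moreover have "ori (l i) x w = (1 - t) * ori (l i) v w" "ori x (r i) w = (1 - t) * ori v (r i) w"
    by (simp_all add: x_def ori_def algebra_simps)
  moreover have "t < 1" using crossing_parameter_bounds[OF assms] by (simp add: t_def)
  ultimately have "a > 0" "b > 0" using vw by (simp_all add: a_def b_def)
  moreover have "ori (l i) (r i) x = 0" using ori_diagonal_point_sign(2)[OF assms] x_def t_def by simp
  then have "x = a *\<^sub>R l i + b *\<^sub>R r i" "a + b = 1"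
    using barycentric[of "l i" "r i" w x] vw by (auto simp: a_def b_def)
  moreover have "a = 1 - b" using \<open>a + b = 1\<close> by simp
  ultimately have "x \<in> open_segment (l i) (r i)"
    unfolding in_segment using l_ne_r[OF assms] by (intro conjI exI[of _ b]) auto
  then show ?thesis by (simp add: x_def t_def)
qed

lemma ori_on_gate: "x \<in> closed_segment (l i) (r i) \<Longrightarrow> ori (l i) (r i) x = 0"
  unfolding in_segment using ori_affine[of "l i" "r i" _ "l i" "r i"] by auto

lemma crossing_point_gate:
  assumes "1 \<le> i" "i \<le> n"
  shows "crossing_point v w (T (Orig i)) = diagonal_point (crossing_parameter i)"
proof -
  have "closed_segment v w \<inter> closed_segment (l i) (r i) = {diagonal_point (crossing_parameter i)}"
  proof (intro equalityI subsetI)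
    fix x assume x: "x \<in> closed_segment v w \<inter> closed_segment (l i) (r i)"
    then obtain t where t: "x = diagonal_point t" by (auto simp: in_segment)
    then have "t = crossing_parameter i"
      using ori_on_gate[of x i] x ori_diagonal_point_sign(2)[OF assms] by auto
    with t show "x \<in> {diagonal_point (crossing_parameter i)}" by simp
  next
    fix x assume "x \<in> {diagonal_point (crossing_parameter i)}"
    moreover have "diagonal_point (crossing_parameter i) \<in> closed_segment v w"
      unfolding in_segment using crossing_parameter_bounds[OF assms] by (intro exI conjI) auto
    ultimately show "x \<in> closed_segment v w \<inter> closed_segment (l i) (r i)"
      using open_closed_segment[OF crossing_in_gate[OF assms]] by simp
  qed
  then show ?thesis by (simp add: crossing_point_def T_Orig[OF assms])
qed

text \<open>The segment from \<open>v\<close> to \<open>w\<close> meets \<open>T_{i+1}\<close> in an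
  interior point. One endpoint of \<open>T_{i+1}\<close> is on \<open>T_i\<close> and the other is
  ahead of it, hence so is every interior point.\<close>

lemma crossing_parameter_Suc:
  assumes "1 \<le> i" "i < n"
  shows "crossing_parameter i < crossing_parameter (Suc i)"
proof -
  let ?x = "diagonal_point (crossing_parameter (Suc i))"
  have "?x \<in> open_segment (l (Suc i)) (r (Suc i))" using crossing_in_gate[of "Suc i"] assms by simp
  then obtain u where u: "0 < u" "u < 1" "?x = (1 - u) *\<^sub>R l (Suc i) + u *\<^sub>R r (Suc i)"
    unfolding in_segment by blast
  have "ori (l i) (r i) ?x > 0"
  proof (cases "delta Q i = 0")
    case True
    then show ?thesis using next_gate_0[OF assms True] u by (simp add: u(3) ori_affine del: scaleR_collapse)
  next
    case False
    then show ?thesis using next_gate_1[OF assms False] u by (simp add: u(3) ori_affine)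
  qed
  then show ?thesis using ori_diagonal_point_sign(1)[of i] assms by simp
qed

lemma dist_crossing_point_less:
  assumes "1 \<le> i" "j \<le> n" "i < j"
  shows "dist v (crossing_point v w (T (Orig i))) < dist v (crossing_point v w (T (Orig j)))"
proof -
  have "crossing_parameter i < crossing_parameter j"
    using Suc_leI[OF assms(3)] assms(2)
  proof (induction j rule: dec_induct)
    case base
    then show ?case using crossing_parameter_Suc[of i] assms(1) by simp
  next
    case (step k)
    then show ?case using crossing_parameter_Suc[of k] assms(1) by simp
  qed
  moreover have "dist v (diagonal_point t) = \<bar>t\<bar> * dist v w" for t
  proof -
    have "v - diagonal_point t = t *\<^sub>R (v - w)" by (simp add: algebra_simps)
    then show ?thesis by (simp add: dist_norm)
  qed
  ultimately show ?thesis
    using assms crossing_point_gate crossing_parameter_bounds(1)[of i]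
      crossing_parameter_bounds(1)[of j] v_ne_w by simp
qed

lemma T_boundary_segment:
  assumes "e \<in> labels n" "e \<notin> range Orig"
  obtains a b where "T e = closed_segment a b" "a \<noteq> b"
proof -
  have "\<exists>a b. T e = closed_segment a b"
  proof (cases e)
    case (Mid i)
    then have i: "1 \<le> i" "i < n" using assms by auto
    then show ?thesis using Mid next_gate_0(3)[OF i] next_gate_1(3)[OF i] by auto
  qed (use assms T_Start T_End in auto)
  then obtain a b where "T e = closed_segment a b" by blast
  moreover have "a \<noteq> b"
    using T_edge[OF assms] calculation by (auto simp: edge_of_def)
  ultimately show thesis using that by blast
qed

text \<open>Turns the crossing conditions on T-paths into conditions on labels: boundary edges are
  never crossed, diagonals of the triangulation always are.\<close>

lemma crosses_iff:
  assumes "e \<in> labels n"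
  shows "crosses (T e) (closed_segment v w) \<longleftrightarrow> e \<in> range Orig"
proof (cases "e \<in> range Orig")
  case True
  then obtain i where i: "e = Orig i" "1 \<le> i" "i \<le> n" using assms by auto
  have "diagonal_point (crossing_parameter i) \<in> open_segment v w"
    unfolding in_segment using crossing_parameter_bounds[OF i(2,3)] v_ne_w by (intro exI conjI) auto
  moreover have "{l i, r i} \<noteq> {v, w}" using v_not_gate[OF i(2,3)] by blast
  ultimately show ?thesis
    using crosses_closed_segment[OF l_ne_r[OF i(2,3)] v_ne_w] crossing_in_gate[OF i(2,3)]
      T_Orig[OF i(2,3)] i(1) by auto
next
  case False
  then obtain a b where "T e = closed_segment a b" "a \<noteq> b" using T_boundary_segment assms by blast
  then show ?thesis
    using False edge_not_crossed[OF _ vw_extreme _ v_ne_w] T_edge[OF assms] by auto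
qed

end

section \<open>Cancellation of adjacent duplicates\<close>

text \<open>The deleted pair contributes either zero or two to a count.\<close>

lemma cancel_step_parity:
  assumes "cancel_step xs ys"
  shows "even (length (filter P xs)) \<longleftrightarrow> even (length (filter P ys))"
  using assms by cases auto

lemma cancel_step_sorted:
  assumes "cancel_step xs ys" "sorted (map f xs)"
  shows "sorted (map f ys)"
  using assms by cases (auto simp: sorted_append)

lemma cancel_step_set: "cancel_step xs ys \<Longrightarrow> set ys \<subseteq> set xs"
  by (erule cancel_step.cases) auto

text \<open>Entries after the deleted pair shift by two and keep the parity of their position. List
  indices start at \<open>0\<close>, so the odd ones belong to the steps with even number.\<close>

lemma cancel_step_odd_positions:
  assumes "cancel_step xs ys" and R: "\<And>k. k < length xs \<Longrightarrow> odd k \<Longrightarrow> R (xs ! k)"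
    and k: "k < length ys" "odd k"
  shows "R (ys ! k)"
  using assms(1)
proof cases
  case (1 es e fs)
  show ?thesis
  proof (cases "k < length es")
    case True
    then show ?thesis using R[of k] k 1 by (simp add: nth_append)
  next
    case False
    then have "xs ! (k + 2) = ys ! k" using 1 by (simp add: nth_append nth_Cons' not_less)
    then show ?thesis using R[of "k + 2"] k 1 by simp
  qed
qed

lemma cancel_steps_parity:
  "cancel_step\<^sup>*\<^sup>* xs ys \<Longrightarrow> even (length (filter P xs)) \<longleftrightarrow> even (length (filter P ys))"
  by (induction rule: rtranclp_induct) (simp_all add: cancel_step_parity)

lemma cancel_steps_sorted:
  "cancel_step\<^sup>*\<^sup>* xs ys \<Longrightarrow> sorted (map f xs) \<Longrightarrow> sorted (map f ys)"
  by (induction rule: rtranclp_induct) (auto intro: cancel_step_sorted)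

lemma cancel_steps_set: "cancel_step\<^sup>*\<^sup>* xs ys \<Longrightarrow> set ys \<subseteq> set xs"
  by (induction rule: rtranclp_induct) (auto dest: cancel_step_set)

lemma cancel_steps_odd_positions:
  assumes "cancel_step\<^sup>*\<^sup>* xs ys" and "\<And>k. k < length xs \<Longrightarrow> odd k \<Longrightarrow> R (xs ! k)"
  shows "k < length ys \<Longrightarrow> odd k \<Longrightarrow> R (ys ! k)"
  using assms
proof (induction arbitrary: k rule: rtranclp_induct)
  case (step ys zs)
  then show ?case using cancel_step_odd_positions[of ys zs R k] by blast
qed blast

lemma cancels_to_exists: "\<exists>ys. cancels_to xs ys"
proof (induction xs rule: length_induct)
  case (1 xs)
  show ?case
  proof (cases "\<exists>ys. cancel_step xs ys")
    case True
    then obtain ys where ys: "cancel_step xs ys" by blast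
    then have "length ys < length xs" by cases simp
    with 1 obtain zs where "cancels_to ys zs" by blast
    then have "cancels_to xs zs"
      using ys unfolding cancels_to_def by (meson converse_rtranclp_into_rtranclp)
    then show ?thesis by blast
  qed (auto simp: cancels_to_def)
qed

lemma no_cancel_step_distinct_adj:
  assumes "\<not> (\<exists>ys. cancel_step xs ys)"
  shows "distinct_adj xs"
proof (rule ccontr)
  assume "\<not> distinct_adj xs"
  then obtain k where k: "Suc k < length xs" "xs ! k = xs ! Suc k"
    unfolding distinct_adj_conv_nth by auto
  then have "xs = take k xs @ [xs ! k, xs ! k] @ drop (Suc (Suc k)) xs"
    by (metis Cons_nth_drop_Suc Suc_lessD append_Cons append_Nil append_take_drop_id)
  then have "cancel_step xs (take k xs @ drop (Suc (Suc k)) xs)"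
    by (metis cancel_step.intros)
  with assms show False by blast
qed

lemma cancels_to_strictly_sorted:
  fixes f :: "qvertex \<Rightarrow> nat"
  assumes "cancels_to xs ys" "sorted (map f xs)" "inj_on f (set xs)"
  shows "sorted_wrt (<) (map f ys)"
proof -
  have ys: "cancel_step\<^sup>*\<^sup>* xs ys" "distinct_adj ys"
    using assms(1) no_cancel_step_distinct_adj unfolding cancels_to_def by auto
  have sorted: "sorted (map f ys)" using cancel_steps_sorted ys(1) assms(2) by blast
  have inj: "inj_on f (set ys)" using cancel_steps_set[OF ys(1)] assms(3) inj_on_subset by blast
  have "successively (<) (map f ys)"
    unfolding successively_conv_nth
  proof (intro allI impI)
    fix k assume k: "Suc k < length (map f ys)"
    have "f (ys ! k) \<le> f (ys ! Suc k)" using sorted k by (simp add: sorted_iff_nth_Suc)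
    moreover have "ys ! k \<noteq> ys ! Suc k" using ys(2) k unfolding distinct_adj_conv_nth by simp
    then have "f (ys ! k) \<noteq> f (ys ! Suc k)" using inj k by (auto simp: inj_on_def)
    ultimately show "map f ys ! k < map f ys ! Suc k" using k by simp
  qed
  then show ?thesis by (simp add: successively_conv_sorted_wrt)
qed

lemma strictly_sorted_eqI:
  fixes f :: "'a \<Rightarrow> nat"
  assumes "sorted_wrt (<) (map f xs)" "sorted_wrt (<) (map f ys)"
    and "set xs = set ys" and "inj_on f (set xs)"
  shows "xs = ys"
proof -
  have "map f xs = map f ys"
    using assms(1-3) by (intro strict_sorted_equal) simp_all
  then show ?thesis using assms(3,4) by (simp add: inj_on_map_eq_map)
qed

section \<open>Words and their reductions\<close>

text \<open>The level orders the edges along the triangulation from \<open>v\<close> to \<open>w\<close>; a complete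
  edge sequence \<open>\<alpha>'\<close> is weakly increasing for it, and cancellation makes it strictly increasing.\<close>

definition level :: "nat \<Rightarrow> qvertex \<Rightarrow> nat" where
  "level n e = (case e of Start k \<Rightarrow> k | Orig i \<Rightarrow> 2 * i + 1 | Mid i \<Rightarrow> 2 * i + 2 | End k \<Rightarrow> 2 * n + 2 + k)"

lemma level_simps [simp]:
  "level n (Start k) = k" "level n (Orig i) = 2 * i + 1" "level n (Mid i) = 2 * i + 2"
  "level n (End k) = 2 * n + 2 + k"
  by (simp_all add: level_def)

lemma inj_on_level: "inj_on (level n) (labels n)"
proof (rule inj_onI)
  fix x z assume "x \<in> labels n" "z \<in> labels n" "level n x = level n z"
  then show "x = z" by (cases x; cases z) (auto, presburger+)
qed

text \<open>The sequence \<alpha>' with its odd entries left as parameters: \<open>e i\<close> is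
  entry \<open>2 * i + 1\<close>, and the even entries are the fixed diagonals.\<close>

primrec word :: "(nat \<Rightarrow> qvertex) \<Rightarrow> nat \<Rightarrow> qvertex list" where
  "word e 0 = [e 0]"
| "word e (Suc m) = word e m @ [Orig (Suc m), e (Suc m)]"

definition slots :: "nat \<Rightarrow> (nat \<Rightarrow> qvertex) \<Rightarrow> bool" where
  "slots n e \<longleftrightarrow> e 0 \<in> {Start 0, Start 1} \<and> e n \<in> {End 0, End 1} \<and>
     (\<forall>i. 1 \<le> i \<and> i < n \<longrightarrow> e i \<in> {Orig i, Orig (Suc i), Mid i})"

lemma length_word [simp]: "length (word e m) = 2 * m + 1"
  by (induction m) auto

lemma word_last: "1 \<le> m \<Longrightarrow> word e m = word e (m - 1) @ [Orig m, e m]"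
  by (cases m) simp_all

lemma word_cong: "(\<And>i. i \<le> m \<Longrightarrow> e i = e' i) \<Longrightarrow> word e m = word e' m"
  by (induction m) auto

lemma set_word: "set (word e m) = e ` {0..m} \<union> Orig ` {1..m}"
  by (induction m) (auto simp: atLeastAtMostSuc_conv)

lemma word_odd_positions: "k < length (word e m) \<Longrightarrow> odd k \<Longrightarrow> word e m ! k \<in> range Orig"
proof (induction m)
  case (Suc m)
  then have "k < length (word e m) \<or> k = 2 * m + 1 \<or> k = 2 * m + 2" by auto
  then show ?case using Suc by (auto simp: nth_append)
qed simp

lemma map_upt_eq_word:
  assumes "\<And>k. even k \<Longrightarrow> f k = Orig (k div 2)"
  shows "map f [1..<2 * m + 2] = word (\<lambda>i. f (2 * i + 1)) m"
proof (induction m)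
  case (Suc m)
  have "[1..<2 * Suc m + 2] = [1..<2 * m + 2] @ [2 * m + 2, 2 * m + 3]"
    using upt_Suc_append[of 1 "2 * m + 2"] upt_Suc_append[of 1 "2 * m + 3"]
    by (simp add: eval_nat_numeral)
  moreover have "f (2 * m + 2) = Orig (Suc m)" using assms[of "2 * m + 2"] by simp
  moreover have "2 * Suc m + 1 = 2 * m + 3" by simp
  ultimately show ?case using Suc by simp
qed (simp add: numeral_eq_Suc)

lemma set_word_labels:
  assumes "slots n e"
  shows "set (word e n) \<subseteq> labels n"
proof -
  have "e i \<in> labels n" if "i \<le> n" for i
  proof (cases "i = 0 \<or> i = n")
    case False
    then have "1 \<le> i" "i < n" using that by auto
    then have "e i \<in> {Orig i, Orig (Suc i), Mid i}" using assms by (simp add: slots_def)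
    with \<open>1 \<le> i\<close> \<open>i < n\<close> show ?thesis by auto
  qed (use assms in \<open>auto simp: slots_def\<close>)
  then show ?thesis by (auto simp: set_word)
qed

lemma level_slot:
  assumes "slots n e" "1 \<le> i" "i \<le> n"
  shows "2 * i + 1 \<le> level n (e i)" "level n (e i) \<le> 2 * i + 1 \<longleftrightarrow> e i = Orig i"
    "i < n \<Longrightarrow> level n (e i) \<le> 2 * i + 3"
proof -
  have "i < n \<and> e i \<in> {Orig i, Orig (Suc i), Mid i} \<or> i = n \<and> e i \<in> {End 0, End 1}"
    using assms unfolding slots_def by (metis le_neq_implies_less)
  then show "2 * i + 1 \<le> level n (e i)" "level n (e i) \<le> 2 * i + 1 \<longleftrightarrow> e i = Orig i"
    "i < n \<Longrightarrow> level n (e i) \<le> 2 * i + 3" by auto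
qed

lemma level_word_le:
  assumes "slots n e" "m < n" "x \<in> set (word e m)"
  shows "level n x \<le> 2 * m + 3"
proof -
  from assms(3) consider i where "i \<le> m" "x = e i" | i where "i \<le> m" "x = Orig i"
    by (auto simp: set_word)
  then show ?thesis
  proof cases
    case 1
    then show ?thesis
      using level_slot(3)[OF assms(1), of i] assms(1,2) by (cases "i = 0") (auto simp: slots_def)
  qed auto
qed

lemma sorted_word:
  assumes "slots n e"
  shows "m \<le> n \<Longrightarrow> sorted (map (level n) (word e m))"
proof (induction m)
  case (Suc m)
  then show ?case
    using level_word_le[OF assms, of m] level_slot(1)[OF assms, of "Suc m"]
    by (fastforce simp: sorted_append)
qed simp

section \<open>Counting edges up to a diagonal\<close>

definition low_count :: "nat \<Rightarrow> nat \<Rightarrow> qvertex list \<Rightarrow> nat" where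
  "low_count n i xs = length (filter (\<lambda>x. level n x \<le> 2 * i + 1) xs)"

text \<open>The \<open>2 * i\<close> entries up to the fixed \<open>Orig i\<close> all count; of the
  later ones at most \<open>e i\<close> does. The parity, which survives cancellation, thus shows
  whether \<open>e i\<close> is \<open>Orig i\<close>.\<close>

lemma low_count_word:
  assumes "slots n e" "1 \<le> i" "i \<le> m" "m \<le> n"
  shows "low_count n i (word e m) = 2 * i + of_bool (e i = Orig i)"
  using assms(3,4)
proof (induction m rule: dec_induct)
  case base
  obtain k where k: "i = Suc k" using assms(2) by (cases i) auto
  have "filter (\<lambda>x. level n x \<le> 2 * i + 1) (word e k) = word e k"
    using level_word_le[OF assms(1), of k] base k by (fastforce simp: filter_id_conv)
  then show ?case
    using level_slot(2)[OF assms(1,2)] base k by (simp add: low_count_def)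
next
  case (step m)
  then show ?case
    using level_slot(1)[OF assms(1), of "Suc m"] by (simp add: low_count_def)
qed

text \<open>The only slot in which a label that is not a diagonal can occur; the value at
  \<open>Orig i\<close> is a dummy.\<close>

definition slot_position :: "nat \<Rightarrow> qvertex \<Rightarrow> nat" where
  "slot_position n x = (case x of Mid i \<Rightarrow> i | Start k \<Rightarrow> 0 | End k \<Rightarrow> n | Orig i \<Rightarrow> 0)"

lemma slot_position_simps [simp]:
  "slot_position n (Mid i) = i" "slot_position n (Start k) = 0" "slot_position n (End k) = n"
  by (simp_all add: slot_position_def)

lemma slot_position_unique:
  assumes "slots n e" "1 \<le> n" "j \<le> n" "e j \<notin> range Orig"
  shows "j = slot_position n (e j)"
proof -
  consider "j = 0" | "j = n" | "1 \<le> j" "j < n" using assms(3) by linarith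
  then show ?thesis
  proof cases
    case 3
    then have "e j \<in> {Orig j, Orig (Suc j), Mid j}" using assms(1) by (simp add: slots_def)
    then show ?thesis using assms(4) by auto
  qed (use assms in \<open>auto simp: slots_def\<close>)
qed

lemma length_filter_word:
  assumes "x \<notin> range Orig"
  shows "length (filter (\<lambda>z. z = x) (word e m)) = card {j. j \<le> m \<and> e j = x}"
proof (induction m)
  case 0
  have "{j. j = 0 \<and> e j = x} = (if e 0 = x then {0} else {})" by auto
  then show ?case by simp
next
  case (Suc m)
  have "{j. j \<le> Suc m \<and> e j = x}
      = {j. j \<le> m \<and> e j = x} \<union> (if e (Suc m) = x then {Suc m} else {})"
    by (auto simp: le_Suc_eq)
  then have "card {j. j \<le> Suc m \<and> e j = x}
      = card {j. j \<le> m \<and> e j = x} + of_bool (e (Suc m) = x)"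
    by (simp add: card_insert_if)
  then show ?case using Suc assms by auto
qed

text \<open>All that is needed about a reduction, derived from invariants of a single deletion. A
  label that is not a diagonal occurs at most once in the word, so for it the parity of the number
  of occurrences is membership.\<close>

lemma cancels_to_word:
  assumes e: "slots n e" and n: "1 \<le> n" and es: "cancels_to (word e n) es"
  shows "sorted_wrt (<) (map (level n) es)" "set es \<subseteq> labels n" "odd (length es)"
    and "\<And>k. k < length es \<Longrightarrow> odd k \<Longrightarrow> es ! k \<in> range Orig"
    and "\<And>i. 1 \<le> i \<Longrightarrow> i \<le> n \<Longrightarrow> odd (low_count n i es) \<longleftrightarrow> e i = Orig i"
    and "\<And>x. x \<notin> range Orig \<Longrightarrow> slot_position n x \<le> n \<Longrightarrow>
      x \<in> set es \<longleftrightarrow> e (slot_position n x) = x"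
proof -
  have st: "cancel_step\<^sup>*\<^sup>* (word e n) es" using es unfolding cancels_to_def by blast
  have inj: "inj_on (level n) (set (word e n))"
    using inj_on_level set_word_labels[OF e] by (rule inj_on_subset)
  show sorted: "sorted_wrt (<) (map (level n) es)"
    using cancels_to_strictly_sorted[OF es sorted_word[OF e order_refl] inj] .
  show "set es \<subseteq> labels n" using cancel_steps_set[OF st] set_word_labels[OF e] by blast
  show "odd (length es)" using cancel_steps_parity[OF st, of "\<lambda>_. True"] by simp
  show "es ! k \<in> range Orig" if "k < length es" "odd k" for k
    using cancel_steps_odd_positions[OF st, of "\<lambda>x. x \<in> range Orig" k] word_odd_positions that
    by blast
  show "odd (low_count n i es) \<longleftrightarrow> e i = Orig i" if "1 \<le> i" "i \<le> n" for i
    using cancel_steps_parity[OF st, of "\<lambda>x. level n x \<le> 2 * i + 1"]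
      low_count_word[OF e that order_refl] by (auto simp: low_count_def)
  show "x \<in> set es \<longleftrightarrow> e (slot_position n x) = x"
    if x: "x \<notin> range Orig" "slot_position n x \<le> n" for x
  proof -
    let ?j = "slot_position n x"
    have "{j. j \<le> n \<and> e j = x} = (if e ?j = x then {?j} else {})"
      using slot_position_unique[OF e n] x by auto
    then have "length (filter (\<lambda>z. z = x) (word e n)) = of_bool (e ?j = x)"
      using length_filter_word[OF x(1)] by simp
    moreover have "distinct es"
      using sorted by (simp add: strict_sorted_iff distinct_map)
    then have "length (filter (\<lambda>z. z = x) es) = card ({x} \<inter> set es)"
      by (simp add: distinct_length_filter)
    then have "length (filter (\<lambda>z. z = x) es) = of_bool (x \<in> set es)" by simp
    ultimately show ?thesis
      using cancel_steps_parity[OF st, of "\<lambda>z. z = x"] by (auto split: if_splits)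
  qed
qed

lemma strictly_sorted_filter_le_Suc:
  fixes f :: "'a \<Rightarrow> nat"
  assumes "sorted_wrt (<) (map f xs)"
  shows "filter (\<lambda>x. f x \<le> Suc a) xs = filter (\<lambda>x. f x \<le> a) xs @ filter (\<lambda>x. f x = Suc a) xs"
  using assms
proof (induction xs)
  case (Cons x xs)
  then have gt: "\<forall>z\<in>set xs. f x < f z" by simp
  consider "f x \<le> a" | "f x = Suc a" | "f x > Suc a" by linarith
  then show ?case
  proof cases
    case 2
    then have "filter (\<lambda>x. f x \<le> a) xs = []" using gt by (auto simp: filter_empty_conv)
    then show ?thesis using Cons 2 by simp
  next
    case 3
    then have "filter (\<lambda>x. f x \<le> a) xs = []" using gt by (fastforce simp: filter_empty_conv)
    then show ?thesis using Cons 3 by simp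
  qed (use Cons in auto)
qed simp

lemma strictly_sorted_filter_partition:
  fixes f :: "'a \<Rightarrow> nat"
  assumes "sorted_wrt (<) (map f xs)"
  shows "xs = filter (\<lambda>x. f x \<le> a) xs @ filter (\<lambda>x. \<not> f x \<le> a) xs"
  using assms
proof (induction xs)
  case (Cons x xs)
  show ?case
  proof (cases "f x \<le> a")
    case False
    then have "\<forall>z\<in>set xs. \<not> f z \<le> a" using Cons.prems by auto
    then have "filter (\<lambda>x. f x \<le> a) xs = []" "filter (\<lambda>x. \<not> f x \<le> a) xs = xs"
      by (auto simp: filter_empty_conv filter_id_conv)
    then show ?thesis using False by simp
  qed (use Cons in simp)
qed simp

lemma filter_eq_distinct:
  "distinct xs \<Longrightarrow> filter (\<lambda>z. z = x) xs = (if x \<in> set xs then [x] else [])"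
  by (induction xs) auto

lemma filter_level_Suc:
  assumes sorted: "sorted_wrt (<) (map (level n) es)" and es: "set es \<subseteq> labels n"
    and x: "level n x = Suc a" "\<And>z. z \<in> labels n \<Longrightarrow> level n z = Suc a \<Longrightarrow> z = x"
  shows "filter (\<lambda>z. level n z \<le> Suc a) es
    = filter (\<lambda>z. level n z \<le> a) es @ (if x \<in> set es then [x] else [])"
proof -
  have "filter (\<lambda>z. level n z = Suc a) es = filter (\<lambda>z. z = x) es"
    using es x by (intro filter_cong) auto
  also have "\<dots> = (if x \<in> set es then [x] else [])"
    using sorted by (intro filter_eq_distinct) (simp add: strict_sorted_iff distinct_map)
  finally show ?thesis using strictly_sorted_filter_le_Suc[OF sorted] by simp
qed

lemma filter_level_Mid:
  assumes "sorted_wrt (<) (map (level n) es)" "set es \<subseteq> labels n" "i < n"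
  shows "filter (\<lambda>z. level n z \<le> 2 * i + 2) es
    = filter (\<lambda>z. level n z \<le> 2 * i + 1) es @ (if Mid i \<in> set es then [Mid i] else [])"
proof -
  have "z = Mid i" if "z \<in> labels n" "level n z = Suc (2 * i + 1)" for z
    using that assms(3) by (cases z) (auto, presburger+)
  then show ?thesis using filter_level_Suc[OF assms(1,2), of "Mid i" "2 * i + 1"] by simp
qed

lemma filter_level_Orig:
  assumes "sorted_wrt (<) (map (level n) es)" "set es \<subseteq> labels n" "i < n"
  shows "filter (\<lambda>z. level n z \<le> 2 * Suc i + 1) es
    = filter (\<lambda>z. level n z \<le> 2 * i + 2) es
      @ (if Orig (Suc i) \<in> set es then [Orig (Suc i)] else [])"
proof -
  have "z = Orig (Suc i)" if "z \<in> labels n" "level n z = Suc (2 * i + 2)" for z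
    using that assms(3) by (cases z) (auto, presburger+)
  then show ?thesis using filter_level_Suc[OF assms(1,2), of "Orig (Suc i)" "2 * i + 2"] by simp
qed

lemma low_count_Suc:
  assumes "sorted_wrt (<) (map (level n) es)" "set es \<subseteq> labels n" "i < n"
  shows "low_count n (Suc i) es
    = low_count n i es + of_bool (Mid i \<in> set es) + of_bool (Orig (Suc i) \<in> set es)"
  unfolding low_count_def filter_level_Orig[OF assms] filter_level_Mid[OF assms] by simp

text \<open>The shape of reduced sequences and of \<open>T\<close>-paths alike, without the incidence condition.\<close>

definition reduced_shape :: "nat \<Rightarrow> qvertex list \<Rightarrow> bool" where
  "reduced_shape n es \<longleftrightarrow> sorted_wrt (<) (map (level n) es) \<and> set es \<subseteq> labels n \<and> odd (length es) \<and>
     (\<forall>k<length es. odd k \<longrightarrow> es ! k \<in> range Orig) \<and>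
     (\<exists>k. es ! 0 = Start k) \<and> (\<exists>k. last es = End k)"

text \<open>From \<open>T_i\<close> to \<open>T_{i+1}\<close> the count grows by one for
  \<open>Mid i\<close> and one for \<open>Orig (Suc i)\<close>, if present. Parities and the
  non-diagonal labels therefore determine which diagonals occur, and a strictly sorted list is
  determined by its set.\<close>

lemma reduced_shape_eqI:
  assumes "reduced_shape n xs" "reduced_shape n zs"
    and non_Orig: "\<And>x. x \<notin> range Orig \<Longrightarrow> x \<in> labels n \<Longrightarrow> x \<in> set xs \<longleftrightarrow> x \<in> set zs"
    and parity: "\<And>i. i \<le> n \<Longrightarrow> even (low_count n i xs) \<longleftrightarrow> even (low_count n i zs)"
  shows "xs = zs"
proof (rule strictly_sorted_eqI[of "level n"])
  have x: "sorted_wrt (<) (map (level n) xs)" "set xs \<subseteq> labels n"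
    and z: "sorted_wrt (<) (map (level n) zs)" "set zs \<subseteq> labels n"
    using assms(1,2) unfolding reduced_shape_def by auto
  then show "sorted_wrt (<) (map (level n) xs)" "sorted_wrt (<) (map (level n) zs)"
    "inj_on (level n) (set xs)" using inj_on_subset[OF inj_on_level] by auto
  have "Orig (Suc i) \<in> set xs \<longleftrightarrow> Orig (Suc i) \<in> set zs" if "i < n" for i
  proof -
    have "Mid i \<in> set xs \<longleftrightarrow> Mid i \<in> set zs"
      using non_Orig[of "Mid i"] x(2) z(2) by blast
    then show ?thesis
      using parity[of i] parity[of "Suc i"] that
        low_count_Suc[OF x that] low_count_Suc[OF z that] by (auto split: if_splits)
  qed
  then have "Orig i \<in> set xs \<longleftrightarrow> Orig i \<in> set zs" if "Orig i \<in> labels n" for i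
    using that by (cases i) auto
  note Orig_iff = this
  show "set xs = set zs"
  proof (rule set_eqI)
    fix a
    show "a \<in> set xs \<longleftrightarrow> a \<in> set zs"
    proof (cases "a \<in> labels n")
      case True
      then show ?thesis using non_Orig[of a] Orig_iff by (cases "a \<in> range Orig") blast+
    next
      case False
      then show ?thesis using x(2) z(2) by blast
    qed
  qed
qed

lemma low_count_nth:
  assumes "sorted_wrt (<) (map (level n) es)" "k < length es"
    and "level n (es ! k) = 2 * i + 2"
  shows "low_count n i es = k"
proof -
  have es: "es = take k es @ es ! k # drop (Suc k) es" using assms(2) by (rule id_take_nth_drop)
  have "sorted_wrt (<) (map (level n) (take k es @ es ! k # drop (Suc k) es))"
    using assms(1) es by simp
  then have "\<forall>x\<in>set (take k es). level n x < 2 * i + 2"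
    "\<forall>x\<in>set (drop (Suc k) es). 2 * i + 2 < level n x"
    using assms(3) by (simp_all add: sorted_wrt_append)
  then have "filter (\<lambda>x. level n x \<le> 2 * i + 1) (take k es) = take k es"
    "filter (\<lambda>x. level n x \<le> 2 * i + 1) (drop (Suc k) es) = []"
    by (auto simp: filter_id_conv filter_empty_conv)
  then have "filter (\<lambda>x. level n x \<le> 2 * i + 1) es = take k es"
    using es assms(3) filter_append[of "\<lambda>x. level n x \<le> 2 * i + 1" "take k es" "es ! k # drop (Suc k) es"]
    by simp
  then show ?thesis using assms(2) by (simp add: low_count_def)
qed

text \<open>The unreduced sequence is recovered from the parities of the number of edges up to \<open>T\<^sub>i\<close>.\<close>

definition slots_of :: "nat \<Rightarrow> qvertex list \<Rightarrow> nat \<Rightarrow> qvertex" where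
  "slots_of n es i = (if i = 0 then es ! 0 else if i = n then last es
     else if odd (low_count n i es) then Orig i
     else if Mid i \<in> set es then Mid i else Orig (Suc i))"

lemma slots_of_slots:
  assumes "reduced_shape n es" "1 \<le> n"
  shows "slots n (slots_of n es)"
proof -
  have ne: "es \<noteq> []" and sub: "set es \<subseteq> labels n" using assms by (auto simp: reduced_shape_def)
  then have "es ! 0 \<in> labels n" "last es \<in> labels n" by auto
  then show ?thesis using assms by (auto simp: slots_def slots_of_def reduced_shape_def)
qed

text \<open>The entries \<open>e 0\<close> and \<open>e n\<close> occur once, hence survive; the
  order by level then forces the first entry to be a \<open>Start\<close> and the last to be an
  \<open>End\<close>.\<close>

lemma cancels_to_word_shape:
  assumes e: "slots n e" and n: "1 \<le> n" and es: "cancels_to (word e n) es"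
  shows "reduced_shape n es"
proof -
  note c = cancels_to_word[OF e n es]
  have ne: "es \<noteq> []" using c(3) by auto
  have le: "level n (es ! j) \<le> level n (es ! k)" if "j \<le> k" "k < length es" for j k
    using c(1) that sorted_wrt_nth_less[OF c(1), of j k] by (cases "j = k") auto
  obtain k where k: "e 0 = Start k" "k \<le> 1" using e by (auto simp: slots_def)
  then have "Start k \<in> set es" using c(6)[of "Start k"] by auto
  then obtain i where i: "i < length es" "es ! i = Start k" by (auto simp: in_set_conv_nth)
  have "es ! 0 \<in> labels n" using ne c(2) by auto
  then have first: "\<exists>k. es ! 0 = Start k"
    using le[of 0 i] i k(2) by (cases "es ! 0") auto
  obtain k where k: "e n = End k" using e by (auto simp: slots_def)
  then have "End k \<in> set es" using c(6)[of "End k"] by auto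
  then obtain i where i: "i < length es" "es ! i = End k" by (auto simp: in_set_conv_nth)
  have "last es \<in> labels n" using ne c(2) by auto
  moreover have "level n (es ! i) \<le> level n (last es)"
    using le[of i "length es - 1"] i ne by (simp add: last_conv_nth)
  ultimately have "\<exists>k. last es = End k"
    using i by (cases "last es") auto
  with first c show ?thesis by (auto simp: reduced_shape_def)
qed

text \<open>There are at least three edges, since no edge is both a \<open>Start\<close> and an
  \<open>End\<close>. Odd positions, among them the second and the last but one, carry diagonals,
  with levels between \<open>3\<close> and \<open>2 * n + 1\<close>; this confines
  \<open>Start\<close> and \<open>End\<close> labels to the two ends. A \<open>Mid i\<close> sits at
  an even position, and exactly the edges before it are counted by
  \<open>low_count n i\<close>.\<close>

lemma reduced_shape_low_count:
  assumes es: "reduced_shape n es"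
  shows "low_count n 0 es = 1" "Suc (low_count n n es) = length es"
    "\<And>k. Start k \<in> set es \<longleftrightarrow> es ! 0 = Start k" "\<And>k. End k \<in> set es \<longleftrightarrow> last es = End k"
    "\<And>i. Mid i \<in> set es \<Longrightarrow> even (low_count n i es)"
proof -
  have sorted: "sorted_wrt (<) (map (level n) es)" and sub: "set es \<subseteq> labels n"
    and pos: "\<And>k. k < length es \<Longrightarrow> odd k \<Longrightarrow> \<exists>i. es ! k = Orig i" and odd_es: "odd (length es)"
    using es by (auto simp: reduced_shape_def)
  obtain a b where a: "es ! 0 = Start a" and b: "last es = End b"
    using es by (auto simp: reduced_shape_def)
  have ne: "es \<noteq> []" using odd_es by auto
  have "length es \<noteq> 1" using a b ne by (auto simp: last_conv_nth)
  then have len: "length es \<ge> 3" using odd_es by presburger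
  define L where "L = length es - 1"
  have L: "length es = Suc L" "even L" "2 \<le> L" using len odd_es by (auto simp: L_def)
  have b: "es ! L = End b" using b ne by (simp add: L_def last_conv_nth)
  have le: "level n (es ! j) \<le> level n (es ! k)" if "j \<le> k" "k < length es" for j k
    using that sorted_wrt_nth_less[OF sorted, of j k] by (cases "j = k") auto
  have inL: "es ! k \<in> labels n" if "k < length es" for k using that sub by auto
  have low: "3 \<le> level n (es ! j)" if "1 \<le> j" "j < length es" for j
  proof -
    obtain i where "es ! 1 = Orig i" using pos[of 1] L by auto
    then have "3 \<le> level n (es ! 1)" using inL[of 1] L by auto
    then show ?thesis using le[OF that] by simp
  qed
  have high: "level n (es ! j) \<le> 2 * n + 1" if "j < L" for j
  proof -
    have L1: "L - 1 < length es" "odd (L - 1)" "j \<le> L - 1" using L that by auto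
    then obtain i where i: "es ! (L - 1) = Orig i" using pos by blast
    then have "level n (es ! (L - 1)) \<le> 2 * n + 1" using inL[OF L1(1)] by auto
    then show ?thesis using le[OF L1(3,1)] by simp
  qed
  have first: "j = 0" if "es ! j = Start k" "j < length es" for j k
    using low[of j] inL[of j] that by (cases j) auto
  have lst: "j = L" if "es ! j = End k" "j < length es" for j k
    using high[of j] that L by (cases "j < L") auto
  show "Start k \<in> set es \<longleftrightarrow> es ! 0 = Start k" for k
    using first ne by (auto simp: in_set_conv_nth)
  show "End k \<in> set es \<longleftrightarrow> last es = End k" for k
  proof -
    have "last es = es ! L" using ne by (simp add: last_conv_nth L_def)
    then show ?thesis using lst L by (auto simp: in_set_conv_nth)
  qed
  show "low_count n 0 es = 1"
  proof -
    obtain fs where fs: "es = Start a # fs" using a ne by (cases es) auto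
    have "filter (\<lambda>x. level n x \<le> 1) fs = []"
    proof -
      have "3 \<le> level n x" if "x \<in> set fs" for x
        using that low[of "Suc _"] by (auto simp: fs in_set_conv_nth)
      then show ?thesis by (fastforce simp: filter_empty_conv)
    qed
    moreover have "a \<le> 1" using inL[of 0] a ne by auto
    ultimately show ?thesis by (simp add: low_count_def fs)
  qed
  show "Suc (low_count n n es) = length es"
  proof -
    have "es = butlast es @ [End b]"
      using append_butlast_last_id[OF ne] b by (simp add: last_conv_nth L_def ne)
    moreover have "filter (\<lambda>x. level n x \<le> 2 * n + 1) (butlast es) = butlast es"
      using high by (auto simp: filter_id_conv in_set_conv_nth nth_butlast L)
    ultimately have "filter (\<lambda>x. level n x \<le> 2 * n + 1) es = butlast es"
      using filter_append[of "\<lambda>x. level n x \<le> 2 * n + 1" "butlast es" "[End b]"] by simp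
    then show ?thesis by (simp add: low_count_def L)
  qed
  show "even (low_count n i es)" if "Mid i \<in> set es" for i
  proof -
    from that obtain k where k: "k < length es" "es ! k = Mid i" by (auto simp: in_set_conv_nth)
    then have "low_count n i es = k" using low_count_nth[OF sorted k(1)] by simp
    moreover have "even k" using pos[OF k(1)] k(2) by auto
    ultimately show ?thesis by simp
  qed
qed

text \<open>No deletions are exhibited. Some complete cancellation \<open>fs\<close> of the word
  exists, and its invariants agree with those of \<open>es\<close>.\<close>

lemma cancels_to_slots_of:
  assumes es: "reduced_shape n es" and n: "1 \<le> n"
  shows "cancels_to (word (slots_of n es) n) es"
proof -
  define e where "e = slots_of n es"
  have e: "slots n e" unfolding e_def by (rule slots_of_slots[OF es n])
  note lc = reduced_shape_low_count[OF es]
  have sub: "set es \<subseteq> labels n" and odd_es: "odd (length es)"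
    using es by (auto simp: reduced_shape_def)
  obtain fs where fs: "cancels_to (word e n) fs" using cancels_to_exists by blast
  note c = cancels_to_word[OF e n fs]
  have shape: "reduced_shape n fs" using cancels_to_word_shape[OF e n fs] .
  have "fs = es"
  proof (rule reduced_shape_eqI[OF shape es])
    fix x assume x: "x \<notin> range Orig" "x \<in> labels n"
    have "x \<in> set fs \<longleftrightarrow> e (slot_position n x) = x" using c(6)[OF x(1)] x by (cases x) auto
    also have "\<dots> \<longleftrightarrow> x \<in> set es"
      using x lc(3-5) n by (cases x) (auto simp: e_def slots_of_def)
    finally show "x \<in> set fs \<longleftrightarrow> x \<in> set es" .
  next
    fix i assume i: "i \<le> n"
    consider "i = 0" | "1 \<le> i" "i < n" | "i = n" "1 \<le> n" using i n by linarith
    then show "even (low_count n i fs) \<longleftrightarrow> even (low_count n i es)"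
    proof cases
      case 1
      then show ?thesis using lc(1) reduced_shape_low_count(1)[OF shape] by simp
    next
      case 2
      then show ?thesis using c(5)[of i] by (auto simp: e_def slots_of_def split: if_splits)
    next
      case 3
      then show ?thesis
        using lc(2) reduced_shape_low_count(2)[OF shape] odd_es c(3) by (metis even_Suc)
    qed
  qed
  with fs show ?thesis by (simp add: e_def)
qed


section \<open>Laurent monomials\<close>

text \<open>The flag is the parity of the current step. Allowing both values makes it possible to
  split a sequence at a deleted pair.\<close>

primrec alternating_monomial :: "bool \<Rightarrow> qvertex list \<Rightarrow> laurent" where
  "alternating_monomial b [] = 1"
| "alternating_monomial b (x # xs) = (if b then X x else Xinv x) * alternating_monomial (\<not> b) xs"

lemma alternating_monomial_append:
  "alternating_monomial b (xs @ zs)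
    = alternating_monomial b xs * alternating_monomial (b \<longleftrightarrow> even (length xs)) zs"
proof (induction xs arbitrary: b)
  case (Cons x xs)
  have "(\<not> b \<longleftrightarrow> even (length xs)) = (b \<longleftrightarrow> even (length (x # xs)))" by auto
  then show ?case using Cons by (simp add: mult.assoc)
qed simp

lemma path_monomial_eq: "path_monomial (ws, es) = alternating_monomial True es"
proof -
  let ?A = "\<lambda>m. {k \<in> {1..m}. odd k}" and ?B = "\<lambda>m. {k \<in> {1..m}. even k}"
  have "(\<Prod>k\<in>?A (length es). X (es ! (k - 1))) * (\<Prod>k\<in>?B (length es). Xinv (es ! (k - 1)))
    = alternating_monomial True es"
  proof (induction es rule: rev_induct)
    case (snoc x es)
    let ?m = "length es"
    have A: "?A (Suc ?m) = (if even ?m then insert (Suc ?m) (?A ?m) else ?A ?m)"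
      and B: "?B (Suc ?m) = (if even ?m then ?B ?m else insert (Suc ?m) (?B ?m))"
      by (auto simp: le_Suc_eq)
    have "(\<Prod>k\<in>?A ?m. X ((es @ [x]) ! (k - 1))) = (\<Prod>k\<in>?A ?m. X (es ! (k - 1)))"
      "(\<Prod>k\<in>?B ?m. Xinv ((es @ [x]) ! (k - 1))) = (\<Prod>k\<in>?B ?m. Xinv (es ! (k - 1)))"
      by (intro prod.cong refl; auto simp: nth_append)+
    moreover have "length (es @ [x]) = Suc ?m" by simp
    ultimately show ?case
      unfolding alternating_monomial_append snoc[symmetric]
      by (simp only: A B) (simp add: ac_simps)
  qed simp
  then show ?thesis by (simp add: path_monomial_def)
qed

text \<open>Equal neighbours have opposite exponents, and removing two entries does not change the
  parity of the positions of the others.\<close>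

lemma cancel_step_monomial:
  "cancel_step xs zs \<Longrightarrow> alternating_monomial b xs = alternating_monomial b zs"
proof (erule cancel_step.cases)
  fix es e fs
  have "X e * (Xinv e * a) = a" "Xinv e * (X e * a) = a" for a
    using X_times_Xinv[of e] mult.commute[of "X e" "Xinv e"] by (simp_all flip: mult.assoc)
  then show "xs = es @ [e, e] @ fs \<Longrightarrow> zs = es @ fs \<Longrightarrow> ?thesis"
    by (simp add: alternating_monomial_append)
qed

lemma cancel_steps_monomial:
  "cancel_step\<^sup>*\<^sup>* xs zs \<Longrightarrow> alternating_monomial b xs = alternating_monomial b zs"
  by (induction rule: rtranclp_induct) (simp_all add: cancel_step_monomial)

lemma word_monomial:
  "alternating_monomial True (word e m) = (\<Prod>i=1..m. Xinv (Orig i)) * (\<Prod>i=0..m. X (e i))"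
  by (induction m) (simp_all add: alternating_monomial_append ac_simps)

section \<open>Globally compatible collections as bit sequences\<close>

text \<open>Bit \<open>b i\<close> tells whether the walk arrives at \<open>T\<^sub>i\<close> in its right endpoint, the common
  endpoint of \<open>T\<^sub>1\<close> and \<open>T\<^sub>1\<^sub>,\<^sub>0\<close> being on the right; \<open>d i\<close> is \<open>\<delta>\<^sub>i\<close>.\<close>

definition compatible_bits :: "nat \<Rightarrow> (nat \<Rightarrow> nat) \<Rightarrow> (nat \<Rightarrow> bool) \<Rightarrow> bool" where
  "compatible_bits n d b \<longleftrightarrow>
     (\<forall>i. 1 \<le> i \<and> i < n \<longrightarrow> (if d i = 0 then b i \<longrightarrow> b (Suc i) else b (Suc i) \<longrightarrow> b i))"

text \<open>The edge from the endpoint where \<open>T_i\<close> is left to the one where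
  \<open>T_{i+1}\<close> is reached. For the incompatible pair of bits these two points coincide and
  \<open>Mid i\<close> is a dummy.\<close>

definition slot_of_bits :: "nat \<Rightarrow> (nat \<Rightarrow> nat) \<Rightarrow> (nat \<Rightarrow> bool) \<Rightarrow> nat \<Rightarrow> qvertex" where
  "slot_of_bits n d b i =
     (if i = 0 then Start (if b 1 then 0 else 1)
      else if i = n then End (if b n then 0 else 1)
      else if b i \<noteq> b (Suc i) then Mid i
      else if b i \<longleftrightarrow> d i = 0 then Orig (Suc i) else Orig i)"

text \<open>Sizes \<open>(1, 1)\<close> correspond exactly to the pair of bits that
  \<open>compatible_bits\<close> excludes. The four conditions linking \<open>i - 1\<close> and
  \<open>i\<close> in a GCC all say that both indices prescribe the same bit
  \<open>b i\<close>.\<close>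

definition represents :: "nat \<Rightarrow> (nat \<Rightarrow> nat) \<Rightarrow> (nat \<Rightarrow> bool) \<Rightarrow> collection \<Rightarrow> bool" where
  "represents n d b S \<longleftrightarrow> (\<forall>i. 1 \<le> i \<and> i < n \<longrightarrow>
     card (S (i, 1)) = of_bool (if d i = 0 then b i else b (Suc i)) \<and>
     card (S (i, 2)) = of_bool (if d i = 0 then \<not> b (Suc i) else \<not> b i))"

lemma slots_slot_of_bits: "1 \<le> n \<Longrightarrow> slots n (slot_of_bits n d b)"
  by (auto simp: slots_def slot_of_bits_def)

lemma slot_of_bits_Mid_iff:
  "1 \<le> i \<Longrightarrow> i < n \<Longrightarrow> slot_of_bits n d b i = Mid i \<longleftrightarrow> b i \<noteq> b (Suc i)"
  by (simp add: slot_of_bits_def)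

text \<open>The first bit is visible in the \<open>Start\<close> edge, and afterwards an edge
  \<open>Mid i\<close> marks precisely the changes of bit.\<close>

lemma slot_of_bits_inj:
  assumes "\<And>i. i \<le> n \<Longrightarrow> slot_of_bits n d b i = slot_of_bits n d b' i" "1 \<le> i" "i \<le> n"
  shows "b i = b' i"
proof -
  have "Suc k \<le> n \<Longrightarrow> b (Suc k) = b' (Suc k)" for k
  proof (induction k)
    case 0
    have "slot_of_bits n d b 0 = slot_of_bits n d b' 0" by (rule assms(1)) simp
    moreover have "slot_of_bits n d c 0 = Start 0 \<longleftrightarrow> c (Suc 0)" for c
      by (simp add: slot_of_bits_def)
    ultimately show ?case by metis
  next
    case (Suc k)
    have "slot_of_bits n d b (Suc k) = slot_of_bits n d b' (Suc k)"
      by (rule assms(1)) (use Suc.prems in simp)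
    moreover have "1 \<le> Suc k" "Suc k < n" "b (Suc k) = b' (Suc k)" using Suc by simp_all
    ultimately show ?case
      using slot_of_bits_Mid_iff[of "Suc k" n d b] slot_of_bits_Mid_iff[of "Suc k" n d b'] by metis
  qed
  then show ?thesis using assms(2,3) by (cases i) auto
qed

lemma delta_cases: "delta Q i = 0 \<or> delta Q i = Suc 0"
  by (simp add: delta_def)

lemma alpha_seq_represents:
  assumes n: "2 \<le> n" and S: "represents n (delta Q) b S"
  shows "alpha_seq n Q S = word (slot_of_bits n (delta Q) b) n"
proof -
  have "alpha_term n Q S (2 * i + 1) = slot_of_bits n (delta Q) b i" if i: "i \<le> n" for i
  proof -
    consider "i = 0" | "i = n" "0 < n" | "1 \<le> i" "i < n" using i n by linarith
    then show ?thesis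
    proof cases
      case 1
      then show ?thesis using S n delta_cases[of Q 1]
        by (auto simp: represents_def alpha_term_def slot_of_bits_def numeral_2_eq_2 dest!: spec[of _ 1])
    next
      case 2
      then show ?thesis using S n delta_cases[of Q "n - 1"]
        by (auto simp: represents_def alpha_term_def slot_of_bits_def dest!: spec[of _ "n - 1"])
    next
      case 3
      then show ?thesis using S delta_cases[of Q i]
        by (auto simp: represents_def alpha_term_def slot_of_bits_def Let_def dest!: spec[of _ i])
    qed
  qed
  then have "word (\<lambda>i. alpha_term n Q S (2 * i + 1)) n = word (slot_of_bits n (delta Q) b) n"
    by (rule word_cong)
  then show ?thesis
    unfolding alpha_seq_def by (subst map_upt_eq_word) (simp_all add: alpha_term_def)
qed

lemma y_represents:
  assumes n: "2 \<le> n" and S: "represents n (delta Q) b S" and b: "compatible_bits n (delta Q) b"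
    and i: "i \<le> n"
  shows "y n Q S i = X (slot_of_bits n (delta Q) b i)"
proof -
  consider "i = 0" | "i = n" "0 < n" | "1 \<le> i" "i < n" using i n by linarith
  then show ?thesis
  proof cases
    case 1
    then show ?thesis using S n delta_cases[of Q 1]
      by (auto simp: represents_def y_def slot_of_bits_def numeral_2_eq_2 dest!: spec[of _ 1])
  next
    case 2
    then show ?thesis using S n delta_cases[of Q "n - 1"]
      by (auto simp: represents_def y_def slot_of_bits_def dest!: spec[of _ "n - 1"])
  next
    case 3
    then have "if delta Q i = 0 then b i \<longrightarrow> b (Suc i) else b (Suc i) \<longrightarrow> b i"
      using b by (simp add: compatible_bits_def)
    then show ?thesis using 3 S delta_cases[of Q i]
      by (auto simp: represents_def y_def slot_of_bits_def dest!: spec[of _ i])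
  qed
qed

lemma collection_subset:
  assumes "S \<in> collections n" "1 \<le> i" "i < n"
  shows "S (i, 1) \<subseteq> {GU i}" "S (i, 2) \<subseteq> {GV i}"
proof -
  have "S p \<in> (case p of (i, r) \<Rightarrow> Pow {if r = 1 then GU i else GV i})"
    if "p \<in> {1..n-1} \<times> {1,2}" for p
    using assms(1) that unfolding collections_def by (rule PiE_mem)
  from this[of "(i, 1)"] this[of "(i, 2)"] show "S (i, 1) \<subseteq> {GU i}" "S (i, 2) \<subseteq> {GV i}"
    using assms(2,3) by auto
qed

lemma card_subset_singleton: "A \<subseteq> {x} \<Longrightarrow> card A = of_bool (A = {x})"
  by (auto simp: subset_singleton_iff)

lemma represents_inj:
  assumes S: "S \<in> collections n" "represents n d b S"
    and S': "S' \<in> collections n" "represents n d b' S'"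
    and eq: "\<And>i. 1 \<le> i \<Longrightarrow> i \<le> n \<Longrightarrow> b i = b' i"
  shows "S = S'"
proof (rule PiE_ext)
  show "S \<in> (\<Pi>\<^sub>E (i, r) \<in> {1..n-1} \<times> {1,2}. Pow {if r = 1 then GU i else GV i})"
    "S' \<in> (\<Pi>\<^sub>E (i, r) \<in> {1..n-1} \<times> {1,2}. Pow {if r = 1 then GU i else GV i})"
    using S(1) S'(1) by (simp_all add: collections_def)
  fix p assume "p \<in> {1..n-1} \<times> {1::nat, 2}"
  then obtain i where i: "1 \<le> i" "i < n" "p = (i, 1) \<or> p = (i, 2)"
    by (cases p) fastforce
  have "card (S (i, 1)) = card (S' (i, 1))" "card (S (i, 2)) = card (S' (i, 2))"
    using S(2) S'(2) eq[of i] eq[of "Suc i"] i by (auto simp: represents_def)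
  moreover note collection_subset[OF S(1) i(1,2)] collection_subset[OF S'(1) i(1,2)]
  ultimately have "S (i, 1) = S' (i, 1)" "S (i, 2) = S' (i, 2)"
    by (auto simp: subset_singleton_iff)
  then show "S p = S' p" using i(3) by auto
qed

lemma represents_exists:
  assumes b: "compatible_bits n (delta Q) b"
  shows "\<exists>S\<in>GCCs n Q. represents n (delta Q) b S"
proof -
  define A where "A i r = (if r = (1::nat)
     then (if (if delta Q i = 0 then b i else b (Suc i)) then {GU i} else {})
     else (if (if delta Q i = 0 then \<not> b (Suc i) else \<not> b i) then {GV i} else {}))" for i r
  define S where "S = restrict (\<lambda>(i, r). A i r) ({1..n-1} \<times> {1, 2})"
  have S: "S (i, r) = A i r" if "1 \<le> i" "i < n" "r \<in> {1, 2}" for i r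
    using that by (auto simp: S_def)
  then have rep: "represents n (delta Q) b S"
    by (auto simp: represents_def A_def)
  have "S \<in> collections n"
    unfolding collections_def S_def by (rule restrict_PiE_iff[THEN iffD2]) (auto simp: A_def)
  moreover have "(card (S (i, 1)), card (S (i, 2))) \<noteq> (1, 1)" if "i \<in> {1..n-1}" for i
  proof -
    from that have i: "1 \<le> i" "i < n" by auto
    then have "if delta Q i = 0 then b i \<longrightarrow> b (Suc i) else b (Suc i) \<longrightarrow> b i"
      using b by (simp add: compatible_bits_def)
    moreover have "card (S (i, 1)) = of_bool (if delta Q i = 0 then b i else b (Suc i))"
      "card (S (i, 2)) = of_bool (if delta Q i = 0 then \<not> b (Suc i) else \<not> b i)"
      using rep i by (simp_all add: represents_def)
    ultimately show ?thesis by (auto split: if_splits)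
  qed
  moreover have
    "((delta Q (i-1), delta Q i) = (0,0) \<longrightarrow> card (S (i-1,2)) \<noteq> card (S (i,1))) \<and>
     ((delta Q (i-1), delta Q i) = (1,1) \<longrightarrow> card (S (i-1,1)) \<noteq> card (S (i,2))) \<and>
     ((delta Q (i-1), delta Q i) = (0,1) \<longrightarrow> card (S (i-1,2)) = card (S (i,2))) \<and>
     ((delta Q (i-1), delta Q i) = (1,0) \<longrightarrow> card (S (i-1,1)) = card (S (i,1)))"
    if i: "i \<in> {2..n-1}" for i
  proof -
    obtain j where j: "i = Suc j" "1 \<le> j" "Suc j < n" using i by (cases i) fastforce+
    then have "card (S (k, 1)) = of_bool (if delta Q k = 0 then b k else b (Suc k))"
      "card (S (k, 2)) = of_bool (if delta Q k = 0 then \<not> b (Suc k) else \<not> b k)"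
      if "k = j \<or> k = Suc j" for k
      using rep that by (auto simp: represents_def)
    then show ?thesis using j(1) by simp
  qed
  ultimately have "S \<in> GCCs n Q" unfolding GCCs_def by blast
  with rep show ?thesis by blast
qed

lemma GCC_represented:
  assumes n: "2 \<le> n" and S: "S \<in> GCCs n Q"
  shows "\<exists>b. compatible_bits n (delta Q) b \<and> represents n (delta Q) b S"
proof -
  \<comment> \<open>Bit \<open>i\<close> is read off the sets with index \<open>i\<close>; as there
    are none with index \<open>n\<close>, the last bit comes from those with index
    \<open>n - 1\<close>.\<close>
  define b where "b i = (if i < n
     then (if delta Q i = 0 then card (S (i, 1)) = 1 else card (S (i, 2)) = 0)
     else (if delta Q (n - 1) = 0 then card (S (n - 1, 2)) = 0 else card (S (n - 1, 1)) = 1))" for i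
  have coll: "S \<in> collections n" and
    not11: "\<And>i. 1 \<le> i \<Longrightarrow> i < n \<Longrightarrow> (card (S (i,1)), card (S (i,2))) \<noteq> (1, 1)" and
    compat: "\<And>i. i \<in> {2..n-1} \<Longrightarrow>
        ((delta Q (i-1), delta Q i) = (0,0) \<longrightarrow> card (S (i-1,2)) \<noteq> card (S (i,1))) \<and>
        ((delta Q (i-1), delta Q i) = (1,1) \<longrightarrow> card (S (i-1,1)) \<noteq> card (S (i,2))) \<and>
        ((delta Q (i-1), delta Q i) = (0,1) \<longrightarrow> card (S (i-1,2)) = card (S (i,2))) \<and>
        ((delta Q (i-1), delta Q i) = (1,0) \<longrightarrow> card (S (i-1,1)) = card (S (i,1)))"
    using S unfolding GCCs_def by auto
  have c01: "card (S (i, 1)) = 0 \<or> card (S (i, 1)) = 1" "card (S (i, 2)) = 0 \<or> card (S (i, 2)) = 1"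
    if "1 \<le> i" "i < n" for i
    using card_subset_singleton[OF collection_subset(1)[OF coll that]]
      card_subset_singleton[OF collection_subset(2)[OF coll that]] by auto
  \<comment> \<open>The compatibility conditions make the two readings of bit \<open>i + 1\<close>,
    from index \<open>i\<close> and from index \<open>i + 1\<close>, agree.\<close>
  have next_bit: "b (Suc i) \<longleftrightarrow> (if delta Q i = 0 then card (S (i, 2)) = 0 else card (S (i, 1)) = 1)"
    if i: "1 \<le> i" "i < n" for i
  proof (cases "Suc i < n")
    case True
    then have "b (Suc i) \<longleftrightarrow>
        (if delta Q (Suc i) = 0 then card (S (Suc i, 1)) = 1 else card (S (Suc i, 2)) = 0)"
      by (simp add: b_def)
    moreover have
      "delta Q i = 0 \<Longrightarrow> delta Q (Suc i) = 0 \<Longrightarrow> card (S (i,2)) \<noteq> card (S (Suc i,1))"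
      "delta Q i = Suc 0 \<Longrightarrow> delta Q (Suc i) = Suc 0 \<Longrightarrow> card (S (i,1)) \<noteq> card (S (Suc i,2))"
      "delta Q i = 0 \<Longrightarrow> delta Q (Suc i) = Suc 0 \<Longrightarrow> card (S (i,2)) = card (S (Suc i,2))"
      "delta Q i = Suc 0 \<Longrightarrow> delta Q (Suc i) = 0 \<Longrightarrow> card (S (i,1)) = card (S (Suc i,1))"
      using compat[of "Suc i"] i True by simp_all
    moreover have "1 \<le> Suc i" by simp
    ultimately show ?thesis
      using c01[OF i] c01[OF \<open>1 \<le> Suc i\<close> True] delta_cases[of Q i] delta_cases[of Q "Suc i"]
      by (metis One_nat_def nat.distinct(1))
  next
    case False
    then have "Suc i = n" using i by simp
    then show ?thesis by (auto simp: b_def)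
  qed
  have bit: "b i \<longleftrightarrow> (if delta Q i = 0 then card (S (i, 1)) = 1 else card (S (i, 2)) = 0)"
    if "i < n" for i
    using that by (simp add: b_def)
  have "represents n (delta Q) b S"
    unfolding represents_def
  proof (intro allI impI, elim conjE)
    fix i assume "1 \<le> i" "i < n"
    then show "card (S (i, 1)) = of_bool (if delta Q i = 0 then b i else b (Suc i)) \<and>
     card (S (i, 2)) = of_bool (if delta Q i = 0 then \<not> b (Suc i) else \<not> b i)"
      using next_bit[of i] bit[of i] c01[of i] by auto
  qed
  moreover have "compatible_bits n (delta Q) b"
    unfolding compatible_bits_def
  proof (intro allI impI, elim conjE)
    fix i assume "1 \<le> i" "i < n"
    then show "if delta Q i = 0 then b i \<longrightarrow> b (Suc i) else b (Suc i) \<longrightarrow> b i"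
      using next_bit[of i] bit[of i] c01[of i] not11[of i] by auto
  qed
  ultimately show ?thesis by blast
qed


section \<open>Walks along the strip\<close>

lemma doubleton_cancel: "{a, b} = {a, c} \<Longrightarrow> b = c"
  by (auto simp: doubleton_eq_iff)

text \<open>What the walks need from the geometry: which vertices the edges join, and that each
  vertex belongs to an interval of diagonals.\<close>

locale strip =
  fixes n :: nat and d :: "nat \<Rightarrow> nat" and l r :: "nat \<Rightarrow> 'p" and v w :: 'p
  assumes n_ge_2: "2 \<le> n"
    and l_ne_r: "1 \<le> i \<Longrightarrow> i \<le> n \<Longrightarrow> l i \<noteq> r i"
    and shared_left: "1 \<le> i \<Longrightarrow> i < n \<Longrightarrow> d i = 0 \<Longrightarrow> l (Suc i) = l i \<and> r (Suc i) \<notin> {l i, r i}"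
    and shared_right: "1 \<le> i \<Longrightarrow> i < n \<Longrightarrow> d i \<noteq> 0 \<Longrightarrow> r (Suc i) = r i \<and> l (Suc i) \<notin> {l i, r i}"
    and interval: "1 \<le> i \<Longrightarrow> i \<le> j \<Longrightarrow> j \<le> k \<Longrightarrow> k \<le> n \<Longrightarrow>
      x \<in> {l i, r i} \<Longrightarrow> x \<in> {l k, r k} \<Longrightarrow> x \<in> {l j, r j}"
    and v_not_side: "1 \<le> i \<Longrightarrow> i \<le> n \<Longrightarrow> v \<notin> {l i, r i}"
    and w_not_side: "1 \<le> i \<Longrightarrow> i \<le> n \<Longrightarrow> w \<notin> {l i, r i}"
    and v_ne_w: "v \<noteq> w"
begin

definition ends :: "qvertex \<Rightarrow> 'p set" where
  "ends e = (case e of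
     Orig i \<Rightarrow> {l i, r i}
   | Mid i \<Rightarrow> if d i = 0 then {r i, r (Suc i)} else {l i, l (Suc i)}
   | Start k \<Rightarrow> {v, if k = 0 then r 1 else l 1}
   | End k \<Rightarrow> {if k = 0 then l n else r n, w})"

lemma ends_simps [simp]:
  "ends (Orig i) = {l i, r i}"
  "ends (Mid i) = (if d i = 0 then {r i, r (Suc i)} else {l i, l (Suc i)})"
  "ends (Start k) = {v, if k = 0 then r 1 else l 1}"
  "ends (End k) = {if k = 0 then l n else r n, w}"
  by (simp_all add: ends_def)

text \<open>A walk without its list of vertices. An edge and one of its endpoints determine the
  other, so the vertices can be recovered from the labels.\<close>

primrec reach :: "'p \<Rightarrow> qvertex list \<Rightarrow> 'p \<Rightarrow> bool" where
  "reach x [] z \<longleftrightarrow> x = z"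
| "reach x (e # es) z \<longleftrightarrow> (\<exists>u. ends e = {x, u} \<and> reach u es z)"

lemma reach_append [simp]: "reach x (es @ fs) z \<longleftrightarrow> (\<exists>u. reach x es u \<and> reach u fs z)"
  by (induction es arbitrary: x) auto

lemma reach_deterministic: "reach x es z \<Longrightarrow> reach x es z' \<Longrightarrow> z = z'"
proof (induction es arbitrary: x)
  case (Cons e es)
  then obtain u u' where "ends e = {x, u}" "reach u es z" "ends e = {x, u'}" "reach u' es z'"
    by auto
  then have "u = u'" by (auto simp: doubleton_eq_iff)
  with Cons.IH \<open>reach u es z\<close> \<open>reach u' es z'\<close> show ?case by blast
qed simp

lemma reach_back: "reach x [e, e] z \<Longrightarrow> x = z"
  by (auto simp: doubleton_eq_iff)

text \<open>Traversing an edge twice in a row leads back to the same vertex.\<close>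

lemma cancel_step_reach:
  assumes "cancel_step es fs" "reach x es z"
  shows "reach x fs z"
  using assms(1)
proof cases
  case (1 es' e fs')
  then obtain u u' where u: "reach x es' u" "reach u [e, e] u'" "reach u' fs' z"
    using assms(2) unfolding 1 reach_append by blast
  have "u = u'" using reach_back[OF u(2)] .
  then show ?thesis unfolding 1 reach_append using u by blast
qed

lemma cancel_steps_reach: "cancel_step\<^sup>*\<^sup>* es fs \<Longrightarrow> reach x es z \<Longrightarrow> reach x fs z"
  by (induction rule: rtranclp_induct) (auto intro: cancel_step_reach)

lemma v_ends:
  assumes "e \<in> labels n" "v \<in> ends e"
  shows "\<exists>k. e = Start k"
proof (cases e)
  case (Orig i)
  then show ?thesis using assms v_not_side[of i] by simp
next
  case (Mid i)
  then show ?thesis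
    using assms v_not_side[of i] v_not_side[of "Suc i"] n_ge_2 by (auto split: if_splits)
next
  case (End k)
  then show ?thesis using assms v_not_side[of n] v_ne_w n_ge_2 by (simp split: if_splits)
qed simp

lemma w_ends:
  assumes "e \<in> labels n" "w \<in> ends e"
  shows "\<exists>k. e = End k"
proof (cases e)
  case (Orig i)
  then show ?thesis using assms w_not_side[of i] by simp
next
  case (Mid i)
  then show ?thesis
    using assms w_not_side[of i] w_not_side[of "Suc i"] n_ge_2 by (auto split: if_splits)
next
  case (Start k)
  then show ?thesis using assms w_not_side[of 1] v_ne_w n_ge_2 by (simp split: if_splits)
qed simp

section \<open>Walks given by bits\<close>

definition near :: "(nat \<Rightarrow> bool) \<Rightarrow> nat \<Rightarrow> 'p" where
  "near b i = (if b i then r i else l i)"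

definition far :: "(nat \<Rightarrow> bool) \<Rightarrow> nat \<Rightarrow> 'p" where
  "far b i = (if b i then l i else r i)"

text \<open>Of the three sides of the triangle exactly one joins \<open>far b i\<close> to
  \<open>near b (Suc i)\<close>, unless these vertices coincide, which happens for the incompatible
  pair of bits.\<close>

lemma slot_step:
  assumes "1 \<le> i" "i < n" "e \<in> {Orig i, Orig (Suc i), Mid i}"
  shows "ends e = {far b i, near b (Suc i)} \<longleftrightarrow>
    (if d i = 0 then b i \<longrightarrow> b (Suc i) else b (Suc i) \<longrightarrow> b i) \<and> e = slot_of_bits n d b i"
proof (cases "d i = 0")
  case True
  then have f: "l (Suc i) = l i" "r (Suc i) \<noteq> l i" "r (Suc i) \<noteq> r i" "l i \<noteq> r i"
    using shared_left[OF assms(1,2)] l_ne_r[of i] assms by auto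
  from assms(3) consider "e = Orig i" | "e = Orig (Suc i)" | "e = Mid i" by blast
  then show ?thesis
    using True f f(2-4)[symmetric] assms(1,2)
    by cases (simp_all add: near_def far_def slot_of_bits_def doubleton_eq_iff)
next
  case False
  then have f: "r (Suc i) = r i" "l (Suc i) \<noteq> l i" "l (Suc i) \<noteq> r i" "l i \<noteq> r i"
    using shared_right[OF assms(1,2)] l_ne_r[of i] assms by auto
  from assms(3) consider "e = Orig i" | "e = Orig (Suc i)" | "e = Mid i" by blast
  then show ?thesis
    using False f f(2-4)[symmetric] assms(1,2)
    by cases (simp_all add: near_def far_def slot_of_bits_def doubleton_eq_iff)
qed

lemma ends_Orig: "ends (Orig i) = {near b i, far b i}"
  by (auto simp: near_def far_def)

lemma ends_first_slot: "ends (slot_of_bits n d b 0) = {v, near b 1}"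
  by (simp add: slot_of_bits_def near_def)

lemma ends_last_slot: "ends (slot_of_bits n d b n) = {far b n, w}"
  using n_ge_2 by (simp add: slot_of_bits_def far_def)

lemma reach_word_of_bits:
  assumes b: "compatible_bits n d b"
  shows "reach v (word (slot_of_bits n d b) n) w"
proof -
  have "reach v (word (slot_of_bits n d b) m) (near b (Suc m))" if "m < n" for m
    using that
  proof (induction m)
    case 0
    then show ?case using ends_first_slot by simp
  next
    case (Suc m)
    have "ends (slot_of_bits n d b (Suc m)) = {far b (Suc m), near b (Suc (Suc m))}"
      using b Suc.prems slots_slot_of_bits[of n d b]
      by (subst slot_step) (auto simp: compatible_bits_def slots_def)
    then show ?case using Suc ends_Orig[of "Suc m" b] by (auto simp del: ends_simps)
  qed
  from this[of "n - 1"] have "reach v (word (slot_of_bits n d b) (n - 1)) (near b n)"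
    using n_ge_2 by simp
  moreover have "word (slot_of_bits n d b) n = word (slot_of_bits n d b) (n - 1) @ [Orig n, slot_of_bits n d b n]"
    using n_ge_2 by (intro word_last) simp
  ultimately show ?thesis
    using ends_Orig[of n b] ends_last_slot[of b] by (auto simp del: ends_simps)
qed

text \<open>The even steps traverse every diagonal, so the walk arrives at each \<open>T_i\<close>
  in one of its endpoints, which defines the bit; \<open>slot_step\<close> then identifies the edges
  in between.\<close>

lemma bits_of_reach_word:
  assumes e: "slots n e" and reach: "reach v (word e n) w"
  shows "\<exists>b. compatible_bits n d b \<and> (\<forall>i\<le>n. e i = slot_of_bits n d b i)"
proof -
  have step: "\<exists>p q. reach v (word e m) p \<and> {l (Suc m), r (Suc m)} = {p, q} \<and>
    (\<exists>p'. ends (e (Suc m)) = {q, p'} \<and> reach v (word e (Suc m)) p' \<and> (Suc m = n \<longrightarrow> p' = w))"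
    if m: "m < n" for m
  proof -
    have reach_k: "\<exists>p. reach v (word e k) p \<and> (k = n \<longrightarrow> p = w)" if "k \<le> n" for k
      using that
    proof (induction k rule: inc_induct)
      case base
      then show ?case using reach by blast
    next
      case (step k)
      then obtain p where "reach v (word e (Suc k)) p" by blast
      then obtain u where "reach v (word e k) u" unfolding word.simps reach_append by blast
      then show ?case using step.hyps by auto
    qed
    obtain p' where p': "reach v (word e (Suc m)) p'" "Suc m = n \<longrightarrow> p' = w"
      using reach_k[OF Suc_leI[OF m]] by blast
    then obtain p q where "reach v (word e m) p" "ends (Orig (Suc m)) = {p, q}"
      "ends (e (Suc m)) = {q, p'}" by auto
    then show ?thesis using p' unfolding ends_simps by blast
  qed
  then obtain p q where pq: "\<And>m. m < n \<Longrightarrow> reach v (word e m) (p m)"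
    "\<And>m. m < n \<Longrightarrow> {l (Suc m), r (Suc m)} = {p m, q m}"
    "\<And>m. m < n \<Longrightarrow> \<exists>p'. ends (e (Suc m)) = {q m, p'} \<and> reach v (word e (Suc m)) p' \<and> (Suc m = n \<longrightarrow> p' = w)"
    by metis
  \<comment> \<open>\<open>p m\<close> is the vertex before the step along \<open>T_{m+1}\<close>,
    whence the shift of index.\<close>
  define b where "b i \<longleftrightarrow> p (i - 1) = r i" for i
  have near: "p m = near b (Suc m)" and far: "q m = far b (Suc m)" if "m < n" for m
  proof -
    have "p m = l (Suc m) \<and> q m = r (Suc m) \<or> p m = r (Suc m) \<and> q m = l (Suc m)"
      using pq(2)[OF that] by (metis doubleton_eq_iff)
    moreover have "l (Suc m) \<noteq> r (Suc m)" using l_ne_r[of "Suc m"] that by simp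
    ultimately show "p m = near b (Suc m)" "q m = far b (Suc m)"
      by (auto simp: b_def near_def far_def)
  qed
  have mid: "ends (e i) = {far b i, near b (Suc i)}" if i: "1 \<le> i" "i < n" for i
  proof -
    obtain m where m: "i = Suc m" using \<open>1 \<le> i\<close> by (cases i) auto
    then obtain p' where p': "ends (e i) = {q m, p'}" "reach v (word e i) p'"
      using pq(3)[of m] i(2) Suc_lessD[of m n] unfolding m by blast
    then have "p' = p i" using pq(1)[of i] i reach_deterministic by blast
    then show ?thesis using p'(1) near[of i] far[of m] i m by simp
  qed
  have e_mid: "e i \<in> {Orig i, Orig (Suc i), Mid i}" if "1 \<le> i" "i < n" for i
    using e that by (simp add: slots_def)
  have "compatible_bits n d b"
    using mid slot_step[OF _ _ e_mid] by (auto simp: compatible_bits_def)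
  moreover have "e i = slot_of_bits n d b i" if i: "i \<le> n" for i
  proof -
    consider "i = 0" | "i = n" "0 < n" | "1 \<le> i" "i < n" using i n_ge_2 by linarith
    then show ?thesis
    proof cases
      case 1
      have "ends (e 0) = {v, near b 1}" using pq(1)[of 0] near[of 0] n_ge_2 by simp
      moreover have "e 0 \<in> {Start 0, Start 1}" using e by (simp add: slots_def)
      then obtain k where k: "e 0 = Start k" "k = 0 \<or> k = 1" by blast
      ultimately have "{v, if k = 0 then r 1 else l 1} = {v, near b 1}" by simp
      then have "(if k = 0 then r 1 else l 1) = near b 1" by (rule doubleton_cancel)
      then have "b 1 \<longleftrightarrow> k = 0"
        using l_ne_r[of 1] n_ge_2 by (cases "k = 0"; cases "b 1") (simp_all add: near_def)
      then show ?thesis using 1 k by (auto simp: slot_of_bits_def)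
    next
      case 2
      then obtain m where m: "n = Suc m" by (cases n) auto
      then have "ends (e n) = {far b n, w}" using pq(3)[of m] far[of m] by auto
      moreover have "e n \<in> {End 0, End 1}" using e by (simp add: slots_def)
      then obtain k where k: "e n = End k" "k = 0 \<or> k = 1" by blast
      ultimately have "{w, if k = 0 then l n else r n} = {w, far b n}" by (simp add: insert_commute)
      then have "(if k = 0 then l n else r n) = far b n" by (rule doubleton_cancel)
      then have "b n \<longleftrightarrow> k = 0"
        using l_ne_r[of n] n_ge_2 by (cases "k = 0"; cases "b n") (simp_all add: far_def)
      then show ?thesis using 2 k by (auto simp: slot_of_bits_def)
    next
      case 3
      then show ?thesis using slot_step[OF 3 e_mid[OF 3], of b] mid[OF 3] by simp
    qed
  qed
  ultimately show ?thesis by blast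
qed

text \<open>Level \<open>2 * i + 2\<close> cuts the path just before \<open>T_{i+1}\<close>. The
  last edge \<open>g\<close> before the cut shows \<open>x\<close> on some diagonal with index at
  most \<open>i + 1\<close>, the first edge \<open>h\<close> after it on one with index at least
  \<open>i + 1\<close>. The exceptions \<open>v\<close> and \<open>w\<close> drop out, since
  \<open>h\<close> is no \<open>Start\<close> and \<open>g\<close> no \<open>End\<close>.\<close>

lemma reach_vertex_on_side:
  assumes es: "reduced_shape n es" and reach: "reach v es w" and i: "i < n"
    and x: "reach v (filter (\<lambda>z. level n z \<le> 2 * i + 2) es) x"
  shows "x \<in> {l (Suc i), r (Suc i)}"
proof -
  define pre where "pre = filter (\<lambda>z. level n z \<le> 2 * i + 2) es"
  define post where "post = filter (\<lambda>z. \<not> level n z \<le> 2 * i + 2) es"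
  have sub: "set es \<subseteq> labels n" and sorted: "sorted_wrt (<) (map (level n) es)"
    and ne: "es \<noteq> []"
    and ends_es: "\<exists>k. es ! 0 = Start k" "\<exists>k. last es = End k"
    using es by (auto simp: reduced_shape_def)
  have es_eq: "es = pre @ post"
    unfolding pre_def post_def using sorted by (rule strictly_sorted_filter_partition)
  have first: "es ! 0 \<in> set es" "last es \<in> set es" using ne by auto
  then have "es ! 0 \<in> set pre"
    using ends_es(1) sub i by (auto simp: pre_def)
  then have pre_ne: "pre \<noteq> []" by auto
  have "last es \<in> set post"
    using ends_es(2) first i by (auto simp: post_def)
  then have post_ne: "post \<noteq> []" by auto
  obtain g pre' where g: "pre = pre' @ [g]" using pre_ne by (metis append_butlast_last_id)
  obtain h post' where h: "post = h # post'" using post_ne by (cases post) auto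
  have gx: "x \<in> ends g" using x unfolding pre_def[symmetric] g by auto
  have "reach x post w"
  proof -
    obtain u where "reach v pre u" "reach u post w"
      using reach unfolding es_eq reach_append by blast
    moreover have "u = x"
      using reach_deterministic[OF \<open>reach v pre u\<close>] x by (simp add: pre_def)
    ultimately show ?thesis by simp
  qed
  then have hx: "x \<in> ends h" unfolding h by auto
  have "g \<in> set pre" "h \<in> set post" using g h by simp_all
  then have gh: "g \<in> labels n" "level n g \<le> 2 * i + 2" "h \<in> labels n" "\<not> level n h \<le> 2 * i + 2"
    using sub by (auto simp: pre_def post_def)
  have "x \<noteq> v" using v_ends[OF gh(3)] hx gh(4) gh(3) by auto
  have "x \<noteq> w" using w_ends[OF gh(1)] gx gh(2) i by auto
  have "\<exists>j. 1 \<le> j \<and> j \<le> Suc i \<and> x \<in> {l j, r j}"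
  proof (cases g)
    case (Orig j)
    then show ?thesis using gx gh by (intro exI[of _ j]) auto
  next
    case (Mid j)
    then have "x \<in> {l j, r j} \<or> x \<in> {l (Suc j), r (Suc j)}" using gx by (auto split: if_splits)
    moreover have "1 \<le> j" "j \<le> i" using Mid gh by auto
    ultimately show ?thesis by (meson Suc_le_mono le_Suc_eq le_SucI le_trans)
  next
    case (Start k)
    then show ?thesis using gx \<open>x \<noteq> v\<close> by (intro exI[of _ 1]) (auto split: if_splits)
  next
    case (End k)
    then show ?thesis using gh i by auto
  qed
  moreover have "\<exists>j. Suc i \<le> j \<and> j \<le> n \<and> x \<in> {l j, r j}"
  proof (cases h)
    case (Orig j)
    then show ?thesis using hx gh by (intro exI[of _ j]) auto
  next
    case (Mid j)
    then have "x \<in> {l j, r j} \<or> x \<in> {l (Suc j), r (Suc j)}" using hx by (auto split: if_splits)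
    moreover have "Suc i \<le> j" "Suc j \<le> n" using Mid gh by auto
    ultimately show ?thesis by (meson Suc_leD le_SucI)
  next
    case (End k)
    then show ?thesis using hx \<open>x \<noteq> w\<close> i by (intro exI[of _ n]) (auto split: if_splits)
  next
    case (Start k)
    then show ?thesis using gh by auto
  qed
  ultimately show ?thesis using interval by blast
qed

lemma other_end: "x \<in> {l i, r i} \<Longrightarrow> \<exists>x'. ends (Orig i) = {x, x'}"
  by auto

text \<open>The path and the word are followed in parallel along the strip, cutting both near
  \<open>T_i\<close> at lengths of equal parity.\<close>

lemma reach_word_slots_of:
  assumes es: "reduced_shape n es" and reach: "reach v es w"
  shows "reach v (word (slots_of n es) n) w"
proof -
  define e where "e = slots_of n es"
  define pre where "pre a = filter (\<lambda>z. level n z \<le> a) es" for a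
  have sub: "set es \<subseteq> labels n" and sorted: "sorted_wrt (<) (map (level n) es)"
    using es by (auto simp: reduced_shape_def)
  note lc = reduced_shape_low_count[OF es]
  have e0: "e 0 = es ! 0" by (simp add: e_def slots_of_def)
  have e_i: "e i = (if odd (low_count n i es) then Orig i
      else if Mid i \<in> set es then Mid i else Orig (Suc i))" if "1 \<le> i" "i < n" for i
    using that by (simp add: e_def slots_of_def)
  have Mid_even: "Mid i \<in> set es \<Longrightarrow> even (low_count n i es)" for i by (rule lc(5))
  have pre_reach: "\<exists>x. reach v (pre a) x" for a
  proof -
    have "es = pre a @ filter (\<lambda>z. \<not> level n z \<le> a) es"
      unfolding pre_def using sorted by (rule strictly_sorted_filter_partition)
    then show ?thesis using reach reach_append by metis
  qed
  have on_side: "x \<in> {l (Suc i), r (Suc i)}" if "reach v (pre (2 * i + 2)) x" "i < n" for x i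
    using reach_vertex_on_side[OF es reach that(2)] that(1) by (simp add: pre_def)
  \<comment> \<open>The part of the path up to \<open>T_i\<close> has
    \<open>low_count n i es\<close> edges. If this is odd, it ends where the first
    \<open>2 * i + 1\<close> edges of the word end; if even, where the first \<open>2 * i\<close>
    do.\<close>
  have claim: "if odd (low_count n i es) then i < n \<longrightarrow> reach v (word e i) x
      else 1 \<le> i \<and> reach v (word e (i - 1) @ [Orig i]) x"
    if "i \<le> n" "reach v (pre (2 * i + 1)) x" for i x
    using that
  proof (induction i arbitrary: x)
    case 0
    have "pre 1 = [es ! 0]"
    proof -
      obtain k where k: "es ! 0 = Start k" using es by (auto simp: reduced_shape_def)
      moreover have "es \<noteq> []" using es by (auto simp: reduced_shape_def)
      then have "es ! 0 \<in> set es" by simp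
      ultimately have "es ! 0 \<in> set (pre 1)" using sub by (auto simp: pre_def)
      moreover have "length (pre 1) = 1" using lc(1) by (simp add: low_count_def pre_def)
      ultimately show ?thesis by (cases "pre 1") auto
    qed
    then show ?case using 0 lc(1) e0 by simp
  next
    case (Suc i)
    have i: "i < n" using Suc.prems by simp
    obtain c where c: "reach v (pre (2 * i + 2)) c" using pre_reach by blast
    obtain c' where c': "reach v (pre (2 * i + 1)) c'" using pre_reach by blast
    note IH = Suc.IH[OF less_imp_le[OF i] c']
    have side: "c \<in> {l (Suc i), r (Suc i)}" using on_side[OF c i] .
    then obtain q where q: "ends (Orig (Suc i)) = {c, q}" using other_end by blast
    then have q': "ends (Orig (Suc i)) = {q, c}" by (simp add: insert_commute)
    have c_c': "if Mid i \<in> set es then ends (Mid i) = {c', c} else c = c'"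
    proof -
      have "reach v (pre (2 * i + 1) @ (if Mid i \<in> set es then [Mid i] else [])) c"
        using c filter_level_Mid[OF sorted sub i] unfolding pre_def by simp
      then obtain u where "reach v (pre (2 * i + 1)) u"
        "reach u (if Mid i \<in> set es then [Mid i] else []) c" unfolding reach_append by blast
      moreover have "u = c'" using reach_deterministic[OF calculation(1) c'] .
      ultimately show ?thesis by (simp del: ends_simps split: if_splits)
    qed
    have x: "if Orig (Suc i) \<in> set es then x = q else x = c"
    proof -
      have "reach v (pre (2 * i + 2) @ (if Orig (Suc i) \<in> set es then [Orig (Suc i)] else [])) x"
        using Suc.prems(2) filter_level_Orig[OF sorted sub i] unfolding pre_def by simp
      then obtain u where "reach v (pre (2 * i + 2)) u"
        "reach u (if Orig (Suc i) \<in> set es then [Orig (Suc i)] else []) x"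
        unfolding reach_append by blast
      moreover have "u = c" using reach_deterministic[OF calculation(1) c] .
      ultimately have "if Orig (Suc i) \<in> set es then {c, q} = {c, x} else x = c"
        by (simp add: q del: ends_simps split: if_splits)
      then show ?thesis by (metis doubleton_eq_iff)
    qed
    \<comment> \<open>Let \<open>c\<close> be the endpoint of \<open>T_{i+1}\<close> at which the
      path is cut, \<open>q\<close> the other one. The word, after an odd number of edges, is at
      \<open>c\<close> too iff the path has used an odd number; otherwise it is at
      \<open>q\<close>.\<close>
    have reach_i: "reach v (word e i) (if odd (low_count n i es + of_bool (Mid i \<in> set es)) then c else q)"
    proof (cases "odd (low_count n i es)")
      case True
      then have "Mid i \<notin> set es" using Mid_even by blast
      then show ?thesis using IH True i c_c' by simp
    next
      case False
      then have i1: "1 \<le> i" and IH': "reach v (word e (i - 1) @ [Orig i]) c'" using IH by simp_all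
      have "ends (e i) = {c', if Mid i \<in> set es then c else q}"
        using c_c' q False e_i[OF i1 i] by (simp del: ends_simps)
      then have "reach v ((word e (i - 1) @ [Orig i]) @ [e i]) (if Mid i \<in> set es then c else q)"
        using IH' unfolding reach_append reach.simps by blast
      moreover have "word e i = (word e (i - 1) @ [Orig i]) @ [e i]" using word_last[OF i1] by simp
      ultimately show ?thesis using False by (simp del: ends_simps)
    qed
    have cnt: "low_count n (Suc i) es
        = low_count n i es + of_bool (Mid i \<in> set es) + of_bool (Orig (Suc i) \<in> set es)"
      using low_count_Suc[OF sorted sub i] .
    have go: "reach v (word e i) c \<Longrightarrow> reach v (word e i @ [Orig (Suc i)]) q"
      "reach v (word e i) q \<Longrightarrow> reach v (word e i @ [Orig (Suc i)]) c"
      unfolding reach_append reach.simps using q q' by blast+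
    \<comment> \<open>Here slot \<open>i + 1\<close> repeats \<open>T_{i+1}\<close>, so the word
      goes along this diagonal and back.\<close>
    have turn: "reach v (word e (Suc i)) z"
      if t: "reach v (word e i) z" "z \<in> {c, q}" "odd (low_count n (Suc i) es)" "Suc i < n" for z
    proof -
      have "e (Suc i) = Orig (Suc i)" using e_i[of "Suc i"] t by simp
      moreover obtain z' where "ends (Orig (Suc i)) = {z, z'}" "ends (Orig (Suc i)) = {z', z}"
        using t(2) q q' by blast
      ultimately show ?thesis
        using t(1) unfolding word.simps reach_append reach.simps by metis
    qed
    define B where "B \<longleftrightarrow> odd (low_count n i es + of_bool (Mid i \<in> set es))"
    define z where "z = (if B then c else q)"
    have z: "reach v (word e i) z" "z \<in> {c, q}" using reach_i by (auto simp: B_def z_def)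
    have parity: "odd (low_count n (Suc i) es) \<longleftrightarrow> B \<noteq> (Orig (Suc i) \<in> set es)"
      unfolding cnt B_def by auto
    show ?case
    proof (cases "odd (low_count n (Suc i) es)")
      case True
      then have "x = z" using parity x by (auto simp: z_def split: if_splits)
      then show ?thesis using turn[OF z True] True by simp
    next
      case False
      then have "x = (if B then q else c)" using parity x by (auto split: if_splits)
      then have "reach v (word e i @ [Orig (Suc i)]) x"
        using z(1) go by (cases B) (simp_all only: z_def if_True if_False)
      then show ?thesis using False by (simp del: reach_append)
    qed
  qed
  obtain x where x: "reach v (pre (2 * n + 1)) x" using pre_reach by blast
  have "even (low_count n n es)"
    using lc(2) es by (metis even_Suc reduced_shape_def)
  then have last_step: "1 \<le> n" "reach v (word e (n - 1) @ [Orig n]) x"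
    using claim[OF order_refl x] by simp_all
  define post where "post = filter (\<lambda>z. \<not> level n z \<le> 2 * n + 1) es"
  have es_eq: "es = pre (2 * n + 1) @ post"
    unfolding pre_def post_def using sorted by (rule strictly_sorted_filter_partition)
  then have "length post = 1" using lc(2) unfolding low_count_def pre_def
    by (metis Suc_eq_plus1 add_left_cancel length_append)
  then obtain z where z: "post = [z]" by (cases post) auto
  then have "e n = z" using es_eq n_ge_2 by (simp add: e_def slots_of_def)
  moreover obtain u where "reach v (pre (2 * n + 1)) u" "reach u [z] w"
    using reach es_eq z reach_append by metis
  moreover have "u = x" using reach_deterministic[OF calculation(2) x] .
  ultimately have "ends (e n) = {x, w}" by simp
  then have "reach v ((word e (n - 1) @ [Orig n]) @ [e n]) w"
    using last_step(2) unfolding reach_append reach.simps by blast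
  then show ?thesis using word_last[OF last_step(1), of e] by (simp add: e_def)
qed

text \<open>The endpoint \<open>p\<close> of \<open>Mid i\<close> is dropped at
  \<open>T_{i+1}\<close> and lies only on diagonals up to \<open>T_i\<close>; the endpoint
  \<open>q\<close> is new and lies only on later ones. A traversal from \<open>q\<close> to
  \<open>p\<close> would give \<open>b \<le> i < a\<close>.\<close>

lemma Mid_between:
  assumes i: "1 \<le> i" "i < n" and ab: "1 \<le> a" "a < b" "b \<le> n"
    and ends: "ends (Mid i) = {x, x'}" "x \<in> {l a, r a}" "x' \<in> {l b, r b}"
  shows "a \<le> i" "i < b"
proof -
  obtain p q where pq: "ends (Mid i) = {p, q}" and p: "p \<in> {l i, r i}" "p \<notin> {l (Suc i), r (Suc i)}"
    and q: "q \<in> {l (Suc i), r (Suc i)}" "q \<notin> {l i, r i}"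
  proof (cases "d i = 0")
    case True
    show thesis
      by (rule that[of "r i" "r (Suc i)"])
        (use True shared_left[OF i True] l_ne_r[of i] i in auto)
  next
    case False
    show thesis
      by (rule that[of "l i" "l (Suc i)"])
        (use False shared_right[OF i False] l_ne_r[of i] i in auto)
  qed
  have p_le: "k \<le> i" if "p \<in> {l k, r k}" "k \<le> n" for k
    using interval[of i "Suc i" k p] p i that by (meson not_less_eq_eq le_SucI le_refl)
  have q_ge: "i < k" if "q \<in> {l k, r k}" "1 \<le> k" for k
    using interval[of k i "Suc i" q] q i that by (meson not_less le_SucI le_refl Suc_leI)
  consider "x = p" "x' = q" | "x = q" "x' = p" using pq ends(1) by (metis doubleton_eq_iff)
  then have "a \<le> i \<and> i < b"
  proof cases
    case 1
    then show ?thesis using p_le[of a] q_ge[of b] ends ab by auto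
  next
    case 2
    then have "i < a" "b \<le> i" using p_le[of b] q_ge[of a] ends ab by auto
    then show ?thesis using ab by simp
  qed
  then show "a \<le> i" "i < b" by auto
qed

lemma reach_vertices:
  "reach x es z \<Longrightarrow> \<exists>p. p 0 = x \<and> p (length es) = z \<and> (\<forall>k<length es. ends (es ! k) = {p k, p (Suc k)})"
proof (induction es arbitrary: x)
  case (Cons e es)
  then obtain u where u: "ends e = {x, u}" "reach u es z" by auto
  then obtain p where p: "p 0 = u" "p (length es) = z" "\<forall>k<length es. ends (es ! k) = {p k, p (Suc k)}"
    using Cons.IH by blast
  show ?case
    by (rule exI[of _ "case_nat x p"]) (use u p in \<open>auto simp: nth_Cons split: nat.split\<close>)
qed auto

text \<open>An inner edge at an even list position sits between two diagonals \<open>T_a\<close> and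
  \<open>T_b\<close> with \<open>a < b\<close>. If it is a diagonal, the crossing order places it
  strictly between them; if it is a \<open>Mid i\<close>, \<open>Mid_between\<close> does.
  \<open>Start\<close> and \<open>End\<close> edges are impossible there, because neither
  \<open>v\<close> nor \<open>w\<close> is on a diagonal.\<close>

lemma T_path_reduced_shape:
  assumes sub: "set es \<subseteq> labels n" and reach: "reach v es w" and odd_es: "odd (length es)"
    and odd_pos: "\<And>k. k < length es \<Longrightarrow> odd k \<Longrightarrow> es ! k \<in> range Orig"
    and incr: "\<And>j k a b. j < k \<Longrightarrow> k < length es \<Longrightarrow> es ! j = Orig a \<Longrightarrow> es ! k = Orig b \<Longrightarrow> a < b"
  shows "reduced_shape n es"
proof -
  obtain p where p: "p 0 = v" "p (length es) = w" "\<And>k. k < length es \<Longrightarrow> ends (es ! k) = {p k, p (Suc k)}"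
    using reach_vertices[OF reach] by blast
  define L where "L = length es - 1"
  have L: "length es = Suc L" "even L" using odd_es by (auto simp: L_def elim: oddE)
  have lab: "es ! k \<in> labels n" if "k < length es" for k using that sub by auto
  have first: "\<exists>k. es ! 0 = Start k"
    using v_ends[OF lab, of 0] p(1) p(3)[of 0] L by simp
  have lst: "\<exists>k. es ! L = End k"
    using w_ends[OF lab, of L] p(2) p(3)[of L] L by simp
  have between: "level n (es ! (k - 1)) < level n (es ! k) \<and> level n (es ! k) < level n (es ! (Suc k))"
    if k: "even k" "0 < k" "k < L" for k
  proof -
    have idx: "k - 1 < length es" "Suc k < length es" "k < length es" "odd (k - 1)" "odd (Suc k)"
      "Suc (k - 1) = k" using k L by auto
    obtain a b where ab: "es ! (k - 1) = Orig a" "es ! Suc k = Orig b"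
      using odd_pos[OF idx(1,4)] odd_pos[OF idx(2,5)] by blast
    have bounds: "1 \<le> a" "a \<le> n" "1 \<le> b" "b \<le> n" using lab[OF idx(1)] lab[OF idx(2)] ab by auto
    have "a < b" using incr[OF _ idx(2) ab] by simp
    have x: "p k \<in> {l a, r a}" using p(3)[OF idx(1)] ab idx(6) by auto
    have x': "p (Suc k) \<in> {l b, r b}" using p(3)[OF idx(2)] ab by auto
    have e: "ends (es ! k) = {p k, p (Suc k)}" using p(3)[OF idx(3)] .
    have not_v: "v \<notin> ends (es ! k)" and not_w: "w \<notin> ends (es ! k)"
      using x x' v_not_side[of a] v_not_side[of b] w_not_side[of a] w_not_side[of b] bounds
      unfolding e by blast+
    show ?thesis
    proof (cases "es ! k")
      case (Orig c)
      have "a < c" using incr[OF _ idx(3) ab(1) Orig] k by simp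
      moreover have "c < b" using incr[OF _ idx(2) Orig ab(2)] by simp
      ultimately show ?thesis using Orig ab by simp
    next
      case (Mid i)
      then have i: "1 \<le> i" "i < n" using lab[OF idx(3)] by auto
      have "a \<le> i" "i < b"
        using Mid_between[OF i bounds(1) \<open>a < b\<close> bounds(4) e[unfolded Mid] x x'] by auto
      then show ?thesis using Mid ab by simp
    next
      case (Start c)
      then show ?thesis using not_v by simp
    next
      case (End c)
      then show ?thesis using not_w by simp
    qed
  qed
  have step: "level n (es ! k) < level n (es ! Suc k)" if k: "Suc k < length es" for k
  proof (cases "odd k")
    case True
    show ?thesis
    proof (cases "Suc k = L")
      case True
      obtain a where a: "es ! k = Orig a"
        using odd_pos[OF Suc_lessD[OF k] \<open>odd k\<close>] by blast
      then have "a \<le> n" using lab[OF Suc_lessD[OF k]] by simp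
      then show ?thesis using lst True a by auto
    next
      case False
      then show ?thesis using between[of "Suc k"] True L k by simp
    qed
  next
    case False
    show ?thesis
    proof (cases "k = 0")
      case True
      obtain a where a: "es ! Suc k = Orig a"
        using odd_pos[OF k] True by auto
      obtain c where c: "es ! 0 = Start c" using first by blast
      have "c \<le> 1" using lab[of 0] L c by auto
      moreover have "1 \<le> a" using lab[OF k] a by simp
      ultimately show ?thesis using True a c by simp
    next
      case F: False
      have "Suc k \<noteq> Suc L" using k L by simp
      then show ?thesis using between[of k] False F L k by simp
    qed
  qed
  have "sorted_wrt (<) (map (level n) es)"
    using step unfolding successively_conv_sorted_wrt[OF transp_on_less, symmetric] successively_conv_nth
    by simp
  moreover have "last es = es ! L" using L by (metis L_def last_conv_nth length_0_conv nat.distinct(1))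
  ultimately show ?thesis
    using sub odd_es odd_pos first lst by (auto simp: reduced_shape_def)
qed

end

text \<open>Two reductions of one word share all invariants that determine a reduced sequence,
  whatever the order of deletions.\<close>

lemma cancels_to_word_unique:
  assumes e: "slots n e" and n: "1 \<le> n"
    and es: "cancels_to (word e n) es" and fs: "cancels_to (word e n) fs"
  shows "es = fs"
proof -
  have shapes: "reduced_shape n es" "reduced_shape n fs"
    using cancels_to_word_shape[OF e n] es fs by blast+
  note ces = cancels_to_word(5,6)[OF e n es] and cfs = cancels_to_word(5,6)[OF e n fs]
  show ?thesis
  proof (rule reduced_shape_eqI[OF shapes])
    fix x assume x: "x \<notin> range Orig" "x \<in> labels n"
    then have "slot_position n x \<le> n" by (cases x) auto
    then show "x \<in> set es \<longleftrightarrow> x \<in> set fs" using ces(2) cfs(2) x(1) by blast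
  next
    fix i assume i: "i \<le> n"
    show "even (low_count n i es) \<longleftrightarrow> even (low_count n i fs)"
    proof (cases "i = 0")
      case True
      then show ?thesis using reduced_shape_low_count(1) shapes by simp
    next
      case False
      then have "1 \<le> i" by simp
      then show ?thesis using ces(1)[OF _ i] cfs(1)[OF _ i] by blast
    qed
  qed
qed

text \<open>A label that is not a diagonal reveals its slot. A slot holding a diagonal is
  \<open>Orig i\<close> or \<open>Orig (Suc i)\<close>, and the parity of
  \<open>low_count n i es\<close> decides which.\<close>

lemma cancels_to_word_inj:
  assumes e: "slots n e" and e': "slots n e'" and n: "1 \<le> n"
    and es: "cancels_to (word e n) es" "cancels_to (word e' n) es" and i: "i \<le> n"
  shows "e i = e' i"
proof -
  note c = cancels_to_word(5,6)[OF e n es(1)] and c' = cancels_to_word(5,6)[OF e' n es(2)]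
  have non_Orig: "e' j = x" if "e j = x" "x \<notin> range Orig" "j \<le> n" for j x
  proof -
    have "j = slot_position n x" using slot_position_unique[OF e n that(3)] that by simp
    then show ?thesis using c(2)[OF that(2)] c'(2)[OF that(2)] that by simp
  qed
  have non_Orig': "e j = x" if "e' j = x" "x \<notin> range Orig" "j \<le> n" for j x
  proof -
    have "j = slot_position n x" using slot_position_unique[OF e' n that(3)] that by simp
    then show ?thesis using c(2)[OF that(2)] c'(2)[OF that(2)] that by simp
  qed
  show ?thesis
  proof (cases "e i \<in> range Orig \<and> e' i \<in> range Orig")
    case False
    then show ?thesis using non_Orig[OF refl _ i] non_Orig'[OF refl _ i] by metis
  next
    case True
    have "e 0 \<notin> range Orig" "e n \<notin> range Orig" using e by (auto simp: slots_def)
    then have "i \<noteq> 0" "i \<noteq> n" using True by metis+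
    then have i': "1 \<le> i" "i < n" using i by auto
    have "e i \<in> {Orig i, Orig (Suc i), Mid i}" "e' i \<in> {Orig i, Orig (Suc i), Mid i}"
      using e e' i' by (simp_all add: slots_def)
    then have "e i \<in> {Orig i, Orig (Suc i)}" "e' i \<in> {Orig i, Orig (Suc i)}"
      using True by auto
    moreover have "e i = Orig i \<longleftrightarrow> e' i = Orig i" using c(1) c'(1) i' by simp
    ultimately show ?thesis by auto
  qed
qed

section \<open>The bijection\<close>

context gate_sequence
begin

sublocale walks: strip n "delta Q" l r v w
proof
  fix i assume i: "1 \<le> i" "i < n"
  show "l (Suc i) = l i \<and> r (Suc i) \<notin> {l i, r i}" if "delta Q i = 0"
    using next_gate_0[OF i that] by auto
  show "r (Suc i) = r i \<and> l (Suc i) \<notin> {l i, r i}" if "delta Q i \<noteq> 0"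
    using next_gate_1[OF i that] by auto
qed (use n_ge_2 l_ne_r vertex_interval v_not_gate w_not_gate v_ne_w in blast)+

text \<open>A segment determines its pair of endpoints, so walks in the polygon are walks in the
  abstract strip.\<close>

lemma T_eq_iff:
  assumes "e \<in> labels n"
  shows "T e = closed_segment a b \<longleftrightarrow> walks.ends e = {a, b}"
proof -
  have "\<exists>c d. walks.ends e = {c, d} \<and> T e = closed_segment c d"
  proof (cases e)
    case (Orig i)
    then show ?thesis using assms T_Orig[of i] by auto
  next
    case (Mid i)
    then have "1 \<le> i" "i < n" using assms by auto
    then show ?thesis using Mid next_gate_0(3)[of i] next_gate_1(3)[of i]
      by (cases "delta Q i = 0") auto
  next
    case (Start k)
    then show ?thesis using assms T_Start by auto
  next
    case (End k)
    then show ?thesis using assms T_End by auto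
  qed
  then obtain c d where "walks.ends e = {c, d}" "T e = closed_segment c d" by blast
  then show ?thesis by (simp add: closed_segment_eq)
qed

lemma reach_of_vertices:
  assumes "\<And>k. k < length es \<Longrightarrow> walks.ends (es ! k) = {p k, p (Suc k)}"
  shows "walks.reach (p 0) es (p (length es))"
  using assms
proof (induction es rule: rev_induct)
  case (snoc e es)
  have "walks.ends (es ! k) = {p k, p (Suc k)}" if "k < length es" for k
    using snoc.prems[of k] that by (simp add: nth_append)
  moreover have "walks.ends e = {p (length es), p (Suc (length es))}"
    using snoc.prems[of "length es"] by simp
  ultimately show ?case using snoc.IH by auto
qed simp

lemma walk_iff:
  "walk n P T v w (ws, es) \<longleftrightarrow> set es \<subseteq> labels n \<and> length ws = Suc (length es) \<and>
     ws ! 0 = v \<and> ws ! length es = w \<and>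
     (\<forall>k<length es. walks.ends (es ! k) = {ws ! k, ws ! Suc k})"
    (is "?L \<longleftrightarrow> ?R")
proof
  assume ?L
  then have len: "length ws = Suc (length es)" and vw: "ws ! 0 = v" "ws ! length es = w"
    and seg: "\<And>k. k \<in> {1..length es} \<Longrightarrow>
      es ! (k - 1) \<in> labels n \<and> T (es ! (k - 1)) = closed_segment (ws ! (k - 1)) (ws ! k)"
    by (auto simp: walk_def labels_def)
  have "es ! k \<in> labels n \<and> walks.ends (es ! k) = {ws ! k, ws ! Suc k}" if "k < length es" for k
    using seg[of "Suc k"] that T_eq_iff[of "es ! k" "ws ! k" "ws ! Suc k"] by simp
  then show ?R using len vw by (auto simp: in_set_conv_nth)
next
  assume R: ?R
  have lab: "es ! k \<in> labels n" if "k < length es" for k using R that by auto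
  have seg: "T (es ! k) = closed_segment (ws ! k) (ws ! Suc k)" if "k < length es" for k
    using R T_eq_iff[OF lab[OF that]] that by blast
  have ext: "ws ! k extreme_point_of P" if "k \<le> length es" for k
  proof (cases k)
    case 0
    then show ?thesis using R vw_extreme(1) by simp
  next
    case (Suc j)
    then have "j < length es" using that by simp
    then show ?thesis using T_endpoints_extreme(2)[OF lab seg] Suc by simp
  qed
  have "es ! (k - 1) \<in> labels n \<and> T (es ! (k - 1)) = closed_segment (ws ! (k - 1)) (ws ! k)"
    if k: "k \<in> {1..length es}" for k
  proof -
    have "k - 1 < length es" "Suc (k - 1) = k" using k by auto
    then show ?thesis using lab[of "k - 1"] seg[of "k - 1"] by simp
  qed
  then show ?L using R ext unfolding walk_def labels_def[symmetric] by simp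
qed

lemma walk_reach: "(\<exists>ws. walk n P T v w (ws, es)) \<longleftrightarrow> set es \<subseteq> labels n \<and> walks.reach v es w"
proof
  assume "\<exists>ws. walk n P T v w (ws, es)"
  then obtain ws where ws: "walk n P T v w (ws, es)" by blast
  then show "set es \<subseteq> labels n \<and> walks.reach v es w"
    using reach_of_vertices[of es "\<lambda>k. ws ! k"] unfolding walk_iff by auto
next
  assume R: "set es \<subseteq> labels n \<and> walks.reach v es w"
  then obtain p where p: "p 0 = v" "p (length es) = w"
    "\<forall>k<length es. walks.ends (es ! k) = {p k, p (Suc k)}"
    using walks.reach_vertices by blast
  have "walk n P T v w (map p [0..<Suc (length es)], es)"
    unfolding walk_iff using R p by (simp add: nth_append del: upt_Suc)
  then show "\<exists>ws. walk n P T v w (ws, es)" by blast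
qed

lemma walk_unique:
  assumes "walk n P T v w (ws, es)" "walk n P T v w (ws', es)"
  shows "ws = ws'"
proof (rule nth_equalityI)
  show len: "length ws = length ws'" using assms by (simp add: walk_iff)
  have "k \<le> length es \<Longrightarrow> ws ! k = ws' ! k" for k
  proof (induction k)
    case 0
    then show ?case using assms by (simp add: walk_iff)
  next
    case (Suc k)
    have "walks.ends (es ! k) = {ws ! k, ws ! Suc k}"
      using assms(1) Suc.prems by (simp add: walk_iff)
    moreover have "walks.ends (es ! k) = {ws' ! k, ws' ! Suc k}"
      using assms(2) Suc.prems by (simp add: walk_iff)
    moreover have "ws ! k = ws' ! k" using Suc by simp
    ultimately have "{ws ! k, ws ! Suc k} = {ws ! k, ws' ! Suc k}" by metis
    then show ?case by (rule doubleton_cancel)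
  qed
  then show "ws ! k = ws' ! k" if "k < length ws" for k
    using that assms(1) by (simp add: walk_iff)
qed

text \<open>For a walk, all remaining conditions on a T-path amount to a combinatorial shape:
  crossing means being an \<open>Orig\<close>, and the distance of crossing points from
  \<open>v\<close> orders the diagonals by index.\<close>

lemma T_paths_iff:
  "(ws, es) \<in> T_paths n P T v w \<longleftrightarrow> walk n P T v w (ws, es) \<and> reduced_shape n es"
proof
  assume L: "(ws, es) \<in> T_paths n P T v w"
  then have walk: "walk n P T v w (ws, es)" and odd_es: "odd (length es)"
    and crossing: "\<And>k. k \<in> {1..length es} \<Longrightarrow> even k \<Longrightarrow> crosses (T (es ! (k-1))) (closed_segment v w)"
    and order: "\<And>j k. j \<in> {1..length es} \<Longrightarrow> k \<in> {1..length es} \<Longrightarrow> j < k \<Longrightarrow>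
        crosses (T (es ! (j-1))) (closed_segment v w) \<Longrightarrow>
        crosses (T (es ! (k-1))) (closed_segment v w) \<Longrightarrow>
        dist v (crossing_point v w (T (es ! (j-1)))) < dist v (crossing_point v w (T (es ! (k-1))))"
    unfolding T_paths_def by blast+
  have sub: "set es \<subseteq> labels n" and reach: "walks.reach v es w" using walk walk_reach by blast+
  have lab: "es ! k \<in> labels n" if "k < length es" for k using sub that by auto
  have "es ! k \<in> range Orig" if "k < length es" "odd k" for k
    using crossing[of "Suc k"] crosses_iff[OF lab[OF that(1)]] that by simp
  moreover have "a < b"
    if jk: "j < k" "k < length es" and ab: "es ! j = Orig a" "es ! k = Orig b" for j k a b
  proof (rule ccontr)
    assume "\<not> a < b"
    have j: "j < length es" using jk by simp
    have "crosses (T (es ! j)) (closed_segment v w)" "crosses (T (es ! k)) (closed_segment v w)"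
      using crosses_iff[OF lab[OF j]] crosses_iff[OF lab[OF jk(2)]] ab by auto
    then have "dist v (crossing_point v w (T (Orig a))) < dist v (crossing_point v w (T (Orig b)))"
      using order[of "Suc j" "Suc k"] jk ab by simp
    moreover have "1 \<le> b" "a \<le> n" using lab[OF j] lab[OF jk(2)] ab by auto
    ultimately show False
      using dist_crossing_point_less[of b a] \<open>\<not> a < b\<close> by (cases "a = b") auto
  qed
  ultimately show "walk n P T v w (ws, es) \<and> reduced_shape n es"
    using walk walks.T_path_reduced_shape[OF sub reach odd_es] by blast
next
  assume R: "walk n P T v w (ws, es) \<and> reduced_shape n es"
  then have sub: "set es \<subseteq> labels n" and sorted: "sorted_wrt (<) (map (level n) es)"
    and odd_es: "odd (length es)" and pos: "\<And>k. k < length es \<Longrightarrow> odd k \<Longrightarrow> es ! k \<in> range Orig"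
    by (auto simp: reduced_shape_def)
  have lab: "es ! (k - 1) \<in> labels n" if "k \<in> {1..length es}" for k using sub that by auto
  have "distinct es" using sorted by (simp add: strict_sorted_iff distinct_map)
  moreover have "crosses (T (es ! (k-1))) (closed_segment v w)" if k: "k \<in> {1..length es}" "even k" for k
  proof -
    have "k - 1 < length es" "odd (k - 1)" using k by auto
    then show ?thesis using crosses_iff[OF lab[OF k(1)]] pos by blast
  qed
  moreover have "dist v (crossing_point v w (T (es ! (j-1)))) < dist v (crossing_point v w (T (es ! (k-1))))"
    if jk: "j \<in> {1..length es}" "k \<in> {1..length es}" "j < k"
      and c: "crosses (T (es ! (j-1))) (closed_segment v w)" "crosses (T (es ! (k-1))) (closed_segment v w)"
    for j k
  proof -
    obtain a b where ab: "es ! (j - 1) = Orig a" "es ! (k - 1) = Orig b"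
      using c crosses_iff[OF lab[OF jk(1)]] crosses_iff[OF lab[OF jk(2)]] by blast
    have "j - 1 < k - 1" "k - 1 < length es" using jk by auto
    then have "level n (es ! (j - 1)) < level n (es ! (k - 1))"
      using sorted_wrt_nth_less[OF sorted, of "j - 1" "k - 1"] by simp
    then have "a < b" using ab by simp
    moreover have "1 \<le> a" "b \<le> n" using lab[OF jk(1)] lab[OF jk(2)] ab by auto
    ultimately show ?thesis using dist_crossing_point_less ab by simp
  qed
  ultimately show "(ws, es) \<in> T_paths n P T v w" using R odd_es unfolding T_paths_def by blast
qed

lemma GCC_word:
  assumes "S \<in> GCCs n Q"
  obtains b where "compatible_bits n (delta Q) b" "represents n (delta Q) b S"
    "alpha_seq n Q S = word (slot_of_bits n (delta Q) b) n" "slots n (slot_of_bits n (delta Q) b)"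
proof -
  obtain b where "compatible_bits n (delta Q) b" "represents n (delta Q) b S"
    using GCC_represented[OF n_ge_2 assms] by blast
  moreover have "1 \<le> n" using n_ge_2 by simp
  ultimately show thesis using that alpha_seq_represents[OF n_ge_2] slots_slot_of_bits by blast
qed

lemma alpha_seq_reach:
  assumes "S \<in> GCCs n Q"
  shows "set (alpha_seq n Q S) \<subseteq> labels n" "walks.reach v (alpha_seq n Q S) w"
proof -
  obtain b where b: "compatible_bits n (delta Q) b"
    "alpha_seq n Q S = word (slot_of_bits n (delta Q) b) n" "slots n (slot_of_bits n (delta Q) b)"
    using GCC_word[OF assms] by blast
  then show "set (alpha_seq n Q S) \<subseteq> labels n" "walks.reach v (alpha_seq n Q S) w"
    using set_word_labels walks.reach_word_of_bits by simp_all
qed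

lemma ex1_alpha_walk:
  assumes "S \<in> GCCs n Q"
  shows "\<exists>!ws. walk n P T v w (ws, alpha_seq n Q S)"
  using walk_reach[of "alpha_seq n Q S"] alpha_seq_reach[OF assms] walk_unique by blast

lemma ex1_cancels_to:
  assumes "S \<in> GCCs n Q"
  shows "\<exists>!es. cancels_to (alpha_seq n Q S) es"
proof -
  obtain b where b: "alpha_seq n Q S = word (slot_of_bits n (delta Q) b) n"
    "slots n (slot_of_bits n (delta Q) b)"
    using GCC_word[OF assms] by blast
  have "1 \<le> n" using n_ge_2 by simp
  then show ?thesis
    using cancels_to_exists cancels_to_word_unique[OF b(2)] unfolding b(1) by metis
qed

lemma ex1_reduced_path:
  assumes S: "S \<in> GCCs n Q"
  shows "\<exists>!\<alpha>. reduced_path n Q P T v w S \<alpha>"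
proof -
  obtain es where es: "cancels_to (alpha_seq n Q S) es" using ex1_cancels_to[OF S] by blast
  then have steps: "cancel_step\<^sup>*\<^sup>* (alpha_seq n Q S) es" by (simp add: cancels_to_def)
  have "set es \<subseteq> labels n" "walks.reach v es w"
    using cancel_steps_set[OF steps] walks.cancel_steps_reach[OF steps] alpha_seq_reach[OF S] by blast+
  then obtain ws where ws: "walk n P T v w (ws, es)" using walk_reach by blast
  show ?thesis
  proof (rule ex1I[of _ "(ws, es)"])
    show "reduced_path n Q P T v w S (ws, es)" using ws es by (simp add: reduced_path_def)
    fix \<alpha> assume \<alpha>: "reduced_path n Q P T v w S \<alpha>"
    obtain ws' es' where [simp]: "\<alpha> = (ws', es')" by (cases \<alpha>)
    have "es' = es" using \<alpha> es ex1_cancels_to[OF S] by (auto simp: reduced_path_def)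
    then show "\<alpha> = (ws, es)" using \<alpha> ws walk_unique by (auto simp: reduced_path_def)
  qed
qed

lemma psi_eq_iff:
  "S \<in> GCCs n Q \<Longrightarrow> psi n Q P T v w S = \<alpha> \<longleftrightarrow> reduced_path n Q P T v w S \<alpha>"
  unfolding psi_def using ex1_reduced_path[of S] by (metis (mono_tags, lifting) the1_equality theI')

lemma inj_on_psi: "inj_on (psi n Q P T v w) (GCCs n Q)"
proof (rule inj_onI)
  fix S S' assume S: "S \<in> GCCs n Q" and S': "S' \<in> GCCs n Q"
    and eq: "psi n Q P T v w S = psi n Q P T v w S'"
  have n: "1 \<le> n" using n_ge_2 by simp
  obtain ws es where psi: "psi n Q P T v w S = (ws, es)" by fastforce
  have es: "cancels_to (alpha_seq n Q S) es" "cancels_to (alpha_seq n Q S') es"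
    using psi eq psi_eq_iff[OF S, of "(ws, es)"] psi_eq_iff[OF S', of "(ws, es)"]
    by (auto simp: reduced_path_def)
  obtain b where b: "represents n (delta Q) b S"
    "alpha_seq n Q S = word (slot_of_bits n (delta Q) b) n" "slots n (slot_of_bits n (delta Q) b)"
    using GCC_word[OF S] by blast
  obtain b' where b': "represents n (delta Q) b' S'"
    "alpha_seq n Q S' = word (slot_of_bits n (delta Q) b') n" "slots n (slot_of_bits n (delta Q) b')"
    using GCC_word[OF S'] by blast
  have "slot_of_bits n (delta Q) b i = slot_of_bits n (delta Q) b' i" if "i \<le> n" for i
    using cancels_to_word_inj[OF b(3) b'(3) n _ _ that] es unfolding b(2) b'(2) by blast
  then have "b i = b' i" if "1 \<le> i" "i \<le> n" for i using slot_of_bits_inj that by blast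
  moreover have "S \<in> collections n" "S' \<in> collections n" using S S' by (auto simp: GCCs_def)
  ultimately show "S = S'" using represents_inj b(1) b'(1) by blast
qed

text \<open>For surjectivity, the word recovered from a T-path is a walk, hence given by compatible
  bits, hence by a GCC; its cancellation is the given path.\<close>

lemma psi_image: "psi n Q P T v w ` GCCs n Q = T_paths n P T v w"
proof (intro equalityI subsetI)
  fix \<alpha> assume "\<alpha> \<in> psi n Q P T v w ` GCCs n Q"
  then obtain S where S: "S \<in> GCCs n Q" "psi n Q P T v w S = \<alpha>" by blast
  obtain ws es where \<alpha>: "\<alpha> = (ws, es)" by fastforce
  have red: "walk n P T v w (ws, es)" "cancels_to (alpha_seq n Q S) es"
    using psi_eq_iff[OF S(1), of "(ws, es)"] S(2) \<alpha> by (auto simp: reduced_path_def)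
  obtain b where b: "alpha_seq n Q S = word (slot_of_bits n (delta Q) b) n"
    "slots n (slot_of_bits n (delta Q) b)"
    using GCC_word[OF S(1)] by blast
  have "reduced_shape n es"
    using cancels_to_word_shape[OF b(2)] red(2) n_ge_2 unfolding b(1) by simp
  then show "\<alpha> \<in> T_paths n P T v w" using red(1) T_paths_iff \<alpha> by blast
next
  fix \<alpha> assume "\<alpha> \<in> T_paths n P T v w"
  moreover obtain ws es where \<alpha>: "\<alpha> = (ws, es)" by fastforce
  ultimately have walk: "walk n P T v w (ws, es)" and es: "reduced_shape n es"
    using T_paths_iff by blast+
  have n: "1 \<le> n" using n_ge_2 by simp
  have "walks.reach v (word (slots_of n es) n) w"
    using walks.reach_word_slots_of[OF es] walk walk_reach by blast
  then obtain b where b: "compatible_bits n (delta Q) b"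
    "\<And>i. i \<le> n \<Longrightarrow> slots_of n es i = slot_of_bits n (delta Q) b i"
    using walks.bits_of_reach_word[OF slots_of_slots[OF es n]] by blast
  obtain S where S: "S \<in> GCCs n Q" "represents n (delta Q) b S"
    using represents_exists[OF b(1)] by blast
  have "alpha_seq n Q S = word (slots_of n es) n"
    using alpha_seq_represents[OF n_ge_2 S(2)] word_cong[of n "slots_of n es"] b(2) by simp
  then have "reduced_path n Q P T v w S \<alpha>"
    using walk cancels_to_slots_of[OF es n] \<alpha> by (simp add: reduced_path_def)
  then have "psi n Q P T v w S = \<alpha>" using psi_eq_iff[OF S(1)] by blast
  then show "\<alpha> \<in> psi n Q P T v w ` GCCs n Q" using S(1) by blast
qed

text \<open>Before cancellation the identity is a regrouping of factors: the even entries of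
  \<alpha>' are the diagonals, and entry \<open>2 * i + 1\<close> has the variable
  \<open>y n Q S i\<close>. Cancellation does not change the monomial.\<close>

lemma monomial_psi:
  assumes S: "S \<in> GCCs n Q"
  shows "(\<Prod>i=1..n. Xinv (Orig i)) * (\<Prod>i=0..n. y n Q S i) = path_monomial (psi n Q P T v w S)"
proof -
  obtain ws es where psi: "psi n Q P T v w S = (ws, es)" by fastforce
  then have steps: "cancel_step\<^sup>*\<^sup>* (alpha_seq n Q S) es"
    using psi_eq_iff[OF S, of "(ws, es)"] by (simp add: reduced_path_def cancels_to_def)
  obtain b where b: "compatible_bits n (delta Q) b" "represents n (delta Q) b S"
    "alpha_seq n Q S = word (slot_of_bits n (delta Q) b) n"
    using GCC_word[OF S] by blast
  have "path_monomial (psi n Q P T v w S)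
      = alternating_monomial True (word (slot_of_bits n (delta Q) b) n)"
    using cancel_steps_monomial[OF steps] psi path_monomial_eq b(3) by simp
  also have "\<dots> = (\<Prod>i=1..n. Xinv (Orig i)) * (\<Prod>i=0..n. X (slot_of_bits n (delta Q) b i))"
    by (rule word_monomial)
  also have "(\<Prod>i=0..n. X (slot_of_bits n (delta Q) b i)) = (\<Prod>i=0..n. y n Q S i)"
    using y_represents[OF n_ge_2 b(2,1)] by (intro prod.cong) simp_all
  finally show ?thesis by simp
qed

end

theorem theorem9p3:
  fixes n :: nat and Q :: "nat pair_pre_digraph"
    and P :: "complex set" and T :: "qvertex \<Rightarrow> complex set" and v w :: complex
  assumes "n \<ge> 2"
    and "linear_quiver n Q"
    and "labelled_triangulation n Q P T"
    and "common_endpoint v (T (Start 0)) (T (Start 1))"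
    and "common_endpoint w (T (End 0)) (T (End 1))"
  shows "(\<forall>S\<in>GCCs n Q.
            (\<exists>!ws. walk n P T v w (ws, alpha_seq n Q S)) \<and>
            (\<exists>!es. cancels_to (alpha_seq n Q S) es) \<and>
            (\<exists>!\<alpha>. reduced_path n Q P T v w S \<alpha>)) \<and>
         bij_betw (psi n Q P T v w) (GCCs n Q) (T_paths n P T v w) \<and>
         (\<forall>S\<in>GCCs n Q.
            (\<Prod>i=1..n. Xinv (Orig i)) * (\<Prod>i=0..n. y n Q S i)
              = path_monomial (psi n Q P T v w S))"
proof -
  interpret quiver_triangulation n Q P T
    using assms(1-3) by unfold_locales
  obtain l r where lr:
    "\<And>i. 1 \<le> i \<Longrightarrow> i \<le> n \<Longrightarrow> T (Orig i) = closed_segment (l i) (r i)"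
    "\<And>i. 1 \<le> i \<Longrightarrow> i < n \<Longrightarrow> next_gate i (l i, r i) (l (Suc i), r (Suc i))"
    "T (Start 0) = closed_segment v (r 1)" "T (Start 1) = closed_segment v (l 1)"
    "ori (r 1) (l 1) v > 0"
    "T (End 0) = closed_segment (l n) w" "T (End 1) = closed_segment (r n) w"
    "ori (l n) (r n) w > 0"
    using gates[OF assms(4,5)] by blast
  interpret gate_sequence n Q P T l r v w
    by unfold_locales (use lr in blast)+
  show ?thesis
    using ex1_alpha_walk ex1_cancels_to ex1_reduced_path inj_on_psi psi_image monomial_psi
    unfolding bij_betw_def by blast
qed

end
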